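(* Let $\mathcal{C}$ be any family of finite structures (in a common first-order language). The following are equivalent: (1) $\mathcal{C}$ is proficient. (2) $\mathcal{C}$ has $LFP$-sOP. (3) There are some $n$ and an $LFP$ formula $\lambda(y_1;y_2)$, with $y_1,y_2$ $n$-tuples of variables (so $\lambda$ is $2n$-ary), such that for each $\mathbf{M}\in\mathcal{C}$, $\lambda$ defines a partial preorder on $M^n$, and the lengths of chains (strictly increasing sequences) in these preorders are unbounded as $\mathbf{M}$ varies over $\mathcal{C}$. (4) There are some $n$ and a $2n$-ary $LFP$ formula $\lambda(y_1;y_2)$ such that for each $\mathbf{M}\in\mathcal{C}$, $\lambda$ defines a linear (total) preorder on $M^n$, and the order types of these preorders are unbounded as $\mathbf{M}$ varies over $\mathcal{C}$.
   Context: Least fixed-point ($LFP$) logic extends first-order logic ($FO$) by relation variables and the rule: if $\varphi$ is a formula in which an $n$-ary relation variable $S$ occurs only positively (within an even number of negations), $x$ is an $n$-tuple of free variables and $u$ a fresh $n$-tuple, then $[\mathbf{lfp}\,Sx.\varphi](u)$ is a formula in which $S,x$ are bound and $u$ is free. An $LFP$ formula is one in which all relation variables are bound. Semantics: in a structure $\mathbf{A}$ (other free variables fixed), write $\varphi(x;S)$ and let $\Gamma(X)=\{b\in A^n:\mathbf{A}\models\varphi(b;X)\}$ (monotone); define stages $I^\xi_\varphi=\Gamma(\bigcup_{\eta<\xi}I^\eta_\varphi)$ and $I_\varphi=\bigcup_\xi I^\xi_\varphi$; then $[\mathbf{lfp}\,Sx.\varphi](u)$ holds iff $u\in I_\varphi$.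 The closure ordinal $\|\varphi\|_{\mathbf{A}}$ is the least $\kappa$ with $I_\varphi=I_\varphi^\kappa$. A class $\mathcal{C}$ of finite structures is proficient if for some formula $\varphi(x;S)$ (positive elementary, i.e. first-order with $S$ occurring only positively) the closure ordinals $\|\varphi\|_{\mathbf{A}}$ are unbounded as $\mathbf{A}$ ranges over $\mathcal{C}$. For a partitioned formula $\varphi(x;y)$ ($x,y$ tuples of variables), $\varphi$ has an $n$-instance of the strict order property (sOP($n$)) in $\mathbf{M}$ if there are $b_1,\dots,b_n\in M^y$ with $\varphi(M^x;b_1)\subsetneq\dots\subsetneq\varphi(M^x;b_n)$, where $\varphi(M^x;b)=\{a\in M^x:\mathbf{M}\models\varphi(a;b)\}$. $\mathcal{C}$ has $LFP$-sOP if some $LFP$ formula $\varphi(x;y)$ is such that for every $n<\omega$ there is $\mathbf{M}\in\mathcal{C}$ in which $\varphi$ has sOP($n$). *)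

theory Defs
  imports Main
begin

section \<open>Languages and structures\<close>

text \<open>A first-order language is given by explicit sets of symbols inside the symbol types, so
  that purely relational (or purely functional) languages are included.  Constants are function
  symbols of arity 0.\<close>

record ('f, 'r) language =
  funs :: "'f set"
  fun_ar :: "'f \<Rightarrow> nat"
  rels :: "'r set"
  rel_ar :: "'r \<Rightarrow> nat"

record ('a, 'f, 'r) fo_struct =
  univ :: "'a set"
  fun_int :: "'f \<Rightarrow> 'a list \<Rightarrow> 'a"
  rel_int :: "'r \<Rightarrow> 'a list set"

definition tuples :: "'a set \<Rightarrow> nat \<Rightarrow> 'a list set" where
  "tuples A n = {as. length as = n \<and> set as \<subseteq> A}"

definition is_structure :: "('f, 'r) language \<Rightarrow> ('a, 'f, 'r) fo_struct \<Rightarrow> bool" where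
  "is_structure L M \<longleftrightarrow>
     univ M \<noteq> {} \<and>
     (\<forall>f \<in> funs L. \<forall>as \<in> tuples (univ M) (fun_ar L f). fun_int M f as \<in> univ M) \<and>
     (\<forall>r \<in> rels L. rel_int M r \<subseteq> tuples (univ M) (rel_ar L r))"

definition finite_structure :: "('f, 'r) language \<Rightarrow> ('a, 'f, 'r) fo_struct \<Rightarrow> bool" where
  "finite_structure L M \<longleftrightarrow> is_structure L M \<and> finite (univ M)"


section \<open>Syntax\<close>

datatype 'f tm = Var nat | App 'f "'f tm list"

text \<open>A relation variable \<open>(i, n)\<close> is the \<open>i\<close>-th relation variable of arity \<open>n\<close>.\<close>

type_synonym rvar = "nat \<times> nat"

abbreviation arity :: "rvar \<Rightarrow> nat" where
  "arity \<equiv> snd"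

text \<open>\<open>Lfp S xs \<phi> us\<close> stands for \<open>[lfp S xs. \<phi>](us)\<close>.  The remaining connectives
  and the universal quantifier are defined from negation, conjunction and \<open>Exi\<close> as usual.\<close>

datatype ('f, 'r) fm =
    Eq "'f tm" "'f tm"
  | Rel 'r "'f tm list"
  | RVar rvar "'f tm list"
  | Neg "('f, 'r) fm"
  | Conj "('f, 'r) fm" "('f, 'r) fm"
  | Exi nat "('f, 'r) fm"
  | Lfp rvar "nat list" "('f, 'r) fm" "nat list"

fun tvars :: "'f tm \<Rightarrow> nat set" where
  "tvars (Var i) = {i}"
| "tvars (App f ts) = (\<Union>t \<in> set ts. tvars t)"

text \<open>All first-order variables occurring in a formula, free or bound.\<close>

primrec vars :: "('f, 'r) fm \<Rightarrow> nat set" where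
  "vars (Eq s t) = tvars s \<union> tvars t"
| "vars (Rel r ts) = (\<Union>t \<in> set ts. tvars t)"
| "vars (RVar S ts) = (\<Union>t \<in> set ts. tvars t)"
| "vars (Neg \<phi>) = vars \<phi>"
| "vars (Conj \<phi> \<psi>) = vars \<phi> \<union> vars \<psi>"
| "vars (Exi i \<phi>) = insert i (vars \<phi>)"
| "vars (Lfp S xs \<phi> us) = set xs \<union> vars \<phi> \<union> set us"

primrec fv :: "('f, 'r) fm \<Rightarrow> nat set" where
  "fv (Eq s t) = tvars s \<union> tvars t"
| "fv (Rel r ts) = (\<Union>t \<in> set ts. tvars t)"
| "fv (RVar S ts) = (\<Union>t \<in> set ts. tvars t)"
| "fv (Neg \<phi>) = fv \<phi>"
| "fv (Conj \<phi> \<psi>) = fv \<phi> \<union> fv \<psi>"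
| "fv (Exi i \<phi>) = fv \<phi> - {i}"
| "fv (Lfp S xs \<phi> us) = (fv \<phi> - set xs) \<union> set us"

primrec frv :: "('f, 'r) fm \<Rightarrow> rvar set" where
  "frv (Eq s t) = {}"
| "frv (Rel r ts) = {}"
| "frv (RVar S ts) = {S}"
| "frv (Neg \<phi>) = frv \<phi>"
| "frv (Conj \<phi> \<psi>) = frv \<phi> \<union> frv \<psi>"
| "frv (Exi i \<phi>) = frv \<phi>"
| "frv (Lfp S xs \<phi> us) = frv \<phi> - {S}"

text \<open>\<open>occurs_parity e S \<phi>\<close>: every free occurrence of \<open>S\<close> in \<open>\<phi>\<close> lies within an even
  (if \<open>e\<close>) or odd (if \<open>\<not> e\<close>) number of negations.\<close>

primrec occurs_parity :: "bool \<Rightarrow> rvar \<Rightarrow> ('f, 'r) fm \<Rightarrow> bool" where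
  "occurs_parity e S (Eq s t) \<longleftrightarrow> True"
| "occurs_parity e S (Rel r ts) \<longleftrightarrow> True"
| "occurs_parity e S (RVar T ts) \<longleftrightarrow> (T = S \<longrightarrow> e)"
| "occurs_parity e S (Neg \<phi>) \<longleftrightarrow> occurs_parity (\<not> e) S \<phi>"
| "occurs_parity e S (Conj \<phi> \<psi>) \<longleftrightarrow> occurs_parity e S \<phi> \<and> occurs_parity e S \<psi>"
| "occurs_parity e S (Exi i \<phi>) \<longleftrightarrow> occurs_parity e S \<phi>"
| "occurs_parity e S (Lfp T xs \<phi> us) \<longleftrightarrow> T = S \<or> occurs_parity e S \<phi>"

abbreviation positive :: "rvar \<Rightarrow> ('f, 'r) fm \<Rightarrow> bool" where
  "positive \<equiv> occurs_parity True"

fun wf_tm :: "('f, 'r) language \<Rightarrow> 'f tm \<Rightarrow> bool" where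
  "wf_tm L (Var i) \<longleftrightarrow> True"
| "wf_tm L (App f ts) \<longleftrightarrow> f \<in> funs L \<and> length ts = fun_ar L f \<and> (\<forall>t \<in> set ts. wf_tm L t)"

text \<open>Well-formed formulas over \<open>L\<close>, possibly with free relation variables.  In the
  \<open>Lfp\<close> case the tuple \<open>us\<close> is required to be fresh.\<close>

primrec wf_fm :: "('f, 'r) language \<Rightarrow> ('f, 'r) fm \<Rightarrow> bool" where
  "wf_fm L (Eq s t) \<longleftrightarrow> wf_tm L s \<and> wf_tm L t"
| "wf_fm L (Rel r ts) \<longleftrightarrow> r \<in> rels L \<and> length ts = rel_ar L r \<and> (\<forall>t \<in> set ts. wf_tm L t)"
| "wf_fm L (RVar S ts) \<longleftrightarrow> length ts = arity S \<and> (\<forall>t \<in> set ts. wf_tm L t)"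
| "wf_fm L (Neg \<phi>) \<longleftrightarrow> wf_fm L \<phi>"
| "wf_fm L (Conj \<phi> \<psi>) \<longleftrightarrow> wf_fm L \<phi> \<and> wf_fm L \<psi>"
| "wf_fm L (Exi i \<phi>) \<longleftrightarrow> wf_fm L \<phi>"
| "wf_fm L (Lfp S xs \<phi> us) \<longleftrightarrow>
     wf_fm L \<phi> \<and> positive S \<phi> \<and>
     distinct xs \<and> length xs = arity S \<and>
     distinct us \<and> length us = arity S \<and> set us \<inter> (set xs \<union> vars \<phi>) = {}"

definition LFP_formula :: "('f, 'r) language \<Rightarrow> ('f, 'r) fm \<Rightarrow> bool" where
  "LFP_formula L \<phi> \<longleftrightarrow> wf_fm L \<phi> \<and> frv \<phi> = {}"

primrec first_order :: "('f, 'r) fm \<Rightarrow> bool" where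
  "first_order (Eq s t) \<longleftrightarrow> True"
| "first_order (Rel r ts) \<longleftrightarrow> True"
| "first_order (RVar S ts) \<longleftrightarrow> True"
| "first_order (Neg \<phi>) \<longleftrightarrow> first_order \<phi>"
| "first_order (Conj \<phi> \<psi>) \<longleftrightarrow> first_order \<phi> \<and> first_order \<psi>"
| "first_order (Exi i \<phi>) \<longleftrightarrow> first_order \<phi>"
| "first_order (Lfp S xs \<phi> us) \<longleftrightarrow> False"

text \<open>\<open>\<phi>(xs; S)\<close> is a positive elementary formula.\<close>

definition positive_elementary ::
    "('f, 'r) language \<Rightarrow> rvar \<Rightarrow> nat list \<Rightarrow> ('f, 'r) fm \<Rightarrow> bool" where
  "positive_elementary L S xs \<phi> \<longleftrightarrow>
     wf_fm L \<phi> \<and> first_order \<phi> \<and> positive S \<phi> \<and> frv \<phi> \<subseteq> {S} \<and>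
     distinct xs \<and> length xs = arity S \<and> fv \<phi> \<subseteq> set xs"

text \<open>\<open>\<phi>(xs; ys)\<close> is a partitioned LFP formula.\<close>

definition partitioned_LFP ::
    "('f, 'r) language \<Rightarrow> ('f, 'r) fm \<Rightarrow> nat list \<Rightarrow> nat list \<Rightarrow> bool" where
  "partitioned_LFP L \<phi> xs ys \<longleftrightarrow>
     LFP_formula L \<phi> \<and> distinct (xs @ ys) \<and> fv \<phi> \<subseteq> set xs \<union> set ys"


section \<open>Semantics\<close>

text \<open>The stages \<open>I\<^sup>\<xi> = \<Gamma> (\<Union>\<eta><\<xi>. I\<^sup>\<eta>)\<close> for finite ordinals \<open>\<xi>\<close>.  Over finite structures
  the iteration of a monotone operator stops at a finite stage (see \<open>stages_stabilise\<close>
  below), so no further ordinals are needed.  Note that \<open>I\<^sup>0 = \<Gamma> {}\<close>.\<close>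

fun stage :: "('b set \<Rightarrow> 'b set) \<Rightarrow> nat \<Rightarrow> 'b set" where
  "stage \<Gamma> k = \<Gamma> (\<Union>j \<in> {..<k}. stage \<Gamma> j)"

declare stage.simps [simp del]

definition stage_union :: "('b set \<Rightarrow> 'b set) \<Rightarrow> 'b set" where
  "stage_union \<Gamma> = (\<Union>k. stage \<Gamma> k)"

definition closure_index :: "('b set \<Rightarrow> 'b set) \<Rightarrow> nat" where
  "closure_index \<Gamma> = (LEAST k. stage_union \<Gamma> = stage \<Gamma> k)"

primrec tval :: "('a, 'f, 'r) fo_struct \<Rightarrow> (nat \<Rightarrow> 'a) \<Rightarrow> 'f tm \<Rightarrow> 'a" where
  "tval M v (Var i) = v i"
| "tval M v (App f ts) = fun_int M f (map (tval M v) ts)"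

definition assign :: "(nat \<Rightarrow> 'a) \<Rightarrow> nat list \<Rightarrow> 'a list \<Rightarrow> nat \<Rightarrow> 'a" where
  "assign v xs as i = (case map_of (zip xs as) i of Some a \<Rightarrow> a | None \<Rightarrow> v i)"

primrec sat ::
    "('a, 'f, 'r) fo_struct \<Rightarrow> (rvar \<Rightarrow> 'a list set) \<Rightarrow> (nat \<Rightarrow> 'a) \<Rightarrow> ('f, 'r) fm \<Rightarrow> bool" where
  "sat M R v (Eq s t) \<longleftrightarrow> tval M v s = tval M v t"
| "sat M R v (Rel r ts) \<longleftrightarrow> map (tval M v) ts \<in> rel_int M r"
| "sat M R v (RVar S ts) \<longleftrightarrow> map (tval M v) ts \<in> R S"
| "sat M R v (Neg \<phi>) \<longleftrightarrow> \<not> sat M R v \<phi>"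
| "sat M R v (Conj \<phi> \<psi>) \<longleftrightarrow> sat M R v \<phi> \<and> sat M R v \<psi>"
| "sat M R v (Exi i \<phi>) \<longleftrightarrow> (\<exists>a \<in> univ M. sat M R (v(i := a)) \<phi>)"
| "sat M R v (Lfp S xs \<phi> us) \<longleftrightarrow>
     map v us \<in> stage_union
       (\<lambda>X. {b \<in> tuples (univ M) (length xs). sat M (R(S := X)) (assign v xs b) \<phi>})"

text \<open>\<open>holds M \<phi> xs as\<close>: truth of \<open>\<phi>(as)\<close> in \<open>M\<close>, for \<open>\<phi>\<close> without free relation variables
  and with free variables among \<open>xs\<close>.  The background assignments are then irrelevant.\<close>

definition holds :: "('a, 'f, 'r) fo_struct \<Rightarrow> ('f, 'r) fm \<Rightarrow> nat list \<Rightarrow> 'a list \<Rightarrow> bool" where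
  "holds M \<phi> xs as \<longleftrightarrow> sat M (\<lambda>_. {}) (assign (\<lambda>_. undefined) xs as) \<phi>"

text \<open>The operator \<open>\<Gamma>\<close> and the closure ordinal of \<open>\<phi>(xs; S)\<close> in \<open>M\<close>.\<close>

definition induced_op ::
    "('a, 'f, 'r) fo_struct \<Rightarrow> ('f, 'r) fm \<Rightarrow> rvar \<Rightarrow> nat list \<Rightarrow> 'a list set \<Rightarrow> 'a list set" where
  "induced_op M \<phi> S xs X =
     {b \<in> tuples (univ M) (length xs).
        sat M ((\<lambda>_. {})(S := X)) (assign (\<lambda>_. undefined) xs b) \<phi>}"

definition closure_ordinal ::
    "('a, 'f, 'r) fo_struct \<Rightarrow> ('f, 'r) fm \<Rightarrow> rvar \<Rightarrow> nat list \<Rightarrow> nat" where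
  "closure_ordinal M \<phi> S xs = closure_index (induced_op M \<phi> S xs)"

lemma stage_subset_mono: "mono \<Gamma> \<Longrightarrow> j \<le> k \<Longrightarrow> stage \<Gamma> j \<subseteq> stage \<Gamma> k"
  unfolding stage.simps[of \<Gamma> j] stage.simps[of \<Gamma> k]
  by (erule monoD) (rule UN_mono, auto)

lemma stage_Suc:
  assumes "mono \<Gamma>" shows "stage \<Gamma> (Suc k) = \<Gamma> (stage \<Gamma> k)"
proof -
  have "stage \<Gamma> j \<subseteq> stage \<Gamma> k" if "j < Suc k" for j
    using stage_subset_mono[OF assms] that by simp
  then have "(\<Union>j \<in> {..<Suc k}. stage \<Gamma> j) = stage \<Gamma> k"
    by blast
  then show ?thesis unfolding stage.simps[of \<Gamma> "Suc k"] by (rule arg_cong)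
qed

lemma stages_stabilise:
  assumes mono: "mono \<Gamma>" and fin: "finite A" and sub: "\<And>X. \<Gamma> X \<subseteq> A"
  shows "\<exists>k. stage_union \<Gamma> = stage \<Gamma> k" and "stage_union \<Gamma> = lfp \<Gamma>"
proof -
  have "stage \<Gamma> k \<subseteq> A" for k
    unfolding stage.simps[of \<Gamma> k] by (rule sub)
  then have "range (stage \<Gamma>) \<subseteq> Pow A"
    by blast
  then have "finite (range (stage \<Gamma>))"
    using fin finite_subset by blast
  then obtain F where F: "finite F" "range (stage \<Gamma>) = stage \<Gamma> ` F"
    by (meson finite_subset_image order_refl)
  have max: "stage_union \<Gamma> \<subseteq> stage \<Gamma> (Max F)"
  proof -
    have "stage \<Gamma> j \<subseteq> stage \<Gamma> (Max F)" for j
    proof -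
      from F(2) obtain i where "i \<in> F" "stage \<Gamma> j = stage \<Gamma> i" by blast
      then show ?thesis using stage_subset_mono[OF mono, of i "Max F"] F(1) by simp
    qed
    then show ?thesis by (auto simp: stage_union_def)
  qed
  then have eq: "stage_union \<Gamma> = stage \<Gamma> (Max F)"
    by (auto simp: stage_union_def)
  then show "\<exists>k. stage_union \<Gamma> = stage \<Gamma> k" by blast
  have "\<Gamma> (stage \<Gamma> (Max F)) \<subseteq> stage \<Gamma> (Max F)"
    using max by (auto simp: stage_Suc[OF mono, symmetric] stage_union_def)
  then have "lfp \<Gamma> \<subseteq> stage_union \<Gamma>"
    by (simp add: eq lfp_lowerbound)
  moreover have "stage \<Gamma> k \<subseteq> lfp \<Gamma>" for k
  proof (induction k rule: less_induct)
    case (less k)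
    then have "\<Gamma> (\<Union>j \<in> {..<k}. stage \<Gamma> j) \<subseteq> \<Gamma> (lfp \<Gamma>)"
      by (intro monoD[OF mono]) auto
    then show ?case
      unfolding stage.simps[of \<Gamma> k] lfp_unfold[OF mono, symmetric] .
  qed
  ultimately show "stage_union \<Gamma> = lfp \<Gamma>"
    by (auto simp: stage_union_def)
qed


section \<open>Proficiency, the strict order property, and preorders\<close>

definition proficient :: "('f, 'r) language \<Rightarrow> ('a, 'f, 'r) fo_struct set \<Rightarrow> bool" where
  "proficient L C \<longleftrightarrow>
     (\<exists>S xs \<phi>. positive_elementary L S xs \<phi> \<and>
        (\<forall>k. \<exists>M \<in> C. closure_ordinal M \<phi> S xs \<ge> k))"

text \<open>The set \<open>\<phi>(M\<^sup>x; b)\<close>.\<close>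

definition def_set ::
    "('a, 'f, 'r) fo_struct \<Rightarrow> ('f, 'r) fm \<Rightarrow> nat list \<Rightarrow> nat list \<Rightarrow> 'a list \<Rightarrow> 'a list set" where
  "def_set M \<phi> xs ys b = {a \<in> tuples (univ M) (length xs). holds M \<phi> (xs @ ys) (a @ b)}"

definition sOP ::
    "nat \<Rightarrow> ('a, 'f, 'r) fo_struct \<Rightarrow> ('f, 'r) fm \<Rightarrow> nat list \<Rightarrow> nat list \<Rightarrow> bool" where
  "sOP n M \<phi> xs ys \<longleftrightarrow>
     (\<exists>b. (\<forall>i \<in> {1..n}. b i \<in> tuples (univ M) (length ys)) \<and>
          (\<forall>i \<in> {1..<n}. def_set M \<phi> xs ys (b i) \<subset> def_set M \<phi> xs ys (b (Suc i))))"

definition has_LFP_sOP :: "('f, 'r) language \<Rightarrow> ('a, 'f, 'r) fo_struct set \<Rightarrow> bool" where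
  "has_LFP_sOP L C \<longleftrightarrow>
     (\<exists>\<phi> xs ys. partitioned_LFP L \<phi> xs ys \<and> (\<forall>n. \<exists>M \<in> C. sOP n M \<phi> xs ys))"

text \<open>The binary relation defined by \<open>\<phi>(y1; y2)\<close> on \<open>M\<^sup>n\<close>, where \<open>n\<close> is the common length of
  \<open>y1\<close> and \<open>y2\<close>; \<open>(a, b)\<close> in the relation is read as \<open>a \<le> b\<close>.\<close>

definition def_rel ::
    "('a, 'f, 'r) fo_struct \<Rightarrow> ('f, 'r) fm \<Rightarrow> nat list \<Rightarrow> nat list \<Rightarrow> 'a list rel" where
  "def_rel M \<phi> y1 y2 =
     {(a, b). a \<in> tuples (univ M) (length y1) \<and> b \<in> tuples (univ M) (length y2) \<and>
              holds M \<phi> (y1 @ y2) (a @ b)}"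

definition chain_in :: "'b rel \<Rightarrow> 'b set \<Rightarrow> 'b list \<Rightarrow> bool" where
  "chain_in r A cs \<longleftrightarrow> set cs \<subseteq> A \<and> sorted_wrt (\<lambda>a b. (a, b) \<in> r \<and> (b, a) \<notin> r) cs"

definition linear_preorder_on :: "'b set \<Rightarrow> 'b rel \<Rightarrow> bool" where
  "linear_preorder_on A r \<longleftrightarrow> preorder_on A r \<and> total_on A r"

text \<open>The order induced by a preorder on the quotient by \<open>a \<le> b \<and> b \<le> a\<close>.\<close>

definition quotient_order :: "'b set \<Rightarrow> 'b rel \<Rightarrow> 'b set rel" where
  "quotient_order A r =
     {(X, Y). X \<in> A // (r \<inter> r\<inverse>) \<and> Y \<in> A // (r \<inter> r\<inverse>) \<and> (\<exists>a \<in> X. \<exists>b \<in> Y. (a, b) \<in> r)}"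

text \<open>The order type of a linear preorder is that of its quotient linear order; on a finite
  set it is a finite ordinal \<open>k\<close>, represented by \<open>natLeq_on k\<close>.\<close>

definition has_order_type :: "'b set \<Rightarrow> 'b rel \<Rightarrow> nat \<Rightarrow> bool" where
  "has_order_type A r k \<longleftrightarrow> (quotient_order A r, natLeq_on k) \<in> ordIso"

definition has_unbounded_LFP_preorder ::
    "('f, 'r) language \<Rightarrow> ('a, 'f, 'r) fo_struct set \<Rightarrow> bool" where
  "has_unbounded_LFP_preorder L C \<longleftrightarrow>
     (\<exists>n y1 y2 \<phi>. length y1 = n \<and> length y2 = n \<and> partitioned_LFP L \<phi> y1 y2 \<and>
        (\<forall>M \<in> C. preorder_on (tuples (univ M) n) (def_rel M \<phi> y1 y2)) \<and>
        (\<forall>k. \<exists>M \<in> C. \<exists>cs.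
           chain_in (def_rel M \<phi> y1 y2) (tuples (univ M) n) cs \<and> length cs \<ge> k))"

definition has_unbounded_LFP_linear_preorder ::
    "('f, 'r) language \<Rightarrow> ('a, 'f, 'r) fo_struct set \<Rightarrow> bool" where
  "has_unbounded_LFP_linear_preorder L C \<longleftrightarrow>
     (\<exists>n y1 y2 \<phi>. length y1 = n \<and> length y2 = n \<and> partitioned_LFP L \<phi> y1 y2 \<and>
        (\<forall>M \<in> C. linear_preorder_on (tuples (univ M) n) (def_rel M \<phi> y1 y2)) \<and>
        (\<forall>k. \<exists>M \<in> C. \<exists>m \<ge> k. has_order_type (tuples (univ M) n) (def_rel M \<phi> y1 y2) m))"

end

theory Submission
  imports Defs
begin

text \<open>The main step is from the strict order property to proficiency.  A nested LFP formula
  \<open>\<phi>\<close> is compiled into one positive elementary induction from which both \<open>\<phi>\<close> and \<open>\<not> \<phi>\<close> can be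
  read off positively.  For \<open>[lfp S x. \<psi>]\<close> the inner induction for \<open>\<psi>\<close> is run once with \<open>S\<close> empty
  and once for each \<open>u\<close>, with \<open>S\<close> the stage in which \<open>u\<close> appears; this stage and its complement
  are themselves given by the stage comparison relations, which are positive in the runs.  Over a
  finite structure every stage before the fixed point has a newest element, so all stages are
  reached, and a last one can be recognised.  Adding the rank of the relation
  \<open>\<phi>(M; y) \<subset> \<phi>(M; z)\<close> to this induction makes long chains force many stages.  Conversely, comparing
  elements by the stage at which they enter a positive elementary induction is a linear preorder
  definable by a single least fixed point.\<close>

text \<open>The obstacle is negation. A fixed point can be negated only after its iteration has
  stopped, and a positive induction cannot see this moment. Each subformula therefore gives two
  positive answers, yes and no, either of which may come late but never wrongly. All uses of the
  answers are monotone, so reading them early causes delay and no error; an inner induction may thus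
  start before the stage that it reads, or its complement, is known. The classical comparison of
  stages concerns an induction with an elementary body. Here the body is itself an induction, so it
  has to be run separately for every stage about which it is asked, and an element first appearing
  in a stage serves as the name of that stage.

  Combining two inductions into one takes two distinct elements for the tags. A strict chain of
  three definable sets provides them, which is why structures with one element can be left
  aside.\<close>

section \<open>Assignments, tuples, and monotonicity of satisfaction in the relation
  variables\<close>

lemma assign_notin: "i \<notin> set xs \<Longrightarrow> assign v xs as i = v i"
  by (auto simp: assign_def split: option.split dest!: map_of_SomeD set_zip_leftD)

lemma assign_Nil [simp]: "assign v [] as = v"
  by (simp add: assign_def fun_eq_iff)

lemma assign_Cons [simp]:
  "assign v (x # xs) (a # as) i = (if i = x then a else assign v xs as i)"
  by (simp add: assign_def)

lemma assign_Cons_upd: "x \<notin> set xs \<Longrightarrow> assign v (x # xs) (a # as) = assign (v(x := a)) xs as"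
  by (auto simp: fun_eq_iff assign_notin) (auto simp: assign_def split: option.split)

lemma assign_nth:
  "distinct xs \<Longrightarrow> length as = length xs \<Longrightarrow> j < length xs \<Longrightarrow> assign v xs as (xs ! j) = as ! j"
  by (simp add: assign_def map_of_zip_nth)

lemma map_assign:
  "distinct xs \<Longrightarrow> length as = length xs \<Longrightarrow> map (assign v xs as) xs = as"
  by (simp add: list_eq_iff_nth_eq assign_nth)

lemma assign_map: "assign (f \<circ> v) xs (map f as) i = f (assign v xs as i)"
  by (auto simp: assign_def zip_map2 map_of_map split: option.split)

lemma assign_in:
  "length as = length xs \<Longrightarrow> set as \<subseteq> A \<Longrightarrow> i \<in> set xs \<or> v i \<in> A \<Longrightarrow> assign v xs as i \<in> A"
  by (induction xs as arbitrary: v rule: list_induct2') (auto simp: assign_notin)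

lemma assign_cong:
  "length as = length xs \<Longrightarrow> (i \<notin> set xs \<Longrightarrow> v i = v' i) \<Longrightarrow> assign v xs as i = assign v' xs as i"
  by (induction xs as rule: list_induct2') (auto simp: assign_notin)

lemma tuples_append [simp]:
  "length a = k \<Longrightarrow> a @ b \<in> tuples A (k + l) \<longleftrightarrow> a \<in> tuples A k \<and> b \<in> tuples A l"
  by (auto simp: tuples_def)

lemma tuples_split:
  "w \<in> tuples A (k + l) \<longleftrightarrow> (\<exists>a \<in> tuples A k. \<exists>b \<in> tuples A l. w = a @ b)"
proof
  assume "w \<in> tuples A (k + l)"
  then show "\<exists>a \<in> tuples A k. \<exists>b \<in> tuples A l. w = a @ b"
    by (intro bexI[of _ "take k w"] bexI[of _ "drop k w"])
      (auto simp: tuples_def dest: in_set_takeD in_set_dropD)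
qed (auto simp: tuples_def)

lemma tuples_length: "w \<in> tuples A k \<Longrightarrow> length w = k"
  by (simp add: tuples_def)

lemma finite_tuples: "finite A \<Longrightarrow> finite (tuples A n)"
  using finite_lists_length_eq[of A n] by (simp add: tuples_def conj_commute)

lemma map_in_tuples: "(\<And>x. x \<in> set xs \<Longrightarrow> f x \<in> A) \<Longrightarrow> length xs = n \<Longrightarrow> map f xs \<in> tuples A n"
  by (auto simp: tuples_def)

lemma map_nth_in_tuples:
  "as \<in> tuples A n \<Longrightarrow> set js \<subseteq> {..<n} \<Longrightarrow> length js = m \<Longrightarrow> map ((!) as) js \<in> tuples A m"
  by (fastforce simp: tuples_def)

lemma finite_vars: "finite (vars \<phi>)"
proof -
  have "finite (tvars t)" for t :: "'f tm" by (induction t) auto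
  then show ?thesis by (induction \<phi>) auto
qed

lemma tval_cong: "(\<And>i. i \<in> tvars t \<Longrightarrow> v i = v' i) \<Longrightarrow> tval M v t = tval M v' t"
proof (induction t)
  case (App f ts)
  then have "map (tval M v) ts = map (tval M v') ts" by auto
  then show ?case by (simp only: tval.simps)
qed simp

lemma tval_in_univ:
  assumes "is_structure L M"
  shows "wf_tm L t \<Longrightarrow> (\<And>i. i \<in> tvars t \<Longrightarrow> v i \<in> univ M) \<Longrightarrow> tval M v t \<in> univ M"
proof (induction t)
  case (App f ts)
  then have "map (tval M v) ts \<in> tuples (univ M) (fun_ar L f)"
    by (auto simp: tuples_def)
  with App.prems assms show ?case
    by (auto simp: is_structure_def)
qed simp

lemma sat_cong:
  "(\<And>i. i \<in> fv \<phi> \<Longrightarrow> v i = v' i) \<Longrightarrow> (\<And>S. S \<in> frv \<phi> \<Longrightarrow> R S = R' S) \<Longrightarrow>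
   sat M R v \<phi> \<longleftrightarrow> sat M R' v' \<phi>"
proof (induction \<phi> arbitrary: R R' v v')
  case (Eq s t)
  have "tval M v s = tval M v' s" "tval M v t = tval M v' t"
    using Eq by (auto intro!: tval_cong)
  then show ?case by simp
next
  case (Rel r ts)
  then have "map (tval M v) ts = map (tval M v') ts"
    by (auto intro!: tval_cong)
  then show ?case by (simp only: sat.simps)
next
  case (RVar S ts)
  then have "map (tval M v) ts = map (tval M v') ts"
    by (auto intro!: tval_cong)
  moreover have "R S = R' S" using RVar by simp
  ultimately show ?case by (simp only: sat.simps)
next
  case (Neg \<phi>)
  have "sat M R v \<phi> \<longleftrightarrow> sat M R' v' \<phi>"
    by (rule Neg.IH) (use Neg.prems in auto)
  then show ?case by simp
next
  case (Conj \<phi> \<psi>)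
  have "sat M R v \<phi> \<longleftrightarrow> sat M R' v' \<phi>" "sat M R v \<psi> \<longleftrightarrow> sat M R' v' \<psi>"
    by (rule Conj.IH; use Conj.prems in auto)+
  then show ?case by simp
next
  case (Exi i \<phi>)
  have "sat M R (v(i := a)) \<phi> \<longleftrightarrow> sat M R' (v'(i := a)) \<phi>" for a
    by (rule Exi.IH) (use Exi.prems in auto)
  then show ?case by simp
next
  case (Lfp S xs \<phi> us)
  have 1: "sat M (R(S := X)) (assign v xs b) \<phi> \<longleftrightarrow> sat M (R'(S := X)) (assign v' xs b) \<phi>"
    if "b \<in> tuples (univ M) (length xs)" for X b
    using that Lfp.prems by (intro Lfp.IH assign_cong) (auto simp: tuples_def)
  have 2: "map v us = map v' us" using Lfp.prems by auto
  show ?case unfolding sat.simps 2 using 1 by (simp cong: conj_cong)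
qed

lemma stage_mono_op:
  assumes "\<And>X. \<Gamma> X \<subseteq> \<Gamma>' X" and "mono \<Gamma>'"
  shows "stage \<Gamma> k \<subseteq> stage \<Gamma>' k"
proof (induction k rule: less_induct)
  case (less k)
  have "\<Gamma> (\<Union>j<k. stage \<Gamma> j) \<subseteq> \<Gamma>' (\<Union>j<k. stage \<Gamma> j)" by (rule assms(1))
  also have "\<dots> \<subseteq> \<Gamma>' (\<Union>j<k. stage \<Gamma>' j)"
    using less by (intro monoD[OF assms(2)] UN_mono) auto
  finally show ?case unfolding stage.simps[of _ k] .
qed

text \<open>The boolean \<open>e\<close> carries both directions at once, because negation swaps
  them. Well-formedness enters at \<open>Lfp\<close>: positivity of \<open>S\<close> makes the inner
  operator monotone, and an inclusion between two such operators passes to all their stages.\<close>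

lemma sat_mono:
  fixes M :: "('a, 'f, 'r) fo_struct"
  shows "wf_fm L \<phi> \<Longrightarrow> (\<And>S. R S \<subseteq> R' S) \<Longrightarrow> (\<And>S. R S \<noteq> R' S \<Longrightarrow> occurs_parity e S \<phi>) \<Longrightarrow>
   (if e then sat M R v \<phi> \<longrightarrow> sat M R' v \<phi> else sat M R' v \<phi> \<longrightarrow> sat M R v \<phi>)"
proof (induction \<phi> arbitrary: R R' v e)
  case (RVar S ts)
  have "e \<or> R S = R' S" using RVar(3)[of S] by auto
  with RVar(2)[of S] show ?case by (cases e) auto
next
  case (Neg \<phi>)
  from Neg.IH[of R R' "\<not> e" v] Neg.prems show ?case by (auto split: if_splits)
next
  case (Conj \<phi> \<psi>)
  from Conj.IH(1)[of R R' e v] Conj.IH(2)[of R R' e v] Conj.prems show ?case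
    by (auto split: if_splits)
next
  case (Exi i \<phi>)
  have "if e then sat M R (v(i := a)) \<phi> \<longrightarrow> sat M R' (v(i := a)) \<phi>
    else sat M R' (v(i := a)) \<phi> \<longrightarrow> sat M R (v(i := a)) \<phi>" for a
    by (rule Exi.IH) (use Exi.prems in auto)
  then show ?case unfolding sat.simps by (cases e) (simp_all, blast+)
next
  case (Lfp S xs \<phi> us)
  let ?G = "\<lambda>R X. {b \<in> tuples (univ M) (length xs). sat M (R(S := X)) (assign v xs b) \<phi>}"
  \<comment> \<open>The induction hypothesis is used with parity \<open>True\<close> here, whatever
    \<open>e\<close> is: \<open>S\<close> is positive in the body even where the outer variables are
    negative.\<close>
  have mono: "mono (?G R)" for R
  proof (rule monoI)
    fix X Y :: "'a list set" assume "X \<subseteq> Y"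
    then have "if True then sat M (R(S := X)) (assign v xs b) \<phi> \<longrightarrow> sat M (R(S := Y)) (assign v xs b) \<phi>
      else sat M (R(S := Y)) (assign v xs b) \<phi> \<longrightarrow> sat M (R(S := X)) (assign v xs b) \<phi>" for b
      using Lfp.prems(1) by (intro Lfp.IH) (auto split: if_splits)
    then show "?G R X \<subseteq> ?G R Y" by auto
  qed
  have *: "if e then sat M (R(S := X)) (assign v xs b) \<phi> \<longrightarrow> sat M (R'(S := X)) (assign v xs b) \<phi>
      else sat M (R'(S := X)) (assign v xs b) \<phi> \<longrightarrow> sat M (R(S := X)) (assign v xs b) \<phi>" for b X
  proof (intro Lfp.IH)
    show "occurs_parity e T \<phi>" if "(R(S := X)) T \<noteq> (R'(S := X)) T" for T
      using that Lfp.prems(3)[of T] by (auto split: if_splits)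
  qed (use Lfp.prems in auto)
  have "stage_union (?G R) \<subseteq> stage_union (?G R')" if e
  proof -
    have "?G R X \<subseteq> ?G R' X" for X using *[of X] that by auto
    then show ?thesis unfolding stage_union_def by (intro UN_mono stage_mono_op mono) auto
  qed
  moreover have "stage_union (?G R') \<subseteq> stage_union (?G R)" if "\<not> e"
  proof -
    have "?G R' X \<subseteq> ?G R X" for X using *[of X] that by auto
    then show ?thesis unfolding stage_union_def by (intro UN_mono stage_mono_op mono) auto
  qed
  ultimately show ?case unfolding sat.simps by (cases e) (simp_all only: if_True if_False simp_thms, blast+)
qed auto

lemma occurs_parity_notin: "S \<notin> frv \<phi> \<Longrightarrow> occurs_parity e S \<phi>"
  by (induction \<phi> arbitrary: e) auto

section \<open>Positive first-order queries\<close>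

fun ren :: "(nat \<Rightarrow> nat) \<Rightarrow> 'f tm \<Rightarrow> 'f tm" where
  "ren \<rho> (Var i) = Var (\<rho> i)"
| "ren \<rho> (App f ts) = App f (map (ren \<rho>) ts)"

lemma tvars_ren [simp]: "tvars (ren \<rho> t) = \<rho> ` tvars t"
  by (induction t) auto

lemma wf_tm_ren [simp]: "wf_tm L (ren \<rho> t) = wf_tm L t"
  by (induction t) auto

lemma tval_ren [simp]: "tval M v (ren \<rho> t) = tval M (v \<circ> \<rho>) t"
  by (induction t) (auto intro!: arg_cong[of _ _ "fun_int M _"])

text \<open>The \<open>Lfp\<close> clause is a dummy, since the substitution is used on first-order
  formulas only. The injective renaming \<open>\<rho>\<close> prevents capture: whatever
  \<open>g\<close> contributes besides its arguments can be kept outside the range of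
  \<open>\<rho>\<close>.\<close>

primrec sub :: "(nat \<Rightarrow> nat) \<Rightarrow> (rvar \<Rightarrow> 'f tm list \<Rightarrow> ('f, 'r) fm) \<Rightarrow> ('f, 'r) fm \<Rightarrow> ('f, 'r) fm"
where
  "sub \<rho> g (Eq s t) = Eq (ren \<rho> s) (ren \<rho> t)"
| "sub \<rho> g (Rel r ts) = Rel r (map (ren \<rho>) ts)"
| "sub \<rho> g (RVar S ts) = g S (map (ren \<rho>) ts)"
| "sub \<rho> g (Neg \<phi>) = Neg (sub \<rho> g \<phi>)"
| "sub \<rho> g (Conj \<phi> \<psi>) = Conj (sub \<rho> g \<phi>) (sub \<rho> g \<psi>)"
| "sub \<rho> g (Exi i \<phi>) = Exi (\<rho> i) (sub \<rho> g \<phi>)"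
| "sub \<rho> g (Lfp S xs \<phi> us) = Lfp S xs \<phi> us"

text \<open>The assignment \<open>v0\<close> fixes the parameters of \<open>g\<close>: quantifiers
  that stem from \<open>\<psi>\<close> change values inside the range of \<open>\<rho>\<close> only,
  so the meaning of \<open>g\<close> is stable while descending into \<open>\<psi>\<close>.\<close>

lemma sat_sub:
  assumes inj: "inj \<rho>" and M: "is_structure L M"
    and g: "\<And>v' S ts. (\<And>i. i \<notin> range \<rho> \<Longrightarrow> v' i = v0 i) \<Longrightarrow>
      (\<And>t. t \<in> set ts \<Longrightarrow> tvars t \<subseteq> range \<rho> \<and> tval M v' t \<in> univ M) \<Longrightarrow>
      length ts = arity S \<Longrightarrow> S \<in> D \<Longrightarrow> sat M R v' (g S ts) \<longleftrightarrow> map (tval M v') ts \<in> R2 S"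
  shows "first_order \<psi> \<Longrightarrow> wf_fm L \<psi> \<Longrightarrow> frv \<psi> \<subseteq> D \<Longrightarrow> (\<And>i. i \<notin> range \<rho> \<Longrightarrow> v i = v0 i) \<Longrightarrow>
    (\<And>i. i \<in> fv \<psi> \<Longrightarrow> v (\<rho> i) \<in> univ M) \<Longrightarrow> sat M R v (sub \<rho> g \<psi>) \<longleftrightarrow> sat M R2 (v \<circ> \<rho>) \<psi>"
proof (induction \<psi> arbitrary: v)
  case (RVar S ts)
  have "sat M R v (g S (map (ren \<rho>) ts)) \<longleftrightarrow> map (tval M v) (map (ren \<rho>) ts) \<in> R2 S"
    using RVar.prems by (intro g) (auto intro!: tval_in_univ[OF M], blast)
  then show ?case by (simp add: comp_def)
next
  case (Exi i \<psi>)
  have "sat M R (v(\<rho> i := a)) (sub \<rho> g \<psi>) \<longleftrightarrow> sat M R2 (v(\<rho> i := a) \<circ> \<rho>) \<psi>" if "a \<in> univ M" for a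
    using that Exi by (intro Exi.IH) (auto simp: inj_eq[OF inj])
  moreover have "v(\<rho> i := a) \<circ> \<rho> = (v \<circ> \<rho>)(i := a)" for a
    using inj by (auto simp: fun_eq_iff inj_eq)
  ultimately show ?case by (simp del: o_apply)
qed (auto simp: comp_def)

lemma first_order_sub:
  "first_order \<psi> \<Longrightarrow> (\<And>S ts. S \<in> frv \<psi> \<Longrightarrow> length ts = arity S \<Longrightarrow> first_order (g S ts)) \<Longrightarrow>
   wf_fm L \<psi> \<Longrightarrow> first_order (sub \<rho> g \<psi>)"
  by (induction \<psi>) auto

lemma wf_fm_sub:
  "first_order \<psi> \<Longrightarrow> wf_fm L \<psi> \<Longrightarrow>
   (\<And>S ts. S \<in> frv \<psi> \<Longrightarrow> length ts = arity S \<Longrightarrow> \<forall>t \<in> set ts. wf_tm L t \<Longrightarrow> wf_fm L (g S ts)) \<Longrightarrow>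
   wf_fm L (sub \<rho> g \<psi>)"
  by (induction \<psi>) auto

lemma frv_sub:
  "first_order \<psi> \<Longrightarrow> wf_fm L \<psi> \<Longrightarrow>
   (\<And>S ts. S \<in> frv \<psi> \<Longrightarrow> length ts = arity S \<Longrightarrow> frv (g S ts) \<subseteq> D) \<Longrightarrow> frv (sub \<rho> g \<psi>) \<subseteq> D"
  by (induction \<psi>) auto

lemma positive_sub:
  "first_order \<psi> \<Longrightarrow> wf_fm L \<psi> \<Longrightarrow> (\<And>S. occurs_parity e S \<psi>) \<Longrightarrow>
   (\<And>S ts T. S \<in> frv \<psi> \<Longrightarrow> length ts = arity S \<Longrightarrow> positive T (g S ts)) \<Longrightarrow>
   occurs_parity e T (sub \<rho> g \<psi>)"
proof (induction \<psi> arbitrary: e)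
  case (RVar S ts)
  from RVar(3)[of S] have e by simp
  with RVar show ?case by simp
qed auto

lemma fv_sub:
  assumes "inj \<rho>" "V \<inter> range \<rho> = {}"
  shows "first_order \<psi> \<Longrightarrow> wf_fm L \<psi> \<Longrightarrow>
   (\<And>S ts. S \<in> frv \<psi> \<Longrightarrow> length ts = arity S \<Longrightarrow> fv (g S ts) \<subseteq> V \<union> (\<Union>t \<in> set ts. tvars t)) \<Longrightarrow>
   fv (sub \<rho> g \<psi>) \<subseteq> V \<union> \<rho> ` fv \<psi>"
proof (induction \<psi>)
  case (RVar S ts)
  from RVar(3)[of S "map (ren \<rho>) ts"] RVar(2) show ?case by auto
next
  case (Exi i \<psi>)
  have "fv (sub \<rho> g \<psi>) \<subseteq> V \<union> \<rho> ` fv \<psi>" using Exi by auto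
  then show ?case using assms by auto
qed auto

section \<open>Quantifier blocks, and queries given by positive first-order formulas\<close>

definition Exs :: "nat list \<Rightarrow> ('f, 'r) fm \<Rightarrow> ('f, 'r) fm" where
  "Exs zs \<psi> = foldr Exi zs \<psi>"

text \<open>Stands for putting the terms \<open>ts\<close> in place of the variables
  \<open>zs\<close>. As \<open>\<psi>\<close> itself is left alone, no capture can occur inside
  it.\<close>

definition Lets :: "nat list \<Rightarrow> 'f tm list \<Rightarrow> ('f, 'r) fm \<Rightarrow> ('f, 'r) fm" where
  "Lets zs ts \<psi> = Exs zs (foldr (\<lambda>(z, t). Conj (Eq (Var z) t)) (zip zs ts) \<psi>)"

lemma tuples_0 [simp]: "tuples A 0 = {[]}"
  by (auto simp: tuples_def)

lemma bex_tuples_Suc: "(\<exists>b \<in> tuples A (Suc n). P b) \<longleftrightarrow> (\<exists>a \<in> A. \<exists>b \<in> tuples A n. P (a # b))"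
proof -
  have eq: "tuples A (Suc n) = {a # b | a b. a \<in> A \<and> b \<in> tuples A n}"
    by (auto simp: tuples_def length_Suc_conv)
  show ?thesis unfolding eq by blast
qed

lemma sat_Exs:
  "distinct zs \<Longrightarrow>
   sat M R v (Exs zs \<psi>) \<longleftrightarrow> (\<exists>b \<in> tuples (univ M) (length zs). sat M R (assign v zs b) \<psi>)"
proof (induction zs arbitrary: v)
  case (Cons z zs)
  have "assign (v(z := a)) zs b = assign v (z # zs) (a # b)" for a b
    using Cons.prems by (simp add: assign_Cons_upd)
  with Cons show ?case by (simp add: Exs_def bex_tuples_Suc)
qed (simp add: Exs_def)

lemma sat_Lets:
  assumes "distinct zs" "length ts = length zs" "\<And>t. t \<in> set ts \<Longrightarrow> tvars t \<inter> set zs = {}"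
    and "\<And>t. t \<in> set ts \<Longrightarrow> tval M v t \<in> univ M"
  shows "sat M R v (Lets zs ts \<psi>) \<longleftrightarrow> sat M R (assign v zs (map (tval M v) ts)) \<psi>"
proof -
  have *: "sat M R w (foldr (\<lambda>(z, t). Conj (Eq (Var z) t)) (zip zs ts) \<psi>) \<longleftrightarrow>
    map w zs = map (tval M w) ts \<and> sat M R w \<psi>" for w
    using assms(2)[symmetric] by (induction zs ts rule: list_induct2) auto
  have **: "map (tval M (assign v zs b)) ts = map (tval M v) ts" for b
    using assms(3) by (auto intro!: tval_cong assign_notin)
  have "map (tval M v) ts \<in> tuples (univ M) (length zs)"
    using assms by (auto simp: tuples_def)
  moreover have "map (assign v zs b) zs = b" if "b \<in> tuples (univ M) (length zs)" for b
    using that assms(1) by (intro map_assign) (auto simp: tuples_def)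
  ultimately show ?thesis
    by (auto simp: Lets_def sat_Exs[OF assms(1)] * **)
qed

lemma Exs_simps [simp]:
  "wf_fm L (Exs zs \<psi>) = wf_fm L \<psi>" "first_order (Exs zs \<psi>) = first_order \<psi>"
  "occurs_parity e S (Exs zs \<psi>) = occurs_parity e S \<psi>" "frv (Exs zs \<psi>) = frv \<psi>"
  "fv (Exs zs \<psi>) = fv \<psi> - set zs"
  by (induction zs) (auto simp: Exs_def)

lemma Lets_simps [simp]:
  assumes "length ts = length zs"
  shows "wf_fm L (Lets zs ts \<psi>) \<longleftrightarrow> (\<forall>t \<in> set ts. wf_tm L t) \<and> wf_fm L \<psi>"
    "first_order (Lets zs ts \<psi>) = first_order \<psi>"
    "occurs_parity e S (Lets zs ts \<psi>) = occurs_parity e S \<psi>" "frv (Lets zs ts \<psi>) = frv \<psi>"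
    "fv (Lets zs ts \<psi>) = ((\<Union>t \<in> set ts. tvars t) \<union> fv \<psi>) - set zs"
proof -
  let ?F = "\<lambda>zs ts. foldr (\<lambda>(z, t). Conj (Eq (Var z) t)) (zip zs ts) \<psi>"
  have "(wf_fm L (?F zs ts) \<longleftrightarrow> (\<forall>t \<in> set ts. wf_tm L t) \<and> wf_fm L \<psi>) \<and>
    first_order (?F zs ts) = first_order \<psi> \<and>
    occurs_parity e S (?F zs ts) = occurs_parity e S \<psi> \<and> frv (?F zs ts) = frv \<psi> \<and>
    fv (?F zs ts) = (\<Union>t \<in> set ts. tvars t) \<union> set zs \<union> fv \<psi>"
    using assms[symmetric] by (induction zs ts rule: list_induct2) auto
  then show "wf_fm L (Lets zs ts \<psi>) \<longleftrightarrow> (\<forall>t \<in> set ts. wf_tm L t) \<and> wf_fm L \<psi>"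
    "first_order (Lets zs ts \<psi>) = first_order \<psi>"
    "occurs_parity e S (Lets zs ts \<psi>) = occurs_parity e S \<psi>" "frv (Lets zs ts \<psi>) = frv \<psi>"
    "fv (Lets zs ts \<psi>) = ((\<Union>t \<in> set ts. tvars t) \<union> fv \<psi>) - set zs"
    by (auto simp: Lets_def)
qed

text \<open>Positivity in every relation variable makes the formula monotone in the whole
  interpretation. Negative information can come in only through a relation variable of its
  own.\<close>

definition pos_fo :: "('f, 'r) language \<Rightarrow> rvar set \<Rightarrow> nat \<Rightarrow> ('f, 'r) fm \<Rightarrow> bool" where
  "pos_fo L D n \<psi> \<longleftrightarrow> wf_fm L \<psi> \<and> first_order \<psi> \<and> (\<forall>S. positive S \<psi>) \<and> frv \<psi> \<subseteq> D \<and> fv \<psi> \<subseteq> {..<n}"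

type_synonym ('a, 'f, 'r) query =
  "('a, 'f, 'r) fo_struct \<Rightarrow> (rvar \<Rightarrow> 'a list set) \<Rightarrow> 'a list \<Rightarrow> bool"

text \<open>Queries are handled by their meaning, with the formula hidden behind the existential
  quantifier. It is chosen before \<open>M\<close> and \<open>R\<close>, so one formula serves all
  structures.\<close>

definition fo_query :: "('f, 'r) language \<Rightarrow> rvar set \<Rightarrow> nat \<Rightarrow> ('a, 'f, 'r) query \<Rightarrow> bool" where
  "fo_query L D n Q \<longleftrightarrow> (\<exists>\<psi>. pos_fo L D n \<psi> \<and>
     (\<forall>M R v. is_structure L M \<longrightarrow> (\<forall>i<n. v i \<in> univ M) \<longrightarrow>
        sat M R v \<psi> = Q M R (map v [0..<n])))"

lemma fo_query_cong:
  assumes "fo_query L D n Q"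
    and "\<And>M R as. is_structure L M \<Longrightarrow> as \<in> tuples (univ M) n \<Longrightarrow> Q M R as = Q' M R as"
  shows "fo_query L D n Q'"
proof -
  have "Q M R (map v [0..<n]) = Q' M R (map v [0..<n])"
    if "is_structure L M" "\<forall>i<n. v i \<in> univ M" for M R v
    using that by (intro assms(2) map_in_tuples) auto
  with assms(1) show ?thesis unfolding fo_query_def by (metis (no_types, lifting))
qed

lemma fo_queryI:
  assumes "pos_fo L D n \<psi>"
    and "\<And>M R as. is_structure L M \<Longrightarrow> as \<in> tuples (univ M) n \<Longrightarrow> sat M R ((!) as) \<psi> \<longleftrightarrow> Q M R as"
  shows "fo_query L D n Q"
  unfolding fo_query_def
proof (intro exI conjI allI impI)
  fix M :: "('c, 'a, 'b) fo_struct" and R :: "rvar \<Rightarrow> 'c list set" and v :: "nat \<Rightarrow> 'c"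
  assume M: "is_structure L M" and v: "\<forall>i<n. v i \<in> univ M"
  then have "map v [0..<n] \<in> tuples (univ M) n" by (auto simp: tuples_def)
  from assms(2)[OF M this] have "sat M R ((!) (map v [0..<n])) \<psi> \<longleftrightarrow> Q M R (map v [0..<n])" .
  moreover have "sat M R ((!) (map v [0..<n])) \<psi> \<longleftrightarrow> sat M R v \<psi>"
    using assms(1) by (intro sat_cong) (auto simp: pos_fo_def subset_iff)
  ultimately show "sat M R v \<psi> = Q M R (map v [0..<n])" by simp
qed fact

lemma fo_queryE:
  assumes "fo_query L D n Q"
  obtains \<psi> where "pos_fo L D n \<psi>"
    and "\<And>M R as. is_structure L M \<Longrightarrow> as \<in> tuples (univ M) n \<Longrightarrow> sat M R ((!) as) \<psi> \<longleftrightarrow> Q M R as"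
proof -
  from assms obtain \<psi> where 1: "pos_fo L D n \<psi>" and
    2: "\<And>M R v. is_structure L M \<Longrightarrow> (\<forall>i<n. v i \<in> univ M) \<Longrightarrow> sat M R v \<psi> = Q M R (map v [0..<n])"
    unfolding fo_query_def by metis
  show ?thesis
  proof (rule that[OF 1])
    fix M :: "('c, 'a, 'b) fo_struct" and R as
    assume M: "is_structure L M" and as: "as \<in> tuples (univ M) n"
    then have "map ((!) as) [0..<n] = as" by (auto simp: tuples_def list_eq_iff_nth_eq)
    with 2[OF M, of "(!) as" R] as show "sat M R ((!) as) \<psi> \<longleftrightarrow> Q M R as"
      by (auto simp: tuples_def subset_iff)
  qed
qed

lemma fo_query_sat:
  assumes "fo_query L D n Q"
  obtains \<psi> where "pos_fo L D n \<psi>"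
    and "\<And>M R v. is_structure L M \<Longrightarrow> (\<And>i. i < n \<Longrightarrow> v i \<in> univ M) \<Longrightarrow>
      sat M R v \<psi> \<longleftrightarrow> Q M R (map v [0..<n])"
  using assms unfolding fo_query_def by metis

lemma fo_query_mono:
  assumes "fo_query L D n Q" "is_structure L M" "as \<in> tuples (univ M) n" "\<And>S. R S \<subseteq> R' S" "Q M R as"
  shows "Q M R' as"
proof -
  from assms(1) obtain \<psi> where "pos_fo L D n \<psi>"
    and *: "\<And>R. sat M R ((!) as) \<psi> \<longleftrightarrow> Q M R as"
    using assms(2,3) by (elim fo_queryE) metis
  with sat_mono[of L \<psi> R R' True M "(!) as"] assms show ?thesis
    by (auto simp: pos_fo_def)
qed

lemma
  assumes "fo_query L D n Q" "fo_query L D n Q'"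
  shows fo_query_and: "fo_query L D n (\<lambda>M R as. Q M R as \<and> Q' M R as)"
    and fo_query_or: "fo_query L D n (\<lambda>M R as. Q M R as \<or> Q' M R as)"
proof -
  from assms obtain \<psi> \<psi>' where 1: "pos_fo L D n \<psi>" "pos_fo L D n \<psi>'"
    "\<And>M R as. is_structure L M \<Longrightarrow> as \<in> tuples (univ M) n \<Longrightarrow> sat M R ((!) as) \<psi> \<longleftrightarrow> Q M R as"
    "\<And>M R as. is_structure L M \<Longrightarrow> as \<in> tuples (univ M) n \<Longrightarrow> sat M R ((!) as) \<psi>' \<longleftrightarrow> Q' M R as"
    by (elim fo_queryE) metis
  show "fo_query L D n (\<lambda>M R as. Q M R as \<and> Q' M R as)"
    by (rule fo_queryI[of _ _ _ "Conj \<psi> \<psi>'"]) (use 1 in \<open>auto simp: pos_fo_def\<close>)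
  show "fo_query L D n (\<lambda>M R as. Q M R as \<or> Q' M R as)"
    by (rule fo_queryI[of _ _ _ "Neg (Conj (Neg \<psi>) (Neg \<psi>'))"]) (use 1 in \<open>auto simp: pos_fo_def\<close>)
qed

lemma map_assign_append:
  assumes "length b = k"
  shows "map (assign v [n..<n+k] b) [0..<n+k] = map v [0..<n] @ b"
proof -
  have "map (assign v [n..<n+k] b) [n..<n+k] = b" using assms by (intro map_assign) auto
  moreover have "map (assign v [n..<n+k] b) [0..<n] = map v [0..<n]" by (auto simp: assign_notin)
  ultimately show ?thesis using upt_add_eq_append[of 0 n k] by simp
qed

lemma
  assumes "fo_query L D (n + k) Q"
  shows fo_query_ex: "fo_query L D n (\<lambda>M R as. \<exists>b \<in> tuples (univ M) k. Q M R (as @ b))"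
    and fo_query_all: "fo_query L D n (\<lambda>M R as. \<forall>b \<in> tuples (univ M) k. Q M R (as @ b))"
proof -
  from assms obtain \<psi> where 1: "pos_fo L D (n + k) \<psi>"
    and 2: "\<And>M R v. is_structure L M \<Longrightarrow> (\<And>i. i < n + k \<Longrightarrow> v i \<in> univ M) \<Longrightarrow>
      sat M R v \<psi> \<longleftrightarrow> Q M R (map v [0..<n+k])"
    by (elim fo_query_sat) blast
  have 3: "sat M R (assign v [n..<n+k] b) \<psi> \<longleftrightarrow> Q M R (map v [0..<n] @ b)"
    if "is_structure L M" "\<forall>i<n. v i \<in> univ M" "b \<in> tuples (univ M) k" for M R v b
  proof -
    have "sat M R (assign v [n..<n+k] b) \<psi> \<longleftrightarrow> Q M R (map (assign v [n..<n+k] b) [0..<n+k])"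
      using that by (intro 2 assign_in) (auto simp: tuples_def not_less)
    then show ?thesis using that by (simp add: map_assign_append tuples_length)
  qed
  have 4: "pos_fo L D n (Exs [n..<n+k] \<psi>)" "pos_fo L D n (Neg (Exs [n..<n+k] (Neg \<psi>)))"
    using 1 by (auto simp: pos_fo_def)
  show "fo_query L D n (\<lambda>M R as. \<exists>b \<in> tuples (univ M) k. Q M R (as @ b))"
    unfolding fo_query_def using 3 4(1) by (intro exI[of _ "Exs [n..<n+k] \<psi>"]) (simp add: sat_Exs)
  show "fo_query L D n (\<lambda>M R as. \<forall>b \<in> tuples (univ M) k. Q M R (as @ b))"
    unfolding fo_query_def using 3 4(2)
    by (intro exI[of _ "Neg (Exs [n..<n+k] (Neg \<psi>))"]) (simp add: sat_Exs)
qed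

text \<open>All later constructions rest on this closure property: the relations that a query reads
  may be replaced by sets that other queries define from the current tuple. Separate supplies of
  variables keep the quantifiers of the outer formula from capturing the parameters of the inner
  ones.\<close>

lemma fo_query_sub:
  assumes Q: "fo_query L D m Q" and js: "length js = m" "set js \<subseteq> {..<n}"
    and G: "\<And>S. S \<in> D \<Longrightarrow> fo_query L D' (n + arity S) (G S)"
  shows "fo_query L D' n (\<lambda>M R as. Q M (\<lambda>S. {b. G S M R (as @ b)}) (map ((!) as) js))"
proof -
  from Q obtain \<psi> where \<psi>: "pos_fo L D m \<psi>"
    and sat\<psi>: "\<And>M R v. is_structure L M \<Longrightarrow> (\<And>i. i < m \<Longrightarrow> v i \<in> univ M) \<Longrightarrow>
      sat M R v \<psi> \<longleftrightarrow> Q M R (map v [0..<m])"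
    by (elim fo_query_sat) blast
  have "\<forall>S \<in> D. \<exists>\<gamma>. pos_fo L D' (n + arity S) \<gamma> \<and> (\<forall>M R v. is_structure L M \<longrightarrow>
      (\<forall>i < n + arity S. v i \<in> univ M) \<longrightarrow> sat M R v \<gamma> = G S M R (map v [0..<n + arity S]))"
    using G unfolding fo_query_def by blast
  then obtain \<gamma> where \<gamma>: "\<And>S. S \<in> D \<Longrightarrow> pos_fo L D' (n + arity S) (\<gamma> S)"
    and sat\<gamma>: "\<And>S M R v. S \<in> D \<Longrightarrow> is_structure L M \<Longrightarrow> (\<And>i. i < n + arity S \<Longrightarrow> v i \<in> univ M) \<Longrightarrow>
      sat M R v (\<gamma> S) \<longleftrightarrow> G S M R (map v [0..<n + arity S])"
    unfolding bchoice_iff by metis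
  \<comment> \<open>Above the parameters, variables are split by the parity of their distance from
    \<open>n\<close>: \<open>\<rho>\<close> moves those of the outer formula to odd distances, while
    \<open>\<rho>'\<close> keeps the parameters and moves the remaining variables of the inner
    formulas to even distances.\<close>
  define \<rho> where "\<rho> = (\<lambda>i::nat. Suc (n + 2 * i))"
  define \<rho>' where "\<rho>' = (\<lambda>i. if i < n then i else n + 2 * (i - n))"
  define g where "g = (\<lambda>S ts. Lets (map \<rho>' [n..<n + arity S]) ts (sub \<rho>' RVar (\<gamma> S)))"
  have inj: "inj \<rho>" and inj': "inj \<rho>'"
    by (auto simp: inj_def \<rho>_def \<rho>'_def split: if_splits)
  have disj: "{..<n} \<inter> range \<rho> = {}" "range \<rho>' \<inter> range \<rho> = {}"
    unfolding \<rho>_def \<rho>'_def by auto presburger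
  have posg: "wf_fm L (sub \<rho>' RVar (\<gamma> S))" "first_order (sub \<rho>' RVar (\<gamma> S))"
    "frv (sub \<rho>' RVar (\<gamma> S)) \<subseteq> D'" "positive T (sub \<rho>' RVar (\<gamma> S))"
    "fv (sub \<rho>' RVar (\<gamma> S)) \<subseteq> \<rho>' ` {..<n + arity S}" if S: "S \<in> D" for S T
  proof -
    have pos: "pos_fo L D' (n + arity S) (\<gamma> S)" using \<gamma> S by blast
    show "wf_fm L (sub \<rho>' RVar (\<gamma> S))" 
      by (rule wf_fm_sub) (use pos in \<open>auto simp: pos_fo_def\<close>)
    show "first_order (sub \<rho>' RVar (\<gamma> S))" 
      by (rule first_order_sub) (use pos in \<open>auto simp: pos_fo_def\<close>)
    show "frv (sub \<rho>' RVar (\<gamma> S)) \<subseteq> D'" 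
      by (rule frv_sub) (use pos in \<open>auto simp: pos_fo_def\<close>)
    show "positive T (sub \<rho>' RVar (\<gamma> S))" 
      by (rule positive_sub) (use pos in \<open>auto simp: pos_fo_def\<close>)
    have "fv (sub \<rho>' RVar (\<gamma> S)) \<subseteq> {} \<union> \<rho>' ` fv (\<gamma> S)"
      by (rule fv_sub[OF inj']) (use pos in \<open>auto simp: pos_fo_def\<close>)
    then show "fv (sub \<rho>' RVar (\<gamma> S)) \<subseteq> \<rho>' ` {..<n + arity S}"
      using pos unfolding pos_fo_def by blast
  qed
  have fvg: "fv (g S ts) \<subseteq> {..<n} \<union> (\<Union>t \<in> set ts. tvars t)"
    if S: "S \<in> D" and "length ts = arity S" for S ts
  proof -
    have "\<rho>' ` {..<n + arity S} \<subseteq> {..<n} \<union> set (map \<rho>' [n..<n + arity S])"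
      by (auto simp: \<rho>'_def)
    moreover have "fv (g S ts) \<subseteq> (\<Union>t \<in> set ts. tvars t) \<union>
      (fv (sub \<rho>' RVar (\<gamma> S)) - set (map \<rho>' [n..<n + arity S]))"
      using that by (auto simp: g_def)
    moreover have "X \<subseteq> T \<union> (F - Z) \<Longrightarrow> F \<subseteq> I \<Longrightarrow> I \<subseteq> N \<union> Z \<Longrightarrow> X \<subseteq> N \<union> T" for X T F Z I N :: "nat set"
      by blast
    ultimately show ?thesis using posg(5)[OF S] by metis
  qed
  have posg': "\<forall>t \<in> set ts. wf_tm L t \<Longrightarrow> wf_fm L (g S ts)" "first_order (g S ts)"
    "frv (g S ts) \<subseteq> D'" "positive T (g S ts)"
    if "S \<in> frv \<psi>" "length ts = arity S" for S ts T
  proof -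
    have S: "S \<in> D" using that \<psi> by (auto simp: pos_fo_def)
    show "\<forall>t \<in> set ts. wf_tm L t \<Longrightarrow> wf_fm L (g S ts)" "first_order (g S ts)"
      "frv (g S ts) \<subseteq> D'" "positive T (g S ts)"
      using that posg(1-4)[OF S] by (simp_all add: g_def)
  qed
  let ?\<chi> = "Lets (map \<rho> [0..<m]) (map Var js) (sub \<rho> g \<psi>)"
  have wf\<psi>: "first_order \<psi>" "wf_fm L \<psi>" "\<And>S. positive S \<psi>"
    using \<psi> unfolding pos_fo_def by blast+
  have "wf_fm L (sub \<rho> g \<psi>)"
    by (rule wf_fm_sub[OF wf\<psi>(1,2)]) (rule posg'(1))
  moreover have "first_order (sub \<rho> g \<psi>)"
    by (rule first_order_sub[OF wf\<psi>(1) _ wf\<psi>(2)]) (rule posg'(2))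
  moreover have "positive T (sub \<rho> g \<psi>)" for T
    by (rule positive_sub[OF wf\<psi>(1,2)]) (rule wf\<psi>(3), rule posg'(4))
  moreover have "frv (sub \<rho> g \<psi>) \<subseteq> D'"
    by (rule frv_sub[OF wf\<psi>(1,2)]) (rule posg'(3))
  moreover
    have "fv ?\<chi> \<subseteq> {..<n}"
  proof -
    have "fv (sub \<rho> g \<psi>) \<subseteq> {..<n} \<union> \<rho> ` fv \<psi>"
      by (rule fv_sub[OF inj disj(1) wf\<psi>(1,2)], rule fvg) (use \<psi> in \<open>auto simp: pos_fo_def\<close>)
    moreover have "\<rho> ` fv \<psi> \<subseteq> set (map \<rho> [0..<m])"
      using \<psi> by (auto simp: pos_fo_def)
    moreover have "fv ?\<chi> = (set js \<union> fv (sub \<rho> g \<psi>)) - set (map \<rho> [0..<m])"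
      using js(1) by (subst Lets_simps) auto
    ultimately show ?thesis using js(2) by blast
  qed
  ultimately have "pos_fo L D' n ?\<chi>"
    using js(1) by (simp add: pos_fo_def del: Lets_simps(5))
  moreover have "sat M R v ?\<chi> = Q M (\<lambda>S. {b. G S M R (map v [0..<n] @ b)}) (map ((!) (map v [0..<n])) js)"
    if M: "is_structure L M" and v: "\<forall>i<n. v i \<in> univ M"
    for M :: "('c, 'a, 'b) fo_struct" and R :: "rvar \<Rightarrow> 'c list set" and v :: "nat \<Rightarrow> 'c"
  proof -
    let ?v = "assign v (map \<rho> [0..<m]) (map v js)"
    let ?R = "\<lambda>S. {b. G S M R (map v [0..<n] @ b)}"
    have js_map: "map ((!) (map v [0..<n])) js = map v js"
      using js by (auto simp: subset_iff)
    have js_univ: "set (map v js) \<subseteq> univ M"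
      using js v by (auto simp: subset_iff)
    have dist: "distinct (map \<rho> [0..<m])"
      using inj by (simp add: distinct_map inj_on_def inj_def)
    have vr: "map ?v (map \<rho> [0..<m]) = map v js"
      by (rule map_assign) (use dist js in auto)
    have vjs: "map (tval M v) (map Var js) = map v js" by simp
    have "sat M R v ?\<chi> \<longleftrightarrow> sat M R ?v (sub \<rho> g \<psi>)"
      unfolding vjs[symmetric]
    proof (rule sat_Lets[OF dist])
      show "tvars t \<inter> set (map \<rho> [0..<m]) = {}" if "t \<in> set (map Var js)" for t
        using that js(2) disj(1) by auto blast
    qed (use js v in auto)
    also have "\<dots> \<longleftrightarrow> sat M ?R (?v \<circ> \<rho>) \<psi>"
    proof (rule sat_sub[OF inj M, of v D])
      fix v' S ts
      assume v': "\<And>i. i \<notin> range \<rho> \<Longrightarrow> v' i = v i"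
        and ts: "\<And>t. t \<in> set ts \<Longrightarrow> tvars t \<subseteq> range \<rho> \<and> tval M v' t \<in> univ M"
        and len: "length ts = arity S" and S: "S \<in> D"
      let ?zs = "map \<rho>' [n..<n + arity S]" and ?b = "map (tval M v') ts"
      let ?w = "assign v' ?zs ?b"
      have dist': "distinct ?zs"
        using inj' by (simp add: distinct_map inj_on_def inj_def)
      have w1: "?w (\<rho>' i) = v i" if "i < n" for i
      proof -
        have "\<rho>' i \<notin> set ?zs" using that by (auto simp: \<rho>'_def)
        moreover have "\<rho>' i \<notin> range \<rho>" using disj(2) by auto
        moreover have "\<rho>' i = i" using that by (simp add: \<rho>'_def)
        ultimately show ?thesis using v' by (simp add: assign_notin)
      qed
      have w2: "map ?w ?zs = ?b"
        by (rule map_assign) (use dist' len in auto)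
      have w: "map (?w \<circ> \<rho>') [0..<n + arity S] = map v [0..<n] @ ?b"
        unfolding upt_add_eq_append[OF le0] map_append using w1 w2 by (simp add: comp_def)
      have "sat M R v' (g S ts) \<longleftrightarrow> sat M R ?w (sub \<rho>' RVar (\<gamma> S))"
        unfolding g_def
        by (rule sat_Lets) (use dist' len ts disj(2) in \<open>auto, blast\<close>)
      also have "\<dots> \<longleftrightarrow> sat M R (?w \<circ> \<rho>') (\<gamma> S)"
      proof (rule sat_sub[OF inj' M, of ?w UNIV])
        show "?w (\<rho>' i) \<in> univ M" if "i \<in> fv (\<gamma> S)" for i
        proof -
          have "i < n + arity S" using that \<gamma>[OF S] by (auto simp: pos_fo_def)
          then have "(map (?w \<circ> \<rho>') [0..<n + arity S]) ! i = ?w (\<rho>' i)" by simp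
          moreover have "set (map v [0..<n] @ ?b) \<subseteq> univ M" using v ts by auto
          ultimately show ?thesis
            using \<open>i < n + arity S\<close> w len by (metis (no_types, lifting) length_map length_upt diff_zero nth_mem subset_iff)
        qed
      qed (use \<gamma>[OF S] in \<open>auto simp: pos_fo_def\<close>)
      also have "\<dots> \<longleftrightarrow> G S M R (map (?w \<circ> \<rho>') [0..<n + arity S])"
      proof (rule sat\<gamma>[OF S M])
        fix i assume "i < n + arity S"
        then have "(map (?w \<circ> \<rho>') [0..<n + arity S]) ! i = (?w \<circ> \<rho>') i" by simp
        moreover have "set (map v [0..<n] @ ?b) \<subseteq> univ M" using v ts by auto
        ultimately show "(?w \<circ> \<rho>') i \<in> univ M"
          using \<open>i < n + arity S\<close> w len by (metis (no_types, lifting) length_map length_upt diff_zero nth_mem subset_iff)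
      qed
      finally show "sat M R v' (g S ts) \<longleftrightarrow> ?b \<in> ?R S" using w by simp
    next
      show "?v i = v i" if "i \<notin> range \<rho>" for i
        using that by (auto intro!: assign_notin)
      show "?v (\<rho> i) \<in> univ M" if "i \<in> fv \<psi>" for i
        using that \<psi> js(1) js_univ by (intro assign_in) (auto simp: pos_fo_def)
    qed (use \<psi> in \<open>auto simp: pos_fo_def\<close>)
    also have "\<dots> \<longleftrightarrow> Q M ?R (map (?v \<circ> \<rho>) [0..<m])"
      by (rule sat\<psi>[OF M], unfold o_apply, rule assign_in) (use js(1) js_univ in auto)
    also have "map (?v \<circ> \<rho>) [0..<m] = map v js" using vr by simp
    finally show ?thesis unfolding js_map .
  qed
  ultimately show ?thesis unfolding fo_query_def by (intro exI[of _ ?\<chi>]) simp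
qed

section \<open>Block variables\<close>

lemma fo_query_formula:
  assumes "wf_fm L \<psi>" "first_order \<psi>" "\<And>S. positive S \<psi>" "frv \<psi> \<subseteq> D" "fv \<psi> \<subseteq> {..<n}"
  shows "fo_query L D n (\<lambda>M R as. sat M R ((!) as) \<psi>)"
  by (rule fo_queryI[of _ _ _ \<psi>]) (use assms in \<open>auto simp: pos_fo_def\<close>)

lemma fo_query_atom:
  assumes "S \<in> D"
  shows "fo_query L D (n + arity S) (\<lambda>M R as. drop n as \<in> R S)"
proof -
  have "fo_query L D (n + arity S) (\<lambda>M R as. sat M R ((!) as) (RVar S (map Var [n..<n + arity S])))"
    by (rule fo_query_formula) (use assms in auto)
  then show ?thesis
  proof (rule fo_query_cong)
    fix M :: "('c, 'a, 'b) fo_struct" and R :: "rvar \<Rightarrow> 'c list set" and as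
    assume "as \<in> tuples (univ M) (n + arity S)"
    then have "map ((!) as) [n..<n + arity S] = drop n as"
      by (auto simp: tuples_def list_eq_iff_nth_eq)
    then show "sat M R ((!) as) (RVar S (map Var [n..<n + arity S])) = (drop n as \<in> R S)"
      by (simp add: comp_def)
  qed
qed

lemma fo_query_eq: "i < n \<Longrightarrow> j < n \<Longrightarrow> fo_query L D n (\<lambda>M R as. as ! i = as ! j)"
  using fo_query_formula[of L "Eq (Var i) (Var j)" D n] by simp

lemma fo_query_neq: "i < n \<Longrightarrow> j < n \<Longrightarrow> fo_query L D n (\<lambda>M R as. as ! i \<noteq> as ! j)"
  using fo_query_formula[of L "Neg (Eq (Var i) (Var j))" D n] by simp

lemma fo_query_const: "fo_query L D n (\<lambda>M R as. c)"
proof (cases c)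
  case True
  then show ?thesis
    using fo_query_formula[of L "Neg (Exi 0 (Neg (Eq (Var 0) (Var 0))))" D n] by simp
next
  case False
  then show ?thesis
    using fo_query_formula[of L "Exi 0 (Neg (Eq (Var 0) (Var 0)))" D n] by simp
qed

text \<open>Queries with several tuple arguments are coded as queries on their concatenation.\<close>

primrec blocks :: "nat list \<Rightarrow> 'a list \<Rightarrow> nat \<Rightarrow> 'a list" where
  "blocks [] as = (\<lambda>_. [])"
| "blocks (k # \<alpha>) as = (\<lambda>b. case b of 0 \<Rightarrow> take k as | Suc b \<Rightarrow> blocks \<alpha> (drop k as) b)"

lemma blocks_snoc:
  "length as = sum_list \<alpha> \<Longrightarrow> length u = k \<Longrightarrow>
   blocks (\<alpha> @ [k]) (as @ u) = (blocks \<alpha> as)(length \<alpha> := u)"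
  by (induction \<alpha> arbitrary: as) (auto simp: fun_eq_iff split: nat.split)

lemma blocks_in_tuples:
  "as \<in> tuples A (sum_list \<alpha>) \<Longrightarrow> b < length \<alpha> \<Longrightarrow> blocks \<alpha> as b \<in> tuples A (\<alpha> ! b)"
proof (induction \<alpha> arbitrary: as b)
  case (Cons k \<alpha>)
  then obtain a as' where *: "as = a @ as'" "a \<in> tuples A k" "as' \<in> tuples A (sum_list \<alpha>)"
    by (auto simp: tuples_split)
  then show ?case using Cons
    by (cases b) (auto dest: tuples_length)
qed simp

text \<open>A selector copies coordinates from positions that do not depend on the tuple. Such
  argument lists can be expressed by renaming the variables of a formula over the
  concatenation.\<close>

definition selector :: "nat list \<Rightarrow> nat \<Rightarrow> ((nat \<Rightarrow> 'a list) \<Rightarrow> 'a list) \<Rightarrow> bool" where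
  "selector \<alpha> m f \<longleftrightarrow> (\<exists>js. length js = m \<and> set js \<subseteq> {..<sum_list \<alpha>} \<and>
     (\<forall>as. length as = sum_list \<alpha> \<longrightarrow> f (blocks \<alpha> as) = map ((!) as) js))"

lemma selector_block:
  assumes "b < length \<alpha>" "m = \<alpha> ! b"
  shows "selector \<alpha> m (\<lambda>e :: nat \<Rightarrow> 'a list. e b)"
  using assms
proof (induction \<alpha> arbitrary: b)
  case (Cons k \<alpha>)
  show ?case
  proof (cases b)
    case 0
    then show ?thesis using Cons.prems unfolding selector_def
      by (intro exI[of _ "[0..<k]"]) (auto simp: list_eq_iff_nth_eq)
  next
    case (Suc b')
    have "selector \<alpha> m (\<lambda>e :: nat \<Rightarrow> 'a list. e b')"
      using Cons.prems Suc by (intro Cons.IH) auto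
    then obtain js where js: "length js = m" "set js \<subseteq> {..<sum_list \<alpha>}"
      "\<And>as :: 'a list. length as = sum_list \<alpha> \<Longrightarrow> blocks \<alpha> as b' = map ((!) as) js"
      unfolding selector_def by blast
    show ?thesis unfolding selector_def
      by (intro exI[of _ "map ((+) k) js"]) (use js Suc in \<open>auto simp: subset_iff\<close>)
  qed
qed simp

lemma selector_append:
  assumes "selector \<alpha> m f" "selector \<alpha> n g"
  shows "selector \<alpha> (m + n) (\<lambda>e. f e @ g e)"
proof -
  from assms obtain js js' where "length js = m \<and> set js \<subseteq> {..<sum_list \<alpha>} \<and>
     (\<forall>as. length as = sum_list \<alpha> \<longrightarrow> f (blocks \<alpha> as) = map ((!) as) js)"
    "length js' = n \<and> set js' \<subseteq> {..<sum_list \<alpha>} \<and>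
     (\<forall>as. length as = sum_list \<alpha> \<longrightarrow> g (blocks \<alpha> as) = map ((!) as) js')"
    unfolding selector_def by blast
  then show ?thesis unfolding selector_def
    by (intro exI[of _ "js @ js'"]) auto
qed

lemma selector_map_nth:
  assumes "selector \<alpha> k f" "set is \<subseteq> {..<k}" "length is = m"
  shows "selector \<alpha> m (\<lambda>e. map ((!) (f e)) is)"
proof -
  from assms(1) obtain js where "length js = k \<and> set js \<subseteq> {..<sum_list \<alpha>} \<and>
     (\<forall>as. length as = sum_list \<alpha> \<longrightarrow> f (blocks \<alpha> as) = map ((!) as) js)"
    unfolding selector_def by blast
  with assms(2,3) show ?thesis unfolding selector_def
    by (intro exI[of _ "map ((!) js) is"]) (auto simp: subset_iff)
qed

lemma selector_cong:
  assumes "selector \<alpha> m f"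
    and "\<And>e. (\<And>b. b < length \<alpha> \<Longrightarrow> length (e b) = \<alpha> ! b) \<Longrightarrow> f e = g e"
  shows "selector \<alpha> m g"
proof -
  have "f (blocks \<alpha> as) = g (blocks \<alpha> as)" if "length as = sum_list \<alpha>" for as
  proof (rule assms(2))
    fix b assume "b < length \<alpha>"
    then show "length (blocks \<alpha> as b) = \<alpha> ! b"
      using blocks_in_tuples[of as UNIV \<alpha> b] that by (auto simp: tuples_def)
  qed
  with assms(1) show ?thesis unfolding selector_def by metis
qed

text \<open>Updating a tuple is a selection of coordinates from the tuple followed by the new
  values. The positions to select are obtained by performing the same update on positions instead of
  values.\<close>

lemma nth_append_assign:
  assumes "length p = m" "length x = length xs" "i < m"
  shows "assign ((!) p) xs x i = (p @ x) ! (assign id xs [m..<m + length xs] i)"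
proof -
  have "map ((!) (p @ x)) [m..<m + length xs] = x"
    using assms(1,2) by (intro nth_equalityI) (simp_all add: nth_append)
  then have "(p @ x) ! (assign id xs [m..<m + length xs] i) = assign ((!) (p @ x)) xs x i"
    using assign_map[of "(!) (p @ x)" id xs "[m..<m + length xs]" i] by simp
  also have "\<dots> = assign ((!) p) xs x i"
    using assms by (intro assign_cong) (simp_all add: nth_append)
  finally show ?thesis by (rule sym)
qed

lemma selector_assign:
  assumes "b < length \<alpha>" "c < length \<alpha>" "\<alpha> ! b = m" "\<alpha> ! c = length xs"
  shows "selector \<alpha> m (\<lambda>e. map (assign ((!) (e b)) xs (e c)) [0..<m])"
proof (rule selector_cong)
  let ?is = "map (assign id xs [m..<m + length xs]) [0..<m]"
  have "assign id xs [m..<m + length xs] i \<in> {..<m + length xs}" if "i < m" for i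
    using that by (intro assign_in) auto
  then show "selector \<alpha> m (\<lambda>e. map ((!) (e b @ e c)) ?is)"
    using assms by (intro selector_map_nth[where k = "m + length xs"] selector_append selector_block) auto
  show "map ((!) (e b @ e c)) ?is = map (assign ((!) (e b)) xs (e c)) [0..<m]"
    if "\<And>b. b < length \<alpha> \<Longrightarrow> length (e b) = \<alpha> ! b" for e :: "nat \<Rightarrow> 'a list"
    using that assms by (auto simp: nth_append_assign)
qed

definition block_query ::
    "('f, 'r) language \<Rightarrow> rvar set \<Rightarrow> nat list \<Rightarrow>
     (('a, 'f, 'r) fo_struct \<Rightarrow> (rvar \<Rightarrow> 'a list set) \<Rightarrow> (nat \<Rightarrow> 'a list) \<Rightarrow> bool) \<Rightarrow> bool" where
  "block_query L D \<alpha> F \<longleftrightarrow> fo_query L D (sum_list \<alpha>) (\<lambda>M R as. F M R (blocks \<alpha> as))"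

lemma block_query_cong:
  assumes "block_query L D \<alpha> F"
    and "\<And>M R e. is_structure L M \<Longrightarrow> (\<And>b. b < length \<alpha> \<Longrightarrow> e b \<in> tuples (univ M) (\<alpha> ! b)) \<Longrightarrow>
      F M R e = G M R e"
  shows "block_query L D \<alpha> G"
  using assms(1) unfolding block_query_def
  by (rule fo_query_cong) (auto intro!: assms(2) blocks_in_tuples)

lemma block_query_and:
  "block_query L D \<alpha> F \<Longrightarrow> block_query L D \<alpha> G \<Longrightarrow> block_query L D \<alpha> (\<lambda>M R e. F M R e \<and> G M R e)"
  unfolding block_query_def by (rule fo_query_and)

lemma block_query_or:
  "block_query L D \<alpha> F \<Longrightarrow> block_query L D \<alpha> G \<Longrightarrow> block_query L D \<alpha> (\<lambda>M R e. F M R e \<or> G M R e)"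
  unfolding block_query_def by (rule fo_query_or)

lemma block_query_if:
  assumes "c \<Longrightarrow> block_query L D \<alpha> F" "\<not> c \<Longrightarrow> block_query L D \<alpha> G"
  shows "block_query L D \<alpha> (\<lambda>M R e. if c then F M R e else G M R e)"
  using assms by (cases c) simp_all

lemma block_query_const: "block_query L D \<alpha> (\<lambda>M R e. c)"
  unfolding block_query_def by (rule fo_query_const)

text \<open>The quantified tuple becomes the last block, with index \<open>length \<alpha>\<close>.
  The second hypothesis is a freshness condition: \<open>H\<close> receives this block as its last
  argument only.\<close>

lemma block_query_ex:
  assumes "block_query L D (\<alpha> @ [k]) (\<lambda>M R e. H M R e (e (length \<alpha>)))"
    and "\<And>M R e x u. H M R (e(length \<alpha> := x)) u = H M R e u"
  shows "block_query L D \<alpha> (\<lambda>M R e. \<exists>u \<in> tuples (univ M) k. H M R e u)"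
proof -
  have "fo_query L D (sum_list \<alpha> + k)
      (\<lambda>M R as. H M R (blocks (\<alpha> @ [k]) as) (blocks (\<alpha> @ [k]) as (length \<alpha>)))"
    using assms(1) by (simp add: block_query_def)
  from fo_query_ex[OF this] show ?thesis unfolding block_query_def
    by (rule fo_query_cong) (auto simp: blocks_snoc tuples_length assms(2) intro!: bex_cong)
qed

lemma block_query_all:
  assumes "block_query L D (\<alpha> @ [k]) (\<lambda>M R e. H M R e (e (length \<alpha>)))"
    and "\<And>M R e x u. H M R (e(length \<alpha> := x)) u = H M R e u"
  shows "block_query L D \<alpha> (\<lambda>M R e. \<forall>u \<in> tuples (univ M) k. H M R e u)"
proof -
  have "fo_query L D (sum_list \<alpha> + k)
      (\<lambda>M R as. H M R (blocks (\<alpha> @ [k]) as) (blocks (\<alpha> @ [k]) as (length \<alpha>)))"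
    using assms(1) by (simp add: block_query_def)
  from fo_query_all[OF this] show ?thesis unfolding block_query_def
    by (rule fo_query_cong) (auto simp: blocks_snoc tuples_length assms(2) intro!: ball_cong)
qed

lemma block_query_sub:
  assumes Q: "fo_query L D m Q" and f: "selector \<alpha> m f"
    and G: "\<And>S. S \<in> D \<Longrightarrow> block_query L D' (\<alpha> @ [arity S]) (G S)"
  shows "block_query L D' \<alpha>
    (\<lambda>M R e. Q M (\<lambda>S. {b \<in> tuples (univ M) (arity S). G S M R (e(length \<alpha> := b))}) (f e))"
proof -
  \<comment> \<open>The first conjunct holds wherever the query is evaluated, so the same formula
    defines \<open>?G\<close>; it makes the substituted sets consist of tuples over the
    universe.\<close>
  let ?G = "\<lambda>S M R as. as \<in> tuples (univ M) (sum_list \<alpha> + arity S) \<and>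
    G S M R (blocks (\<alpha> @ [arity S]) as)"
  from f obtain js where js: "length js = m" "set js \<subseteq> {..<sum_list \<alpha>}"
    "\<And>as. length as = sum_list \<alpha> \<Longrightarrow> f (blocks \<alpha> as) = map ((!) as) js"
    unfolding selector_def by blast
  have "fo_query L D' (sum_list \<alpha> + arity S) (?G S)" if "S \<in> D" for S
    using G[OF that] unfolding block_query_def by simp (erule fo_query_cong, simp)
  from fo_query_sub[OF Q js(1,2) this]
  have "fo_query L D' (sum_list \<alpha>) (\<lambda>M R as. Q M (\<lambda>S. {b. ?G S M R (as @ b)}) (map ((!) as) js))" .
  then show ?thesis unfolding block_query_def
  proof (rule fo_query_cong)
    fix M :: "('c, 'a, 'b) fo_struct" and R :: "rvar \<Rightarrow> 'c list set" and as
    assume as: "as \<in> tuples (univ M) (sum_list \<alpha>)"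
    then have len: "length as = sum_list \<alpha>" by (rule tuples_length)
    have "{b. ?G S M R (as @ b)} =
        {b \<in> tuples (univ M) (arity S). G S M R ((blocks \<alpha> as)(length \<alpha> := b))}" for S
      using as by (auto simp: len blocks_snoc tuples_length)
    then show "Q M (\<lambda>S. {b. ?G S M R (as @ b)}) (map ((!) as) js) =
        Q M (\<lambda>S. {b \<in> tuples (univ M) (arity S). G S M R ((blocks \<alpha> as)(length \<alpha> := b))})
          (f (blocks \<alpha> as))"
      by (simp only: js(3)[OF len])
  qed
qed

lemma block_query_app:
  assumes Q: "fo_query L D m Q" and f: "selector \<alpha> m f"
  shows "block_query L D \<alpha> (\<lambda>M R e. Q M R (f e))"
proof -
  from f obtain js where js: "length js = m" "set js \<subseteq> {..<sum_list \<alpha>}"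
    "\<And>as. length as = sum_list \<alpha> \<Longrightarrow> f (blocks \<alpha> as) = map ((!) as) js"
    unfolding selector_def by blast
  from fo_query_sub[OF Q js(1,2) fo_query_atom]
  have "fo_query L D (sum_list \<alpha>)
    (\<lambda>M R as. Q M (\<lambda>S. {b. drop (sum_list \<alpha>) (as @ b) \<in> R S}) (map ((!) as) js))" .
  then show ?thesis unfolding block_query_def
    by (rule fo_query_cong) (auto simp: js(3) dest!: tuples_length)
qed

lemma block_query_mem:
  assumes "S \<in> D" "selector \<alpha> (arity S) f"
  shows "block_query L D \<alpha> (\<lambda>M R e. f e \<in> R S)"
  using block_query_app[OF _ assms(2), of L D "\<lambda>M R as. as \<in> R S"] fo_query_atom[OF assms(1), of L 0]
  by simp

lemma block_query_fo:
  "block_query L D \<alpha> F \<Longrightarrow> n = sum_list \<alpha> \<Longrightarrow> fo_query L D n (\<lambda>M R as. F M R (blocks \<alpha> as))"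
  by (simp add: block_query_def)

section \<open>Stage comparison by runs\<close>

text \<open>\<open>Y \<kappa>\<close> is the result of the run with key \<open>\<kappa>\<close>;
  \<open>t\<close> and \<open>s\<close> read from it the answers yes and no to membership in
  \<open>\<Gamma>\<close> of the stage belonging to \<open>\<kappa>\<close>. One stage that has
  \<open>x\<close> and lacks \<open>y\<close> shows that \<open>x\<close> enters earlier.\<close>

definition run_less :: "'k set \<Rightarrow> ('w set \<Rightarrow> 'b \<Rightarrow> bool) \<Rightarrow> ('w set \<Rightarrow> 'b \<Rightarrow> bool) \<Rightarrow>
    ('k \<Rightarrow> 'w set) \<Rightarrow> 'b \<Rightarrow> 'b \<Rightarrow> bool" where
  "run_less K t s Y x y \<longleftrightarrow> (\<exists>\<kappa> \<in> K. t (Y \<kappa>) x \<and> s (Y \<kappa>) y)"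

text \<open>Here \<open>x\<close> enters at the latest right after the stage of
  \<open>pt \<kappa>\<close>, and \<open>y\<close> is missing from that stage, so \<open>y\<close>
  cannot precede \<open>x\<close>. That \<open>y\<close> is missing is expressed by
  \<open>run_less\<close> and not by a negation. For a base key the stage is empty and misses every
  \<open>y\<close>.\<close>

definition run_le :: "'k set \<Rightarrow> ('k \<Rightarrow> bool) \<Rightarrow> ('k \<Rightarrow> 'b) \<Rightarrow> ('w set \<Rightarrow> 'b \<Rightarrow> bool) \<Rightarrow>
    ('w set \<Rightarrow> 'b \<Rightarrow> bool) \<Rightarrow> ('k \<Rightarrow> 'w set) \<Rightarrow> 'b \<Rightarrow> 'b \<Rightarrow> bool" where
  "run_le K base pt t s Y x y \<longleftrightarrow>
     (\<exists>\<kappa> \<in> K. t (Y \<kappa>) x \<and> (base \<kappa> \<or> run_less K t s Y (pt \<kappa>) y))"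

definition run_pos where
  "run_pos U K base pt t s Y \<kappa> = {z \<in> U. \<not> base \<kappa> \<and> run_le K base pt t s Y z (pt \<kappa>)}"

definition run_neg where
  "run_neg U K base pt t s Y \<kappa> = {z \<in> U. base \<kappa> \<or> run_less K t s Y (pt \<kappa>) z}"

text \<open>An element is outside the fixed point if it is outside a stage that is already closed
  under \<open>\<Gamma>\<close>.\<close>

definition run_out where
  "run_out U K base pt t s Y x \<longleftrightarrow>
     (\<exists>\<kappa> \<in> K. (base \<kappa> \<or> run_less K t s Y (pt \<kappa>) x) \<and>
        (\<forall>y \<in> U. s (Y \<kappa>) y \<or> \<not> base \<kappa> \<and> run_le K base pt t s Y y (pt \<kappa>)))"

section \<open>Stages of a monotone operator on a finite set\<close>

locale stage_comparison =
  fixes U :: "'b set" and \<Gamma> :: "'b set \<Rightarrow> 'b set"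
  assumes finite_U: "finite U" and mono_\<Gamma>: "mono \<Gamma>" and \<Gamma>_sub: "\<And>X. \<Gamma> X \<subseteq> U"
begin

abbreviation "J \<equiv> stage \<Gamma>"

text \<open>Together with \<open>less\<close>, the stage comparison relations of an induction. An
  element outside the fixed point counts as entering at infinity, and the conjunct
  \<open>x \<in> lfp \<Gamma>\<close> leaves two such elements unrelated.\<close>

definition le :: "'b \<Rightarrow> 'b \<Rightarrow> bool" where
  "le x y \<longleftrightarrow> x \<in> lfp \<Gamma> \<and> (\<forall>k. y \<in> J k \<longrightarrow> x \<in> J k)"

definition less :: "'b \<Rightarrow> 'b \<Rightarrow> bool" where
  "less x y \<longleftrightarrow> (\<exists>k. x \<in> J k \<and> y \<notin> J k)"

lemma lfp_eq: "lfp \<Gamma> = (\<Union>k. J k)"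
  using stages_stabilise(2)[OF mono_\<Gamma> finite_U \<Gamma>_sub] by (simp add: stage_union_def)

lemma J_le: "j \<le> k \<Longrightarrow> x \<in> J j \<Longrightarrow> x \<in> J k"
  using stage_subset_mono[OF mono_\<Gamma>] by blast

lemma J_0: "J 0 = \<Gamma> {}"
  by (subst stage.simps) simp

lemma J_sub: "J k \<subseteq> U"
  unfolding stage.simps[of \<Gamma> k] by (rule \<Gamma>_sub)

lemma first_stage:
  assumes "x \<in> lfp \<Gamma>"
  shows "\<exists>k. x \<in> J k \<and> (\<forall>j<k. x \<notin> J j)"
proof -
  from assms obtain k where "x \<in> J k" by (auto simp: lfp_eq)
  then have "x \<in> J (LEAST k. x \<in> J k)" by (rule LeastI)
  then show ?thesis by (intro exI[of _ "LEAST k. x \<in> J k"]) (auto dest: not_less_Least)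
qed

lemma lfp_is_stage: obtains k where "lfp \<Gamma> = J k"
  using stages_stabilise[OF mono_\<Gamma> finite_U \<Gamma>_sub] by metis

lemma le_first:
  assumes "u \<in> J k" "\<And>j. j < k \<Longrightarrow> u \<notin> J j"
  shows "{z \<in> U. le z u} = J k"
proof -
  have "z \<in> J j" if "z \<in> J k" "u \<in> J j" for z j
    using that assms(2)[of j] J_le[of k j] by (cases "j < k") auto
  then show ?thesis using assms J_sub[of k] by (auto simp: le_def lfp_eq)
qed

text \<open>If \<open>u\<close> never enters, its segment is the whole fixed point, which is a stage
  because \<open>U\<close> is finite. So a run whose point never enters still evaluates
  \<open>\<Gamma>\<close> at a genuine stage and cannot spoil soundness.\<close>

lemma le_segment:
  obtains k where "{z \<in> U. le z u} = J k"
proof (cases "u \<in> lfp \<Gamma>")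
  case True
  from first_stage[OF True] obtain k where "u \<in> J k \<and> (\<forall>j<k. u \<notin> J j)" ..
  then show ?thesis by (intro that le_first) auto
next
  case False
  obtain k where k: "lfp \<Gamma> = J k" by (rule lfp_is_stage)
  have "{z \<in> U. le z u} = J k"
    using False J_sub[of k] by (auto simp: le_def lfp_eq k[symmetric])
  then show ?thesis by (rule that)
qed

text \<open>If \<open>J k\<close> had nothing new, it would be the union of the earlier stages,
  hence closed under \<open>\<Gamma>\<close>, and nothing could be new in the next one. So a stage
  that still grows is named by one of its newest elements.\<close>

lemma new_at_stage:
  assumes "x \<in> J (Suc k)" "x \<notin> J k"
  obtains u where "u \<in> J k" "\<And>j. j < k \<Longrightarrow> u \<notin> J j"
proof (rule ccontr)
  assume "\<not> thesis"
  then have "J k \<subseteq> (\<Union>j<k. J j)" using that by blast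
  moreover have "(\<Union>j<k. J j) \<subseteq> J k" by (intro UN_least stage_subset_mono[OF mono_\<Gamma>]) simp
  ultimately have eq: "(\<Union>j<k. J j) = J k" by (rule subset_antisym[rotated])
  have "\<Gamma> (J k) = J k" using stage.simps[of \<Gamma> k] unfolding eq by (rule sym)
  with assms show False unfolding stage_Suc[OF mono_\<Gamma>] by simp
qed

end

text \<open>A run with key \<open>\<kappa>\<close> evaluates \<open>\<Gamma>\<close> at the empty set if \<open>\<kappa>\<close> is a base key, and at the stage
  in which \<open>pt \<kappa>\<close> appears otherwise.  It learns this stage and its complement only gradually,
  through the sets \<open>run_pos\<close> and \<open>run_neg\<close>, which are themselves computed by the runs.\<close>

locale stage_runs = stage_comparison U \<Gamma> for U :: "'b set" and \<Gamma> +
  fixes K :: "'k set" and base :: "'k \<Rightarrow> bool" and pt :: "'k \<Rightarrow> 'b"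
    and Op :: "'b set \<Rightarrow> 'b set \<Rightarrow> 'w set \<Rightarrow> 'w set"
    and t s :: "'w set \<Rightarrow> 'b \<Rightarrow> bool" and Y :: "'k \<Rightarrow> 'w set"
  assumes base: "\<exists>\<kappa> \<in> K. base \<kappa>"
    and nonbase: "\<And>u. u \<in> U \<Longrightarrow> \<exists>\<kappa> \<in> K. \<not> base \<kappa> \<and> pt \<kappa> = u"
    and pt: "\<And>\<kappa>. \<kappa> \<in> K \<Longrightarrow> pt \<kappa> \<in> U"
    and Op_mono: "\<And>P P' Q Q' X X'. P \<subseteq> P' \<Longrightarrow> Q \<subseteq> Q' \<Longrightarrow> X \<subseteq> X' \<Longrightarrow> Op P Q X \<subseteq> Op P' Q' X'"
    and t_mono: "\<And>X X' x. X \<subseteq> X' \<Longrightarrow> x \<in> U \<Longrightarrow> t X x \<Longrightarrow> t X' x"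
    and s_mono: "\<And>X X' x. X \<subseteq> X' \<Longrightarrow> x \<in> U \<Longrightarrow> s X x \<Longrightarrow> s X' x"
    and t_exact: "\<And>S x. S \<subseteq> U \<Longrightarrow> x \<in> U \<Longrightarrow> t (lfp (Op S (U - S))) x \<longleftrightarrow> x \<in> \<Gamma> S"
    and s_exact: "\<And>S x. S \<subseteq> U \<Longrightarrow> x \<in> U \<Longrightarrow> s (lfp (Op S (U - S))) x \<longleftrightarrow> x \<notin> \<Gamma> S"
    and Y_fix: "\<And>\<kappa>. \<kappa> \<in> K \<Longrightarrow>
      Y \<kappa> = Op (run_pos U K base pt t s Y \<kappa>) (run_neg U K base pt t s Y \<kappa>) (Y \<kappa>)"
    and Y_least: "\<And>Z \<kappa>. (\<And>\<kappa>. \<kappa> \<in> K \<Longrightarrow>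
      Op (run_pos U K base pt t s Z \<kappa>) (run_neg U K base pt t s Z \<kappa>) (Z \<kappa>) \<subseteq> Z \<kappa>) \<Longrightarrow>
      \<kappa> \<in> K \<Longrightarrow> Y \<kappa> \<subseteq> Z \<kappa>"
begin

abbreviation "LT \<equiv> run_less K t s"
abbreviation "LE \<equiv> run_le K base pt t s"

definition seg :: "'k \<Rightarrow> 'b set" where
  "seg \<kappa> = (if base \<kappa> then {} else {z \<in> U. le z (pt \<kappa>)})"

text \<open>What the run would produce if its stage and the complement were known completely from
  the start. The actual runs \<open>Y\<close> are compared with this ideal from both sides.\<close>

definition exact_run :: "'k \<Rightarrow> 'w set" where
  "exact_run \<kappa> = lfp (Op (seg \<kappa>) (U - seg \<kappa>))"

lemma exact_run_t: "x \<in> U \<Longrightarrow> t (exact_run \<kappa>) x \<longleftrightarrow> x \<in> \<Gamma> (seg \<kappa>)"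
  unfolding exact_run_def by (rule t_exact) (auto simp: seg_def)

lemma exact_run_s: "x \<in> U \<Longrightarrow> s (exact_run \<kappa>) x \<longleftrightarrow> x \<notin> \<Gamma> (seg \<kappa>)"
  unfolding exact_run_def by (rule s_exact) (auto simp: seg_def)

lemma \<Gamma>_seg: obtains k where "\<Gamma> (seg \<kappa>) = J k"
proof (cases "base \<kappa>")
  case True
  then show ?thesis using that[of 0] by (simp add: seg_def J_0)
next
  case False
  obtain k where k: "{z \<in> U. le z (pt \<kappa>)} = J k" by (rule le_segment)
  show ?thesis
    by (rule that[of "Suc k"]) (simp only: seg_def False if_False k stage_Suc[OF mono_\<Gamma>])
qed

lemma less_sound_exact: "LT exact_run x y \<Longrightarrow> x \<in> U \<Longrightarrow> y \<in> U \<Longrightarrow> less x y"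
  unfolding run_less_def less_def by (auto simp: exact_run_t exact_run_s) (metis \<Gamma>_seg)

text \<open>For a key that is not base, some \<open>J k\<close> has \<open>pt \<kappa>\<close> and
  lacks \<open>y\<close>. It includes \<open>seg \<kappa>\<close>, so \<open>x\<close> is in
  \<open>J (Suc k)\<close>, and no stage has \<open>y\<close> without \<open>x\<close>.\<close>

lemma le_sound_exact:
  assumes "LE exact_run x y" "x \<in> U" "y \<in> U"
  shows "le x y"
proof -
  from assms obtain \<kappa> where \<kappa>: "\<kappa> \<in> K" "x \<in> \<Gamma> (seg \<kappa>)" "base \<kappa> \<or> LT exact_run (pt \<kappa>) y"
    unfolding run_le_def using exact_run_t by blast
  show ?thesis
  proof (cases "base \<kappa>")
    case True
    with \<kappa> have "x \<in> J 0" by (simp add: seg_def J_0)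
    then show ?thesis using J_le[of 0] by (auto simp: le_def lfp_eq)
  next
    case False
    with \<kappa> pt assms have "less (pt \<kappa>) y" using less_sound_exact by blast
    then obtain k where k: "pt \<kappa> \<in> J k" "y \<notin> J k" by (auto simp: less_def)
    then have "seg \<kappa> \<subseteq> J k" using False by (auto simp: seg_def le_def)
    then have x: "x \<in> J (Suc k)"
      using \<kappa>(2) monoD[OF mono_\<Gamma>] by (auto simp: stage_Suc[OF mono_\<Gamma>])
    have "x \<in> J j" if "y \<in> J j" for j
    proof -
      have "\<not> j \<le> k" using that k J_le by blast
      then show ?thesis using x J_le[of "Suc k" j] by simp
    qed
    with x show ?thesis by (auto simp: le_def lfp_eq)
  qed
qed

lemma less_not_le: "less x y \<Longrightarrow> \<not> le y x"
  by (auto simp: less_def le_def)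

text \<open>Fed with their own comparisons, the exact runs are told true facts only. They are
  therefore closed under the rules defining \<open>Y\<close>, and leastness of \<open>Y\<close>
  applies.\<close>

lemma Y_sub_exact: "\<kappa> \<in> K \<Longrightarrow> Y \<kappa> \<subseteq> exact_run \<kappa>"
proof (rule Y_least)
  fix \<kappa> assume \<kappa>: "\<kappa> \<in> K"
  have "run_pos U K base pt t s exact_run \<kappa> \<subseteq> seg \<kappa>"
    using le_sound_exact pt[OF \<kappa>] by (auto simp: run_pos_def seg_def)
  moreover have "run_neg U K base pt t s exact_run \<kappa> \<subseteq> U - seg \<kappa>"
    using less_sound_exact less_not_le pt[OF \<kappa>] by (auto simp: run_neg_def seg_def)
  ultimately have "Op (run_pos U K base pt t s exact_run \<kappa>) (run_neg U K base pt t s exact_run \<kappa>)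
      (exact_run \<kappa>) \<subseteq> Op (seg \<kappa>) (U - seg \<kappa>) (exact_run \<kappa>)"
    by (intro Op_mono) auto
  also have "\<dots> = exact_run \<kappa>"
    unfolding exact_run_def by (rule lfp_unfold[symmetric]) (rule monoI, rule Op_mono, auto)
  finally show "Op (run_pos U K base pt t s exact_run \<kappa>) (run_neg U K base pt t s exact_run \<kappa>)
      (exact_run \<kappa>) \<subseteq> exact_run \<kappa>" .
qed

lemma less_sound: "LT Y x y \<Longrightarrow> x \<in> U \<Longrightarrow> y \<in> U \<Longrightarrow> less x y"
  by (rule less_sound_exact) (unfold run_less_def, meson Y_sub_exact t_mono s_mono)

lemma le_sound: "LE Y x y \<Longrightarrow> x \<in> U \<Longrightarrow> y \<in> U \<Longrightarrow> le x y"
  by (rule le_sound_exact) (unfold run_le_def run_less_def, meson Y_sub_exact t_mono s_mono pt)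

text \<open>The converse inclusion, for a key whose inputs have become complete: its run is then
  closed under the operator that defines the exact run.\<close>

lemma Y_exact:
  assumes \<kappa>: "\<kappa> \<in> K" and "\<And>z. z \<in> seg \<kappa> \<Longrightarrow> LE Y z (pt \<kappa>)"
    and "\<And>z. z \<in> U - seg \<kappa> \<Longrightarrow> \<not> base \<kappa> \<Longrightarrow> LT Y (pt \<kappa>) z"
  shows "Y \<kappa> = exact_run \<kappa>"
proof
  have "seg \<kappa> \<subseteq> run_pos U K base pt t s Y \<kappa>" "U - seg \<kappa> \<subseteq> run_neg U K base pt t s Y \<kappa>"
    using assms(2,3) by (auto simp: run_pos_def run_neg_def seg_def split: if_splits)
  then have "Op (seg \<kappa>) (U - seg \<kappa>) (Y \<kappa>) \<subseteq> Y \<kappa>"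
    by (subst (2) Y_fix[OF \<kappa>]) (intro Op_mono order_refl)
  then show "exact_run \<kappa> \<subseteq> Y \<kappa>" unfolding exact_run_def by (rule lfp_lowerbound)
qed (rule Y_sub_exact[OF \<kappa>])

lemma Y_base: "\<kappa> \<in> K \<Longrightarrow> base \<kappa> \<Longrightarrow> Y \<kappa> = exact_run \<kappa>"
  by (rule Y_exact) (auto simp: seg_def)

lemma seg_first:
  "\<not> base \<kappa> \<Longrightarrow> pt \<kappa> \<in> J k \<Longrightarrow> (\<And>j. j < k \<Longrightarrow> pt \<kappa> \<notin> J j) \<Longrightarrow> seg \<kappa> = J k"
  by (simp add: seg_def le_first)

text \<open>All facts that this run has to be told have an element of \<open>J k\<close> on the
  left: \<open>z \<le> pt \<kappa>\<close> for \<open>z\<close> inside the stage, and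
  \<open>pt \<kappa> < z\<close> for \<open>z\<close> outside. This is why \<open>IH\<close> bounds
  the stage of \<open>x\<close> and lets \<open>y\<close> be arbitrary.\<close>

lemma Y_first:
  assumes \<kappa>: "\<kappa> \<in> K" "\<not> base \<kappa>" "pt \<kappa> \<in> J k" "\<And>j. j < k \<Longrightarrow> pt \<kappa> \<notin> J j"
    and IH: "\<And>x y. x \<in> J k \<Longrightarrow> y \<in> U \<Longrightarrow> (le x y \<longrightarrow> LE Y x y) \<and> (less x y \<longrightarrow> LT Y x y)"
  shows "Y \<kappa> = exact_run \<kappa>"
proof (rule Y_exact[OF \<kappa>(1)])
  have seg: "seg \<kappa> = J k" using \<kappa> by (rule_tac seg_first)
  show "LE Y z (pt \<kappa>)" if "z \<in> seg \<kappa>" for z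
    using that IH[of z "pt \<kappa>"] seg pt[OF \<kappa>(1)] \<kappa>(2) by (auto simp: seg_def)
  show "LT Y (pt \<kappa>) z" if "z \<in> U - seg \<kappa>" for z
    using that IH[of "pt \<kappa>" z] seg \<kappa>(3) by (auto simp: less_def)
qed

text \<open>Induction on a stage containing \<open>x\<close>, for all \<open>y\<close> at once. What
  is new in \<open>J (Suc k)\<close> is found by the run named after a newest element of
  \<open>J k\<close>, and that run is exact by the induction hypothesis.\<close>

lemma complete:
  "x \<in> J k \<Longrightarrow> y \<in> U \<Longrightarrow> (le x y \<longrightarrow> LE Y x y) \<and> (less x y \<longrightarrow> LT Y x y)"
proof (induction k arbitrary: x y)
  case 0
  obtain \<kappa> where \<kappa>: "\<kappa> \<in> K" "base \<kappa>" using base by blast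
  have ex: "t (Y \<kappa>) z \<longleftrightarrow> z \<in> J 0" "s (Y \<kappa>) z \<longleftrightarrow> z \<notin> J 0" if "z \<in> U" for z
    using that \<kappa> by (auto simp: Y_base exact_run_t exact_run_s seg_def J_0)
  have "x \<in> U" using 0 J_sub by blast
  moreover have "y \<notin> J 0" if "less x y" using that J_le[of 0] by (auto simp: less_def)
  ultimately show ?case
    using 0 \<kappa> ex unfolding run_le_def run_less_def by blast
next
  case (Suc k)
  show ?case
  proof (cases "x \<in> J k")
    case True
    then show ?thesis using Suc by blast
  next
    case False
    then obtain u where u: "u \<in> J k" "\<And>j. j < k \<Longrightarrow> u \<notin> J j"
      using new_at_stage[OF Suc.prems(1)] by metis
    then obtain \<kappa> where \<kappa>: "\<kappa> \<in> K" "\<not> base \<kappa>" "pt \<kappa> = u" using nonbase J_sub by blast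
    have "seg \<kappa> = J k" using u \<kappa> seg_first by metis
    moreover have "Y \<kappa> = exact_run \<kappa>"
      by (rule Y_first[of \<kappa> k]) (use u \<kappa> Suc.IH in auto)
    ultimately have ex: "t (Y \<kappa>) z \<longleftrightarrow> z \<in> J (Suc k)" "s (Y \<kappa>) z \<longleftrightarrow> z \<notin> J (Suc k)" if "z \<in> U" for z
      using that by (auto simp: exact_run_t exact_run_s stage_Suc[OF mono_\<Gamma>])
    have x: "x \<in> U" using Suc.prems J_sub by blast
    have "LE Y x y" if "le x y"
    proof -
      have "y \<notin> J k" using that False by (auto simp: le_def)
      then have "LT Y u y" using u Suc.IH[of u y] Suc.prems(2) by (auto simp: less_def)
      then show ?thesis unfolding run_le_def using ex(1)[OF x] Suc.prems(1) \<kappa> by blast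
    qed
    moreover have "LT Y x y" if "less x y"
    proof -
      from that obtain j where j: "x \<in> J j" "y \<notin> J j" by (auto simp: less_def)
      then have "\<not> j \<le> k" using False J_le by blast
      then have "y \<notin> J (Suc k)" using j J_le[of "Suc k" j] by auto
      then show ?thesis unfolding run_less_def using ex(1)[OF x] ex(2)[OF Suc.prems(2)] Suc.prems(1) \<kappa> by blast
    qed
    ultimately show ?thesis by blast
  qed
qed

lemma run_le_iff: "x \<in> U \<Longrightarrow> LE Y x x \<longleftrightarrow> x \<in> lfp \<Gamma>"
proof
  assume x: "x \<in> U"
  show "x \<in> lfp \<Gamma>" if "LE Y x x" using le_sound[OF that x x] by (simp add: le_def)
  show "LE Y x x" if "x \<in> lfp \<Gamma>"
  proof -
    from that obtain k where "x \<in> J k" by (auto simp: lfp_eq)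
    with that x complete[of x k x] show ?thesis by (simp add: le_def)
  qed
qed

text \<open>The danger is a stage that only looks closed. Since an answer \<open>s\<close> is never
  wrong, a stage passing the test is truly closed under \<open>\<Gamma>\<close> and includes the
  fixed point. Conversely the last stage passes, once a key for it is found.\<close>

lemma run_out_iff:
  assumes x: "x \<in> U"
  shows "run_out U K base pt t s Y x \<longleftrightarrow> x \<notin> lfp \<Gamma>"
proof
  assume "run_out U K base pt t s Y x"
  then obtain \<kappa> where \<kappa>: "\<kappa> \<in> K" "base \<kappa> \<or> LT Y (pt \<kappa>) x"
    "\<And>y. y \<in> U \<Longrightarrow> s (Y \<kappa>) y \<or> \<not> base \<kappa> \<and> LE Y y (pt \<kappa>)"
    unfolding run_out_def by blast
  have "y \<in> seg \<kappa>" if "y \<in> \<Gamma> (seg \<kappa>)" for y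
  proof -
    have y: "y \<in> U" using that \<Gamma>_sub by blast
    have "\<not> s (Y \<kappa>) y"
      using that y exact_run_s s_mono Y_sub_exact[OF \<kappa>(1)] by blast
    then show ?thesis using \<kappa>(3)[OF y] le_sound y pt[OF \<kappa>(1)] by (auto simp: seg_def)
  qed
  then have "lfp \<Gamma> \<subseteq> seg \<kappa>" by (intro lfp_lowerbound) auto
  moreover have "x \<notin> seg \<kappa>"
    using \<kappa>(2) less_sound[OF _ pt[OF \<kappa>(1)] x] less_not_le by (auto simp: seg_def)
  ultimately show "x \<notin> lfp \<Gamma>" by blast
next
  assume x': "x \<notin> lfp \<Gamma>"
  show "run_out U K base pt t s Y x"
  \<comment> \<open>If the first stage is empty, then so is the fixed point, and it has no element
    to name it; a base key takes over.\<close>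
  proof (cases "J 0 = {}")
    case True
    obtain \<kappa> where \<kappa>: "\<kappa> \<in> K" "base \<kappa>" using base by blast
    with True have "s (Y \<kappa>) y" if "y \<in> U" for y
      using that by (simp add: Y_base exact_run_s seg_def J_0)
    with \<kappa> show ?thesis unfolding run_out_def by blast
  next
    case False
    \<comment> \<open>Minimality of the index guarantees an element that is new in the last stage
      and can name it.\<close>
    define k where "k = (LEAST k. lfp \<Gamma> = J k)"
    obtain k0 where "lfp \<Gamma> = J k0" by (rule lfp_is_stage)
    then have k: "lfp \<Gamma> = J k" unfolding k_def by (rule LeastI)
    have "\<exists>u \<in> J k. \<forall>j<k. u \<notin> J j"
    proof (cases k)
      case 0
      then show ?thesis using False by auto
    next
      case (Suc k')
      then have "lfp \<Gamma> \<noteq> J k'" unfolding k_def by (intro not_less_Least) simp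
      then obtain u where "u \<in> J k" "u \<notin> J k'" using k by (auto simp: lfp_eq)
      moreover have "u \<notin> J j" if "j < k" for j
        using that Suc J_le[of j k'] \<open>u \<notin> J k'\<close> by auto
      ultimately show ?thesis by blast
    qed
    then obtain u where u: "u \<in> J k" "\<And>j. j < k \<Longrightarrow> u \<notin> J j" by blast
    then obtain \<kappa> where \<kappa>: "\<kappa> \<in> K" "\<not> base \<kappa>" "pt \<kappa> = u" using nonbase J_sub by blast
    have "seg \<kappa> = J k" using u \<kappa> seg_first by metis
    moreover have "Y \<kappa> = exact_run \<kappa>"
      by (rule Y_first[of \<kappa> k]) (use u \<kappa> complete in auto)
    ultimately have seg: "seg \<kappa> = J k" "Y \<kappa> = exact_run \<kappa>" .
    have "LT Y u x" using u(1) x x' k complete[of u k x] by (auto simp: less_def)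
    moreover have "s (Y \<kappa>) y \<or> LE Y y u" if y: "y \<in> U" for y
    proof (cases "y \<in> J k")
      case True
      then have "le y u" using seg(1) \<kappa> by (auto simp: seg_def)
      then show ?thesis using True complete[of y k u] u(1) J_sub by blast
    next
      case False
      have "J k = \<Gamma> (J k)" using k lfp_unfold[OF mono_\<Gamma>] by simp
      with False show ?thesis using y seg by (simp add: exact_run_s)
    qed
    ultimately show ?thesis unfolding run_out_def using \<kappa> by blast
  qed
qed

end

section \<open>Systems deciding a formula and its negation\<close>

text \<open>Index 0 is kept for the variable of the fixed point. A free variable with index
  \<open>i\<close> is split into index \<open>2 * i + 1\<close> for itself and, in
  \<open>neg_in\<close>, index \<open>2 * i + 2\<close> for its complement.\<close>

definition pos_in :: "(rvar \<Rightarrow> 'a list set) \<Rightarrow> rvar \<Rightarrow> 'a list set" where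
  "pos_in R S = R (Suc (2 * fst S), snd S)"

definition neg_in :: "(rvar \<Rightarrow> 'a list set) \<Rightarrow> rvar \<Rightarrow> 'a list set" where
  "neg_in R S = R (Suc (Suc (2 * fst S)), snd S)"

definition join_in :: "(rvar \<Rightarrow> 'a list set) \<Rightarrow> (rvar \<Rightarrow> 'a list set) \<Rightarrow> 'a list set \<Rightarrow> rvar \<Rightarrow> 'a list set" where
  "join_in P Q X S = (if fst S = 0 then X else if odd (fst S) then P (fst S div 2, snd S)
     else Q (fst S div 2 - 1, snd S))"

lemma join_in_simps [simp]:
  "pos_in (join_in P Q X) = P" "neg_in (join_in P Q X) = Q" "join_in P Q X (0, N) = X"
  by (simp_all add: fun_eq_iff pos_in_def neg_in_def join_in_def)

type_synonym ('a, 'f, 'r) system =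
  "('a, 'f, 'r) fo_struct \<Rightarrow> (rvar \<Rightarrow> 'a list set) \<Rightarrow> (rvar \<Rightarrow> 'a list set) \<Rightarrow> 'a list set \<Rightarrow> 'a list \<Rightarrow> bool"

definition system_query :: "('f, 'r) language \<Rightarrow> nat \<Rightarrow> ('a, 'f, 'r) system \<Rightarrow> bool" where
  "system_query L N \<Phi> \<longleftrightarrow> fo_query L UNIV N (\<lambda>M R w. \<Phi> M (pos_in R) (neg_in R) (R (0, N)) w)"

text \<open>An output sees the structure and the fixed point of the system only. All information
  about free relation variables has to pass through the system.\<close>

definition output_query ::
    "('f, 'r) language \<Rightarrow> nat \<Rightarrow> nat \<Rightarrow> (('a, 'f, 'r) fo_struct \<Rightarrow> 'a list set \<Rightarrow> 'a list \<Rightarrow> bool) \<Rightarrow> bool" where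
  "output_query L N m \<tau> \<longleftrightarrow> fo_query L UNIV m (\<lambda>M R as. \<tau> M (R (0, N)) as)"

definition rpos :: "('a, 'f, 'r) fo_struct \<Rightarrow> (rvar \<Rightarrow> 'a list set) \<Rightarrow> rvar \<Rightarrow> 'a list set" where
  "rpos M R S = tuples (univ M) (arity S) \<inter> R S"

definition rneg :: "('a, 'f, 'r) fo_struct \<Rightarrow> (rvar \<Rightarrow> 'a list set) \<Rightarrow> rvar \<Rightarrow> 'a list set" where
  "rneg M R S = tuples (univ M) (arity S) - R S"

definition system_op where
  "system_op N \<Phi> M P Q X = {w \<in> tuples (univ M) N. \<Phi> M P Q X w}"

text \<open>The least fixed point of the system \<open>\<Phi>\<close>, which reads every free relation variable only
  through a copy of it and a copy of its complement, decides \<open>\<phi>\<close>: the outputs \<open>\<tau>\<close> and \<open>\<sigma>\<close> are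
  both positive in it.  Unions of systems are tagged by (in)equality of two elements, hence the
  cardinality bound.\<close>

definition decides where
  "decides L m \<phi> N \<Phi> \<tau> \<sigma> \<longleftrightarrow>
     system_query L N \<Phi> \<and> output_query L N m \<tau> \<and> output_query L N m \<sigma> \<and>
     (\<forall>M R as. finite_structure L M \<longrightarrow> 2 \<le> card (univ M) \<longrightarrow> as \<in> tuples (univ M) m \<longrightarrow>
        (\<tau> M (lfp (system_op N \<Phi> M (rpos M R) (rneg M R))) as \<longleftrightarrow> sat M R ((!) as) \<phi>) \<and>
        (\<sigma> M (lfp (system_op N \<Phi> M (rpos M R) (rneg M R))) as \<longleftrightarrow> \<not> sat M R ((!) as) \<phi>))"

lemma system_mono:
  assumes "system_query L N \<Phi>" "is_structure L M"
    and "\<And>S. P S \<subseteq> P' S" "\<And>S. Q S \<subseteq> Q' S" "X \<subseteq> X'" "w \<in> tuples (univ M) N" "\<Phi> M P Q X w"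
  shows "\<Phi> M P' Q' X' w"
proof -
  have "join_in P Q X S \<subseteq> join_in P' Q' X' S" for S
    using assms(3-5) by (auto simp: join_in_def)
  with fo_query_mono[OF assms(1)[unfolded system_query_def] assms(2,6), of "join_in P Q X" "join_in P' Q' X'"]
    assms(7) show ?thesis by simp
qed

lemma system_op_mono:
  assumes "system_query L N \<Phi>" "is_structure L M"
    and "\<And>S. P S \<subseteq> P' S" "\<And>S. Q S \<subseteq> Q' S" "X \<subseteq> X'"
  shows "system_op N \<Phi> M P Q X \<subseteq> system_op N \<Phi> M P' Q' X'"
proof
  fix w assume w: "w \<in> system_op N \<Phi> M P Q X"
  then have "w \<in> tuples (univ M) N" "\<Phi> M P Q X w" by (simp_all add: system_op_def)
  with system_mono[OF assms this] show "w \<in> system_op N \<Phi> M P' Q' X'"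
    by (simp add: system_op_def)
qed

lemma mono_system_op: "system_query L N \<Phi> \<Longrightarrow> is_structure L M \<Longrightarrow> mono (system_op N \<Phi> M P Q)"
  by (rule monoI) (rule system_op_mono, auto)

lemma output_mono:
  assumes "output_query L N m \<tau>" "is_structure L M" "X \<subseteq> X'" "as \<in> tuples (univ M) m" "\<tau> M X as"
  shows "\<tau> M X' as"
  using fo_query_mono[OF assms(1)[unfolded output_query_def] assms(2,4), of "\<lambda>_. X" "\<lambda>_. X'"] assms(3,5)
  by simp

lemma block_query_output:
  assumes \<tau>: "output_query L N m \<tau>" and f: "selector \<alpha> m f"
    and G: "block_query L D (\<alpha> @ [N]) (\<lambda>M R e. G M R e (e (length \<alpha>)))"
    and fresh: "\<And>M R e x b. G M R (e(length \<alpha> := x)) b = G M R e b"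
  shows "block_query L D \<alpha> (\<lambda>M R e. \<tau> M {b \<in> tuples (univ M) N. G M R e b} (f e))"
proof -
  let ?G = "\<lambda>S. if S = (0, N) then \<lambda>M R e. G M R e (e (length \<alpha>)) else (\<lambda>M R e. False)"
  have "block_query L D (\<alpha> @ [arity S]) (?G S)" for S
    using G by (simp add: block_query_const)
  from block_query_sub[OF \<tau>[unfolded output_query_def] f this] show ?thesis
    by (rule block_query_cong) (simp add: fresh)
qed

lemma block_query_system:
  assumes \<Phi>: "system_query L N \<Phi>" and f: "selector \<alpha> N f"
    and G: "block_query L D (\<alpha> @ [N]) (\<lambda>M R e. G M R e (e (length \<alpha>)))"
    and fresh: "\<And>M R e x b. G M R (e(length \<alpha> := x)) b = G M R e b"
    and GP: "\<And>S. block_query L D (\<alpha> @ [arity S]) (\<lambda>M R e. GP S M R e (e (length \<alpha>)))"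
    and freshP: "\<And>S M R e x b. GP S M R (e(length \<alpha> := x)) b = GP S M R e b"
    and GQ: "\<And>S. block_query L D (\<alpha> @ [arity S]) (\<lambda>M R e. GQ S M R e (e (length \<alpha>)))"
    and freshQ: "\<And>S M R e x b. GQ S M R (e(length \<alpha> := x)) b = GQ S M R e b"
  shows "block_query L D \<alpha> (\<lambda>M R e. \<Phi> M (\<lambda>S. {b \<in> tuples (univ M) (arity S). GP S M R e b})
    (\<lambda>S. {b \<in> tuples (univ M) (arity S). GQ S M R e b}) {b \<in> tuples (univ M) N. G M R e b} (f e))"
proof -
  let ?G = "\<lambda>S M R e. if fst S = 0 then snd S = N \<and> G M R e (e (length \<alpha>))
    else if odd (fst S) then GP (fst S div 2, snd S) M R e (e (length \<alpha>))
    else GQ (fst S div 2 - 1, snd S) M R e (e (length \<alpha>))"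
  have "block_query L D (\<alpha> @ [arity S]) (?G S)" for S
  proof (cases "fst S = 0")
    case True
    then show ?thesis using G by (cases "snd S = N") (simp_all add: block_query_const)
  next
    case False
    then show ?thesis using GP[of "(fst S div 2, snd S)"] GQ[of "(fst S div 2 - 1, snd S)"]
      by (cases "odd (fst S)") simp_all
  qed
  from block_query_sub[OF \<Phi>[unfolded system_query_def] f this] show ?thesis
    by (rule block_query_cong) (simp add: fresh freshP freshQ pos_in_def[abs_def] neg_in_def[abs_def])
qed

section \<open>Deciding atoms, negations and quantifiers\<close>

text \<open>Without relation variables nothing has to be iterated: the system is empty, and the
  formula and its negation are themselves the outputs.\<close>

lemma decides_formula:
  fixes \<psi> :: "('f, 'r) fm"
  assumes "wf_fm L \<psi>" "first_order \<psi>" "frv \<psi> = {}" "fv \<psi> \<subseteq> {..<m}"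
  shows "decides L m \<psi> 0 (\<lambda>M P Q X w. False)
    (\<lambda>(M :: ('a, 'f, 'r) fo_struct) X as. sat M (\<lambda>_. {}) ((!) as) \<psi>)
    (\<lambda>M X as. \<not> sat M (\<lambda>_. {}) ((!) as) \<psi>)"
  unfolding decides_def
proof (intro conjI allI impI)
  have *: "sat M R v \<psi> \<longleftrightarrow> sat M (\<lambda>_. {}) v \<psi>" for M :: "('a, 'f, 'r) fo_struct" and R v
    by (rule sat_cong) (use assms in auto)
  have f1: "fo_query L UNIV m (\<lambda>(M :: ('a, 'f, 'r) fo_struct) R as. sat M R ((!) as) \<psi>)"
    and f2: "fo_query L UNIV m (\<lambda>(M :: ('a, 'f, 'r) fo_struct) R as. sat M R ((!) as) (Neg \<psi>))"
    by (rule fo_query_formula; use assms in \<open>simp add: occurs_parity_notin\<close>)+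
  show "system_query L 0 (\<lambda>M P Q X w. False)"
    by (simp add: system_query_def fo_query_const)
  show "output_query L 0 m (\<lambda>(M :: ('a, 'f, 'r) fo_struct) X as. sat M (\<lambda>_. {}) ((!) as) \<psi>)"
    unfolding output_query_def
    using f1 by (rule fo_query_cong) (rule *)
  show "output_query L 0 m (\<lambda>(M :: ('a, 'f, 'r) fo_struct) X as. \<not> sat M (\<lambda>_. {}) ((!) as) \<psi>)"
    unfolding output_query_def
    using f2 by (rule fo_query_cong) (unfold sat.simps, rule arg_cong[where f = Not], rule *)
  show "sat M (\<lambda>_. {}) ((!) as) \<psi> = sat M R ((!) as) \<psi>"
    "(\<not> sat M (\<lambda>_. {}) ((!) as) \<psi>) = (\<not> sat M R ((!) as) \<psi>)" for M :: "('a, 'f, 'r) fo_struct" and R as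
    using * by blast+
qed

lemma decides_Neg: "decides L m \<phi> N \<Phi> \<tau> \<sigma> \<Longrightarrow> decides L m (Neg \<phi>) N \<Phi> \<sigma> \<tau>"
  unfolding decides_def by simp

lemma sat_update:
  assumes "fv \<phi> \<subseteq> {..<m}"
  shows "sat M R ((!) (map v [0..<m])) \<phi> \<longleftrightarrow> sat M R v \<phi>"
  by (rule sat_cong) (use assms in auto)

abbreviation upd :: "nat \<Rightarrow> nat list \<Rightarrow> 'a list \<Rightarrow> 'a list \<Rightarrow> 'a list" where
  "upd m xs p b \<equiv> map (assign ((!) p) xs b) [0..<m]"

lemma upd_in_tuples: "p \<in> tuples A m \<Longrightarrow> b \<in> tuples A (length xs) \<Longrightarrow> upd m xs p b \<in> tuples A m"
  by (intro map_in_tuples assign_in) (auto simp: tuples_def subset_iff)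

lemma block_query_output':
  assumes "output_query L N m \<tau>" "selector \<alpha> m f"
  shows "block_query L UNIV \<alpha> (\<lambda>M R e. \<tau> M (R (0, N)) (f e))"
  using block_query_app[OF assms(1)[unfolded output_query_def] assms(2)] .

lemma output_queryI:
  assumes "block_query L UNIV [m] (\<lambda>M R e. \<tau> M (R (0, N)) (e 0))"
  shows "output_query L N m \<tau>"
proof -
  from assms have "fo_query L UNIV m (\<lambda>M R as. \<tau> M (R (0, N)) (take m as))"
    by (simp add: block_query_def)
  then show ?thesis unfolding output_query_def
    by (rule fo_query_cong) (simp add: tuples_length)
qed

text \<open>One fixed point answers for all assignments, so the system stays as it is and only the
  outputs quantify over coordinate \<open>i\<close>. A no to the quantifier is a no for every
  witness, which is again a positive statement.\<close>

lemma decides_Exi: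
  fixes \<Phi> :: "('a, 'f, 'r) system"
  assumes IH: "decides L m \<phi> N \<Phi> \<tau> \<sigma>" and vars: "fv \<phi> \<subseteq> {..<m}"
  shows "decides L m (Exi i \<phi>) N \<Phi>
    (\<lambda>M X as. \<exists>b \<in> tuples (univ M) 1. \<tau> M X (upd m [i] as b))
    (\<lambda>M X as. \<forall>b \<in> tuples (univ M) 1. \<sigma> M X (upd m [i] as b))"
  unfolding decides_def
proof (intro conjI allI impI)
  from IH have q: "system_query L N \<Phi>" "output_query L N m \<tau>" "output_query L N m \<sigma>"
    by (simp_all add: decides_def)
  show "system_query L N \<Phi>" by fact
  have sel: "selector [m, 1] m (\<lambda>e. upd m [i] (e 0) (e 1))"
    by (rule selector_assign) auto
  show "output_query L N m (\<lambda>M X as. \<exists>b \<in> tuples (univ M) 1. \<tau> M X (upd m [i] as b))"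
    by (rule output_queryI, rule block_query_ex) (use block_query_output'[OF q(2) sel] in simp_all)
  show "output_query L N m (\<lambda>M X as. \<forall>b \<in> tuples (univ M) 1. \<sigma> M X (upd m [i] as b))"
    by (rule output_queryI, rule block_query_all) (use block_query_output'[OF q(3) sel] in simp_all)
  fix M :: "('a, 'f, 'r) fo_struct" and R as
  assume M: "finite_structure L M" "2 \<le> card (univ M)" and as: "as \<in> tuples (univ M) m"
  let ?X = "lfp (system_op N \<Phi> M (rpos M R) (rneg M R))"
  have 1: "(\<tau> M ?X (upd m [i] as b) \<longleftrightarrow> sat M R (assign ((!) as) [i] b) \<phi>) \<and>
      (\<sigma> M ?X (upd m [i] as b) \<longleftrightarrow> \<not> sat M R (assign ((!) as) [i] b) \<phi>)"
    if "b \<in> tuples (univ M) 1" for b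
    using IH M upd_in_tuples[OF as, of b "[i]"] that unfolding decides_def
    by (simp add: sat_update[OF vars])
  have 2: "(\<exists>b \<in> tuples (univ M) 1. sat M R (assign ((!) as) [i] b) \<phi>) \<longleftrightarrow> sat M R ((!) as) (Exi i \<phi>)"
    using sat_Exs[of "[i]" M R "(!) as" \<phi>] by (simp add: Exs_def)
  show "(\<exists>b \<in> tuples (univ M) 1. \<tau> M ?X (upd m [i] as b)) \<longleftrightarrow> sat M R ((!) as) (Exi i \<phi>)"
    unfolding 2[symmetric] using 1 by blast
  show "(\<forall>b \<in> tuples (univ M) 1. \<sigma> M ?X (upd m [i] as b)) \<longleftrightarrow> \<not> sat M R ((!) as) (Exi i \<phi>)"
    unfolding 2[symmetric] using 1 by blast
qed


lemma two_elements:
  assumes "2 \<le> card A"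
  obtains c d where "c \<in> A" "d \<in> A" "c \<noteq> d"
  using assms by (metis card_le_Suc0_iff_eq card.infinite not_less_eq_eq numeral_2_eq_2 zero_le)

lemma tags:
  assumes "2 \<le> card A"
  obtains q q' where "q \<in> tuples A 2" "q ! 0 = q ! 1" "q' \<in> tuples A 2" "q' ! 0 \<noteq> q' ! 1"
proof -
  obtain c d where "c \<in> A" "d \<in> A" "c \<noteq> d" using two_elements[OF assms] .
  then show ?thesis using that[of "[c, c]" "[c, d]"] by (simp add: tuples_def)
qed

text \<open>As outputs cannot read \<open>S\<close>, the system copies \<open>S\<close> and its
  complement into the fixed point, tagged by equal and by unequal pairs. The bound \<open>m\<close>
  on the variables of \<open>ts\<close> leaves \<open>m\<close> and \<open>Suc m\<close> free for
  the tag.\<close>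

lemma decides_RVar:
  assumes S: "length ts = arity S" "\<And>t. t \<in> set ts \<Longrightarrow> wf_tm L t" "\<And>t. t \<in> set ts \<Longrightarrow> tvars t \<subseteq> {..<m}"
  shows "decides L m (RVar S ts) (2 + arity S)
    (\<lambda>(M :: ('a, 'f, 'r) fo_struct) P Q X w. w ! 0 = w ! 1 \<and> drop 2 w \<in> P S \<or> w ! 0 \<noteq> w ! 1 \<and> drop 2 w \<in> Q S)
    (\<lambda>M X as. \<exists>c \<in> univ M. c # c # map (tval M ((!) as)) ts \<in> X)
    (\<lambda>M X as. \<exists>c \<in> univ M. \<exists>d \<in> univ M. c \<noteq> d \<and> c # d # map (tval M ((!) as)) ts \<in> X)"
    (is "decides L m _ ?N ?\<Phi> ?\<tau> ?\<sigma>")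
  unfolding decides_def
proof (intro conjI allI impI)
  show "system_query L ?N ?\<Phi>"
    unfolding system_query_def pos_in_def neg_in_def
    using fo_query_atom[of "(Suc (2 * fst S), snd S)" UNIV L 2]
      fo_query_atom[of "(Suc (Suc (2 * fst S)), snd S)" UNIV L 2]
    by (intro fo_query_or fo_query_and fo_query_eq fo_query_neq) auto
  have ts: "map (tval M (v(m := c))) ts = map (tval M v) ts"
    "map (tval M (v(m := c, Suc m := d))) ts = map (tval M v) ts" for M :: "('a, 'f, 'r) fo_struct" and v c d
  proof -
    have "m \<notin> tvars t" "Suc m \<notin> tvars t" if "t \<in> set ts" for t
      using S(3)[OF that] by auto
    then show "map (tval M (v(m := c))) ts = map (tval M v) ts"
      "map (tval M (v(m := c, Suc m := d))) ts = map (tval M v) ts"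
      by (auto intro!: tval_cong)
  qed
  have "fo_query L UNIV m (\<lambda>(M :: ('a, 'f, 'r) fo_struct) R as. sat M R ((!) as) (Exi m (RVar (0, ?N) (Var m # Var m # ts))))"
    by (rule fo_query_formula) (use S in auto)
  then show "output_query L ?N m ?\<tau>"
    unfolding output_query_def by (rule fo_query_cong) (simp add: ts del: map_eq_conv)
  have "fo_query L UNIV m (\<lambda>(M :: ('a, 'f, 'r) fo_struct) R as. sat M R ((!) as)
      (Exi m (Exi (Suc m) (Conj (Neg (Eq (Var m) (Var (Suc m)))) (RVar (0, ?N) (Var m # Var (Suc m) # ts))))))"
    by (rule fo_query_formula) (use S in fastforce)+
  then show "output_query L ?N m ?\<sigma>"
    unfolding output_query_def by (rule fo_query_cong) (simp add: ts del: map_eq_conv)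
  fix M :: "('a, 'f, 'r) fo_struct" and R as
  assume M: "finite_structure L M" "2 \<le> card (univ M)" and as: "as \<in> tuples (univ M) m"
  from M have str: "is_structure L M" by (simp add: finite_structure_def)
  obtain c d where cd: "c \<in> univ M" "d \<in> univ M" "c \<noteq> d"
    using two_elements[OF M(2)] .
  let ?X = "lfp (system_op ?N ?\<Phi> M (rpos M R) (rneg M R))"
  let ?b = "map (tval M ((!) as)) ts"
  have b: "?b \<in> tuples (univ M) (arity S)"
    using S as by (auto intro!: tval_in_univ[OF str] simp: tuples_def subset_iff)
  \<comment> \<open>The system never consults its own fixed point, so the operator is
    constant.\<close>
  have X: "?X = {w \<in> tuples (univ M) ?N. ?\<Phi> M (rpos M R) (rneg M R) {} w}"
    unfolding system_op_def by (rule lfp_const)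
  have in_X: "c # d # ?b \<in> ?X \<longleftrightarrow> c = d \<and> ?b \<in> R S \<or> c \<noteq> d \<and> ?b \<notin> R S"
    if "c \<in> univ M" "d \<in> univ M" for c d
    unfolding X using that b by (auto simp: rpos_def rneg_def tuples_def)
  show "?\<tau> M ?X as \<longleftrightarrow> sat M R ((!) as) (RVar S ts)"
    using in_X cd by auto
  show "?\<sigma> M ?X as \<longleftrightarrow> \<not> sat M R ((!) as) (RVar S ts)"
    using in_X cd by auto
qed

section \<open>Tagged unions of systems, and conjunction\<close>

text \<open>Two sets are coded in one: a pair of equal elements marks an entry of the first, a pair
  of unequal ones an entry of the second. The part not selected by the tag is padding and is
  quantified away.\<close>

definition dec1 :: "'a set \<Rightarrow> nat \<Rightarrow> nat \<Rightarrow> 'a list set \<Rightarrow> 'a list set" where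
  "dec1 A k l X = {b \<in> tuples A k. \<exists>q \<in> tuples A 2. \<exists>c \<in> tuples A l. q ! 0 = q ! 1 \<and> q @ b @ c \<in> X}"

definition dec2 :: "'a set \<Rightarrow> nat \<Rightarrow> nat \<Rightarrow> 'a list set \<Rightarrow> 'a list set" where
  "dec2 A k l X = {c \<in> tuples A l. \<exists>q \<in> tuples A 2. \<exists>b \<in> tuples A k. q ! 0 \<noteq> q ! 1 \<and> q @ b @ c \<in> X}"

lemma tuples_nonempty: "A \<noteq> {} \<Longrightarrow> tuples A n \<noteq> {}"
proof -
  assume "A \<noteq> {}"
  then obtain a where "a \<in> A" by blast
  then have "replicate n a \<in> tuples A n" by (auto simp: tuples_def)
  then show ?thesis by blast
qed

text \<open>The second component may depend on the first but not conversely, so the joint fixed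
  point splits into two layers. For conjunctions the layers are independent; the rank induction for
  chains has a second layer that reads the first.\<close>

lemma tagged_lfp:
  assumes A: "2 \<le> card A" and F: "mono F" "\<And>X. F X \<subseteq> tuples A (2 + (k + l))"
    and F_iff: "\<And>X q b c. q \<in> tuples A 2 \<Longrightarrow> b \<in> tuples A k \<Longrightarrow> c \<in> tuples A l \<Longrightarrow>
      q @ b @ c \<in> F X \<longleftrightarrow> q ! 0 = q ! 1 \<and> b \<in> F1 (dec1 A k l X) \<or>
        q ! 0 \<noteq> q ! 1 \<and> c \<in> F2 (dec1 A k l X) (dec2 A k l X)"
    and F1: "mono F1" "\<And>X. F1 X \<subseteq> tuples A k"
    and F2: "\<And>X. mono (F2 X)" "\<And>X X' Y. X \<subseteq> X' \<Longrightarrow> F2 X Y \<subseteq> F2 X' Y" "\<And>X Y. F2 X Y \<subseteq> tuples A l"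
  shows "dec1 A k l (lfp F) = lfp F1" and "dec2 A k l (lfp F) = lfp (F2 (lfp F1))"
    and "dec2 A k l (F X) = F2 (dec1 A k l X) (dec2 A k l X)"
proof -
  obtain q q' where q: "q \<in> tuples A 2" "q ! 0 = q ! 1" "q' \<in> tuples A 2" "q' ! 0 \<noteq> q' ! 1"
    using tags[OF A] .
  have "A \<noteq> {}" using A by auto
  then obtain b0 c0 where bc: "b0 \<in> tuples A k" "c0 \<in> tuples A l"
    using tuples_nonempty by (metis ex_in_conv)
  let ?d1 = "dec1 A k l" and ?d2 = "dec2 A k l"
  have d1: "?d1 (F X) = F1 (?d1 X)" for X
  proof -
    have "b \<in> ?d1 (F X) \<longleftrightarrow> b \<in> F1 (?d1 X)" if b: "b \<in> tuples A k" for b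
      unfolding dec1_def[of A k l "F X"] using q(1,2) bc(2) b by (auto simp: F_iff)
    moreover have "?d1 (F X) \<subseteq> tuples A k" by (auto simp: dec1_def)
    ultimately show ?thesis using F1(2)[of "?d1 X"] by blast
  qed
  have d2: "?d2 (F X) = F2 (?d1 X) (?d2 X)" for X
  proof -
    have "c \<in> ?d2 (F X) \<longleftrightarrow> c \<in> F2 (?d1 X) (?d2 X)" if c: "c \<in> tuples A l" for c
      unfolding dec2_def[of A k l "F X"] using q(3,4) bc(1) c by (auto simp: F_iff)
    moreover have "?d2 (F X) \<subseteq> tuples A l" by (auto simp: dec2_def)
    ultimately show ?thesis using F2(3)[of "?d1 X" "?d2 X"] by blast
  qed
  let ?X = "lfp F" and ?Y = "lfp (F2 (lfp F1))"
  have fp: "F ?X = ?X" by (rule lfp_unfold[OF F(1), symmetric])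
  have 1: "lfp F1 \<subseteq> ?d1 ?X" using d1[of ?X] unfolding fp by (intro lfp_lowerbound) simp
  \<comment> \<open>All codes whose selected component lies in the expected fixed point, with
    arbitrary padding. That \<open>Z\<close> is closed under \<open>F\<close> yields both upper
    bounds.\<close>
  define Z where "Z = {w. \<exists>q \<in> tuples A 2. \<exists>b \<in> tuples A k. \<exists>c \<in> tuples A l. w = q @ b @ c \<and>
    (q ! 0 = q ! 1 \<longrightarrow> b \<in> lfp F1) \<and> (q ! 0 \<noteq> q ! 1 \<longrightarrow> c \<in> ?Y)}"
  have Z_iff: "q @ b @ c \<in> Z \<longleftrightarrow> (q ! 0 = q ! 1 \<longrightarrow> b \<in> lfp F1) \<and> (q ! 0 \<noteq> q ! 1 \<longrightarrow> c \<in> ?Y)"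
    if "q \<in> tuples A 2" "b \<in> tuples A k" "c \<in> tuples A l" for q b c
  proof -
    have "q @ b @ c = q' @ b' @ c' \<longleftrightarrow> q = q' \<and> b = b' \<and> c = c'"
      if "q' \<in> tuples A 2" "b' \<in> tuples A k" "c' \<in> tuples A l" for q' b' c'
      using that \<open>q \<in> _\<close> \<open>b \<in> _\<close> by (auto dest!: tuples_length)
    then show ?thesis unfolding Z_def using that by blast
  qed
  have Z: "?d1 Z \<subseteq> lfp F1" "?d2 Z \<subseteq> ?Y"
    unfolding dec1_def dec2_def using Z_iff by blast+
  have "F Z \<subseteq> Z"
  proof
    fix w assume w: "w \<in> F Z"
    with F(2) have "w \<in> tuples A (2 + (k + l))" by blast
    then obtain q v where "q \<in> tuples A 2" "v \<in> tuples A (k + l)" "w = q @ v"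
      using tuples_split[of w A 2 "k + l"] by blast
    then obtain b c where qbc: "q \<in> tuples A 2" "b \<in> tuples A k" "c \<in> tuples A l" "w = q @ b @ c"
      using tuples_split[of v A k l] by blast
    have "b \<in> lfp F1" if "b \<in> F1 (?d1 Z)"
      using that monoD[OF F1(1) Z(1)] lfp_unfold[OF F1(1)] by blast
    moreover have "c \<in> ?Y" if "c \<in> F2 (?d1 Z) (?d2 Z)"
      using that monoD[OF F2(1) Z(2)] F2(2)[OF Z(1)] lfp_unfold[OF F2(1)] by blast
    ultimately show "w \<in> Z" using w F_iff[OF qbc(1-3), of Z] Z_iff[OF qbc(1-3)] unfolding qbc(4) by blast
  qed
  then have XZ: "?X \<subseteq> Z" by (rule lfp_lowerbound)
  have "?d1 ?X \<subseteq> ?d1 Z" "?d2 ?X \<subseteq> ?d2 Z" using XZ unfolding dec1_def dec2_def by blast+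
  with Z have 2: "?d1 ?X \<subseteq> lfp F1" "?d2 ?X \<subseteq> ?Y" by blast+
  show eq: "?d1 ?X = lfp F1" using 1 2 by blast
  have "?Y \<subseteq> ?d2 ?X" using d2[of ?X] unfolding fp eq by (intro lfp_lowerbound) simp
  with 2 show "?d2 ?X = ?Y" by blast
  show "?d2 (F X) = F2 (?d1 X) (?d2 X)" by (rule d2)
qed

lemma block_query_mem0:
  assumes "selector \<alpha> N f"
  shows "block_query L UNIV \<alpha> (\<lambda>M R e. f e \<in> R (0, N))"
  using block_query_mem[of "(0, N)" UNIV \<alpha> f L] assms by simp

lemma block_query_eq:
  assumes "b < length \<alpha>" "\<alpha> ! b = 2"
  shows "block_query L D \<alpha> (\<lambda>M R e. e b ! 0 = e b ! 1)"
proof -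
  have "selector \<alpha> 2 (\<lambda>e. e b)" using assms by (intro selector_block) auto
  from block_query_app[OF fo_query_eq this, of 0 1] show ?thesis by simp
qed

lemma block_query_neq:
  assumes "b < length \<alpha>" "\<alpha> ! b = 2"
  shows "block_query L D \<alpha> (\<lambda>M R e. e b ! 0 \<noteq> e b ! 1)"
proof -
  have "selector \<alpha> 2 (\<lambda>e. e b)" using assms by (intro selector_block) auto
  from block_query_app[OF fo_query_neq this, of 0 1] show ?thesis by simp
qed

lemmas block_query_intros = block_query_ex block_query_all block_query_and block_query_or
  block_query_mem0 block_query_eq block_query_neq selector_append selector_block

lemma block_query_dec1:
  assumes "b < length \<alpha>" "\<alpha> ! b = k"
  shows "block_query L UNIV \<alpha> (\<lambda>M R e. \<exists>q \<in> tuples (univ M) 2. \<exists>c \<in> tuples (univ M) l.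
    q ! 0 = q ! 1 \<and> q @ e b @ c \<in> R (0, 2 + (k + l)))"
  by (intro block_query_intros) (use assms in \<open>auto simp: nth_append\<close>)

lemma block_query_dec2:
  assumes "b < length \<alpha>" "\<alpha> ! b = l"
  shows "block_query L UNIV \<alpha> (\<lambda>M R e. \<exists>q \<in> tuples (univ M) 2. \<exists>c \<in> tuples (univ M) k.
    q ! 0 \<noteq> q ! 1 \<and> q @ c @ e b \<in> R (0, 2 + (k + l)))"
  by (intro block_query_intros) (use assms in \<open>auto simp: nth_append\<close>)

lemma block_query_pos_in:
  "selector \<alpha> (arity S) f \<Longrightarrow> block_query L UNIV \<alpha> (\<lambda>M R e. f e \<in> pos_in R S)"
  unfolding pos_in_def by (rule block_query_mem) auto

lemma block_query_neg_in:
  "selector \<alpha> (arity S) f \<Longrightarrow> block_query L UNIV \<alpha> (\<lambda>M R e. f e \<in> neg_in R S)"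
  unfolding neg_in_def by (rule block_query_mem) auto

text \<open>Substitution into queries produces sets of tuples of the right arity, so the inputs are
  cut down to this form; \<open>rpos\<close> and \<open>rneg\<close> have it already.\<close>

definition restr :: "('a, 'f, 'r) fo_struct \<Rightarrow> (rvar \<Rightarrow> 'a list set) \<Rightarrow> rvar \<Rightarrow> 'a list set" where
  "restr M P = (\<lambda>S. {b \<in> tuples (univ M) (arity S). b \<in> P S})"

lemma restr_simps [simp]: "restr M (rpos M R) = rpos M R" "restr M (rneg M R) = rneg M R"
  by (auto simp: restr_def rpos_def rneg_def)

definition conj_system :: "nat \<Rightarrow> nat \<Rightarrow> ('a, 'f, 'r) system \<Rightarrow> ('a, 'f, 'r) system \<Rightarrow> ('a, 'f, 'r) system" where
  "conj_system k l \<Phi> \<Psi> M P Q X w = (let e = blocks [2, k, l] w in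
     e 0 ! 0 = e 0 ! 1 \<and> \<Phi> M (restr M P) (restr M Q) (dec1 (univ M) k l X) (e 1) \<or>
     e 0 ! 0 \<noteq> e 0 ! 1 \<and> \<Psi> M (restr M P) (restr M Q) (dec2 (univ M) k l X) (e 2))"

lemma conj_system_query:
  assumes "system_query L k \<Phi>" "system_query L l \<Psi>"
  shows "system_query L (2 + (k + l)) (conj_system k l \<Phi> \<Psi>)"
  unfolding system_query_def conj_system_def Let_def
proof (rule block_query_fo)
  have 1: "block_query L UNIV [2, k, l]
      (\<lambda>M R e. \<Phi> M (restr M (pos_in R)) (restr M (neg_in R)) (dec1 (univ M) k l (R (0, 2 + (k + l)))) (e 1))"
    unfolding restr_def dec1_def
    by (intro block_query_system[OF assms(1)] block_query_dec1 block_query_pos_in block_query_neg_in selector_block)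
      (simp_all add: nth_append)
  have 2: "block_query L UNIV [2, k, l]
      (\<lambda>M R e. \<Psi> M (restr M (pos_in R)) (restr M (neg_in R)) (dec2 (univ M) k l (R (0, 2 + (k + l)))) (e 2))"
    unfolding restr_def dec2_def
    by (intro block_query_system[OF assms(2)] block_query_dec2 block_query_pos_in block_query_neg_in selector_block)
      (simp_all add: nth_append)
  show "block_query L UNIV [2, k, l] (\<lambda>M R e.
     e 0 ! 0 = e 0 ! 1 \<and> \<Phi> M (restr M (pos_in R)) (restr M (neg_in R)) (dec1 (univ M) k l (R (0, 2 + (k + l)))) (e 1) \<or>
     e 0 ! 0 \<noteq> e 0 ! 1 \<and> \<Psi> M (restr M (pos_in R)) (restr M (neg_in R)) (dec2 (univ M) k l (R (0, 2 + (k + l)))) (e 2))"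
    by (intro block_query_or block_query_and block_query_eq block_query_neq 1 2) auto
qed simp

lemma output_query_dec1:
  assumes "output_query L k m \<tau>"
  shows "output_query L (2 + (k + l)) m (\<lambda>M X as. \<tau> M (dec1 (univ M) k l X) as)"
  unfolding dec1_def
  by (intro output_queryI block_query_output[OF assms] block_query_dec1 selector_block)
    (simp_all add: nth_append)

lemma output_query_dec2:
  assumes "output_query L l m \<tau>"
  shows "output_query L (2 + (k + l)) m (\<lambda>M X as. \<tau> M (dec2 (univ M) k l X) as)"
  unfolding dec2_def
  by (intro output_queryI block_query_output[OF assms] block_query_dec2 selector_block)
    (simp_all add: nth_append)

lemma system_op_subset: "system_op N \<Phi> M P Q X \<subseteq> tuples (univ M) N"
  by (auto simp: system_op_def)

lemma blocks_triple:
  assumes "q \<in> tuples A 2" "b \<in> tuples A k" "c \<in> tuples A l"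
  shows "blocks [2, k, l] (q @ b @ c) 0 = q" "blocks [2, k, l] (q @ b @ c) 1 = b"
    "blocks [2, k, l] (q @ b @ c) 2 = c" "q @ b @ c \<in> tuples A (2 + (k + l))"
proof -
  have "length q = 2" "length b = k" "length c = l" using assms by (auto dest: tuples_length)
  then show "blocks [2, k, l] (q @ b @ c) 0 = q" "blocks [2, k, l] (q @ b @ c) 1 = b"
    "blocks [2, k, l] (q @ b @ c) 2 = c" "q @ b @ c \<in> tuples A (2 + (k + l))"
    using assms by (simp_all add: numeral_2_eq_2) (simp add: tuples_def)
qed

lemma conj_system_op_iff:
  assumes "q \<in> tuples (univ M) 2" "b \<in> tuples (univ M) k" "c \<in> tuples (univ M) l"
  shows "q @ b @ c \<in> system_op (2 + (k + l)) (conj_system k l \<Phi> \<Psi>) M P Q X \<longleftrightarrow>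
    q ! 0 = q ! 1 \<and> b \<in> system_op k \<Phi> M (restr M P) (restr M Q) (dec1 (univ M) k l X) \<or>
    q ! 0 \<noteq> q ! 1 \<and> c \<in> system_op l \<Psi> M (restr M P) (restr M Q) (dec2 (univ M) k l X)"
  unfolding system_op_def conj_system_def Let_def mem_Collect_eq blocks_triple(1-3)[OF assms]
  using assms blocks_triple(4)[OF assms] by blast

lemma conj_system_lfp:
  fixes \<Phi> \<Psi> :: "('a, 'f, 'r) system"
    and P Q :: "rvar \<Rightarrow> 'a list set"
  assumes \<Phi>: "system_query L k \<Phi>" "system_query L l \<Psi>" and M: "is_structure L M" "2 \<le> card (univ M)"
  defines "X \<equiv> lfp (system_op (2 + (k + l)) (conj_system k l \<Phi> \<Psi>) M P Q)"
  shows "dec1 (univ M) k l X = lfp (system_op k \<Phi> M (restr M P) (restr M Q))"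
    and "dec2 (univ M) k l X = lfp (system_op l \<Psi> M (restr M P) (restr M Q))"
proof -
  let ?F = "system_op (2 + (k + l)) (conj_system k l \<Phi> \<Psi>) M P Q"
  let ?F1 = "system_op k \<Phi> M (restr M P) (restr M Q)"
  let ?F2 = "\<lambda>_ :: 'a list set. system_op l \<Psi> M (restr M P) (restr M Q)"
  note * = mono_system_op[OF conj_system_query[OF \<Phi>] M(1), of P Q] system_op_subset conj_system_op_iff
    mono_system_op[OF \<Phi>(1) M(1)] system_op_subset mono_system_op[OF \<Phi>(2) M(1)] order_refl system_op_subset
  show "dec1 (univ M) k l X = lfp ?F1"
    unfolding X_def by (rule tagged_lfp(1)[of "univ M" ?F k l ?F1 ?F2, OF M(2)]) (rule *; assumption?)+
  show "dec2 (univ M) k l X = lfp (?F2 (lfp ?F1))"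
    unfolding X_def by (rule tagged_lfp(2)[of "univ M" ?F k l ?F1 ?F2, OF M(2)]) (rule *; assumption?)+
qed

lemma decides_Conj:
  fixes \<Phi> \<Psi> :: "('a, 'f, 'r) system"
  assumes \<phi>: "decides L m \<phi> k \<Phi> \<tau> \<sigma>" and \<psi>: "decides L m \<psi> l \<Psi> \<tau>' \<sigma>'"
  shows "decides L m (Conj \<phi> \<psi>) (2 + (k + l)) (conj_system k l \<Phi> \<Psi>)
    (\<lambda>M X as. \<tau> M (dec1 (univ M) k l X) as \<and> \<tau>' M (dec2 (univ M) k l X) as)
    (\<lambda>M X as. \<sigma> M (dec1 (univ M) k l X) as \<or> \<sigma>' M (dec2 (univ M) k l X) as)"
  unfolding decides_def
proof (intro conjI allI impI)
  have q: "system_query L k \<Phi>" "output_query L k m \<tau>" "output_query L k m \<sigma>"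
    "system_query L l \<Psi>" "output_query L l m \<tau>'" "output_query L l m \<sigma>'"
    using \<phi> \<psi> by (simp_all add: decides_def)
  show "system_query L (2 + (k + l)) (conj_system k l \<Phi> \<Psi>)"
    using q by (intro conj_system_query)
  note q' = output_query_dec1[OF q(2), of l] output_query_dec1[OF q(3), of l]
    output_query_dec2[OF q(5), of k] output_query_dec2[OF q(6), of k]
  show "output_query L (2 + (k + l)) m (\<lambda>M X as. \<tau> M (dec1 (univ M) k l X) as \<and> \<tau>' M (dec2 (univ M) k l X) as)"
    using q'(1,3) unfolding output_query_def by (rule fo_query_and)
  show "output_query L (2 + (k + l)) m (\<lambda>M X as. \<sigma> M (dec1 (univ M) k l X) as \<or> \<sigma>' M (dec2 (univ M) k l X) as)"
    using q'(2,4) unfolding output_query_def by (rule fo_query_or)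
  fix M :: "('a, 'f, 'r) fo_struct" and R as
  assume M: "finite_structure L M" "2 \<le> card (univ M)" and as: "as \<in> tuples (univ M) m"
  then have str: "is_structure L M" by (simp add: finite_structure_def)
  let ?X = "lfp (system_op (2 + (k + l)) (conj_system k l \<Phi> \<Psi>) M (rpos M R) (rneg M R))"
  note X = conj_system_lfp[OF q(1,4) str M(2), of "rpos M R" "rneg M R", unfolded restr_simps]
  show "(\<tau> M (dec1 (univ M) k l ?X) as \<and> \<tau>' M (dec2 (univ M) k l ?X) as) \<longleftrightarrow> sat M R ((!) as) (Conj \<phi> \<psi>)"
    "(\<sigma> M (dec1 (univ M) k l ?X) as \<or> \<sigma>' M (dec2 (univ M) k l ?X) as) \<longleftrightarrow> \<not> sat M R ((!) as) (Conj \<phi> \<psi>)"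
    unfolding X using \<phi> \<psi> M as by (simp_all add: decides_def)
qed

section \<open>The system for a least fixed point\<close>

context
  fixes t s :: "'w set \<Rightarrow> 'b \<Rightarrow> bool" and U :: "'b set" and K :: "'k set" and pt and Y Z :: "'k \<Rightarrow> 'w set"
  assumes t: "\<And>X X' x. X \<subseteq> X' \<Longrightarrow> x \<in> U \<Longrightarrow> t X x \<Longrightarrow> t X' x"
    and s: "\<And>X X' x. X \<subseteq> X' \<Longrightarrow> x \<in> U \<Longrightarrow> s X x \<Longrightarrow> s X' x"
    and YZ: "\<And>\<kappa>. \<kappa> \<in> K \<Longrightarrow> Y \<kappa> \<subseteq> Z \<kappa>" and pt: "\<And>\<kappa>. \<kappa> \<in> K \<Longrightarrow> pt \<kappa> \<in> U"
begin

lemma run_less_mono: "x \<in> U \<Longrightarrow> y \<in> U \<Longrightarrow> run_less K t s Y x y \<Longrightarrow> run_less K t s Z x y"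
  using t s YZ unfolding run_less_def by meson

lemma run_le_mono:
  assumes "x \<in> U" "y \<in> U" "run_le K base pt t s Y x y"
  shows "run_le K base pt t s Z x y"
proof -
  from assms(3) obtain \<kappa> where \<kappa>: "\<kappa> \<in> K" "t (Y \<kappa>) x" "base \<kappa> \<or> run_less K t s Y (pt \<kappa>) y"
    unfolding run_le_def by blast
  with t[OF YZ[OF \<kappa>(1)] assms(1)] run_less_mono[OF pt[OF \<kappa>(1)] assms(2)]
  show ?thesis unfolding run_le_def by blast
qed

lemma run_pos_mono: "\<kappa> \<in> K \<Longrightarrow> run_pos U K base pt t s Y \<kappa> \<subseteq> run_pos U K base pt t s Z \<kappa>"
  unfolding run_pos_def using run_le_mono[OF _ pt] by blast

lemma run_neg_mono: "\<kappa> \<in> K \<Longrightarrow> run_neg U K base pt t s Y \<kappa> \<subseteq> run_neg U K base pt t s Z \<kappa>"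
  unfolding run_neg_def using run_less_mono[OF pt] by blast

end

lemma bex_Times: "(\<exists>\<kappa> \<in> A \<times> B. P \<kappa>) \<longleftrightarrow> (\<exists>q \<in> A. \<exists>u \<in> B. P (q, u))"
  by auto

text \<open>A system for the body is turned into one for \<open>Lfp S xs \<phi> us\<close>. The
  tuple \<open>p\<close> of length \<open>m\<close> holds the values of all variables; since the
  operator depends on those outside \<open>xs\<close>, every \<open>p\<close> has its own family of
  runs.\<close>

locale lfp_step =
  fixes L :: "('f, 'r) language" and \<phi> :: "('f, 'r) fm" and S :: rvar and xs us :: "nat list" and m N :: nat
    and \<Phi> :: "('a, 'f, 'r) system" and \<tau> \<sigma>
  assumes decided: "decides L m \<phi> N \<Phi> \<tau> \<sigma>"
    and wf: "wf_fm L \<phi>" and pos: "positive S \<phi>" and xs: "distinct xs" "length xs = arity S"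
    and us: "length us = arity S" "set us \<subseteq> {..<m}" and vars: "fv \<phi> \<subseteq> {..<m}"
begin

abbreviation "n \<equiv> arity S"
abbreviation "keys M \<equiv> tuples (univ M) 2 \<times> tuples (univ M) n"
abbreviation base :: "'a list \<times> 'a list \<Rightarrow> bool" where "base \<kappa> \<equiv> fst \<kappa> ! 0 \<noteq> fst \<kappa> ! 1"
abbreviation "t M p X x \<equiv> \<tau> M X (upd m xs p x)"
abbreviation "s M p X x \<equiv> \<sigma> M X (upd m xs p x)"

text \<open>Tuples of the new system consist of a tag, a point, the parameters \<open>p\<close> and
  a tuple of the inner system. A section collects the results of one run. An unequal tag marks a
  base key, whose point is padding.\<close>

definition sec :: "('a, 'f, 'r) fo_struct \<Rightarrow> 'a list set \<Rightarrow> 'a list \<Rightarrow> 'a list \<times> 'a list \<Rightarrow> 'a list set" where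
  "sec M X p \<kappa> = {w \<in> tuples (univ M) N. fst \<kappa> @ snd \<kappa> @ p @ w \<in> X}"

lemma sec_Pair: "sec M X p (q, u) = {w \<in> tuples (univ M) N. q @ u @ p @ w \<in> X}"
  by (simp add: sec_def)

abbreviation "LT M X p \<equiv> run_less (keys M) (t M p) (s M p) (sec M X p)"
abbreviation "LE M X p \<equiv> run_le (keys M) base snd (t M p) (s M p) (sec M X p)"
abbreviation "OUT M X p \<equiv> run_out (tuples (univ M) n) (keys M) base snd (t M p) (s M p) (sec M X p)"

text \<open>The inner system, reading for \<open>S\<close> what the runs have found so far:
  \<open>LE\<close> describes the stage of the point \<open>e 1\<close>, and \<open>LT\<close> its
  complement. The conditions on \<open>e 0\<close> spell out \<open>run_pos\<close> and
  \<open>run_neg\<close>; they involve equality only, so negating them does not harm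
  positivity.\<close>

definition lfp_system :: "('a, 'f, 'r) system" where
  "lfp_system M P Q X w = (let e = blocks [2, n, m, N] w in
     \<Phi> M (\<lambda>T. {b \<in> tuples (univ M) (arity T).
            if T = S then e 0 ! 0 = e 0 ! 1 \<and> LE M X (e 2) b (e 1) else b \<in> P T})
         (\<lambda>T. {b \<in> tuples (univ M) (arity T).
            if T = S then e 0 ! 0 \<noteq> e 0 ! 1 \<or> LT M X (e 2) (e 1) b else b \<in> Q T})
         {w \<in> tuples (univ M) N. e 0 @ e 1 @ e 2 @ w \<in> X} (e 3))"

abbreviation "N' \<equiv> 2 + (n + (m + N))"

lemma queries: "system_query L N \<Phi>" "output_query L N m \<tau>" "output_query L N m \<sigma>"
  using decided by (simp_all add: decides_def)

lemma block_query_out: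
  assumes "output_query L N m \<rho>"
    and "a < length \<alpha>" "\<alpha> ! a = m" "b < length \<alpha>" "\<alpha> ! b = n" "q < length \<alpha>" "\<alpha> ! q = 2" "u < length \<alpha>" "\<alpha> ! u = n"
  shows "block_query L UNIV \<alpha> (\<lambda>M R e. \<rho> M {w \<in> tuples (univ M) N. e q @ e u @ e a @ w \<in> R (0, N')} (upd m xs (e a) (e b)))"
proof (rule block_query_output[OF assms(1)])
  show "selector \<alpha> m (\<lambda>e. upd m xs (e a) (e b))"
    using assms xs by (intro selector_assign) auto
  show "block_query L UNIV (\<alpha> @ [N]) (\<lambda>M R e. e q @ e u @ e a @ e (length \<alpha>) \<in> R (0, N'))"
    using assms by (intro block_query_intros) (auto simp: nth_append)
qed (use assms in simp)

lemma block_query_LT: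
  assumes "a < length \<alpha>" "\<alpha> ! a = m" "b < length \<alpha>" "\<alpha> ! b = n" "c < length \<alpha>" "\<alpha> ! c = n"
  shows "block_query L UNIV \<alpha> (\<lambda>M R e. LT M (R (0, N')) (e a) (e b) (e c))"
  unfolding run_less_def bex_Times sec_Pair
  by (intro block_query_intros block_query_out[OF queries(2)] block_query_out[OF queries(3)])
    (use assms in \<open>simp_all add: nth_append\<close>)

lemma block_query_LE:
  assumes "a < length \<alpha>" "\<alpha> ! a = m" "b < length \<alpha>" "\<alpha> ! b = n" "c < length \<alpha>" "\<alpha> ! c = n"
  shows "block_query L UNIV \<alpha> (\<lambda>M R e. LE M (R (0, N')) (e a) (e b) (e c))"
  unfolding run_le_def bex_Times fst_conv snd_conv unfolding sec_Pair
  by (intro block_query_intros block_query_LT block_query_out[OF queries(2)])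
    (use assms in \<open>simp_all add: nth_append\<close>)

lemma block_query_OUT:
  assumes "a < length \<alpha>" "\<alpha> ! a = m" "b < length \<alpha>" "\<alpha> ! b = n"
  shows "block_query L UNIV \<alpha> (\<lambda>M R e. OUT M (R (0, N')) (e a) (e b))"
  unfolding run_out_def bex_Times fst_conv snd_conv not_not unfolding sec_Pair
  by (intro block_query_intros block_query_LT block_query_LE block_query_out[OF queries(3)])
    (use assms in \<open>simp_all add: nth_append\<close>)


lemma lfp_system_query: "system_query L N' lfp_system"
  unfolding system_query_def lfp_system_def Let_def
proof (rule block_query_fo)
  let ?\<alpha> = "[2, n, m, N]"
  have X: "block_query L UNIV (?\<alpha> @ [N]) (\<lambda>M R e. e 0 @ e 1 @ e 2 @ e (length ?\<alpha>) \<in> R (0, N'))"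
    by (intro block_query_intros) simp_all
  have f: "selector ?\<alpha> N (\<lambda>e. e 3)" by (rule selector_block) simp_all
  show "block_query L UNIV ?\<alpha> (\<lambda>M R e.
     \<Phi> M (\<lambda>T. {b \<in> tuples (univ M) (arity T).
            if T = S then e 0 ! 0 = e 0 ! 1 \<and> LE M (R (0, N')) (e 2) b (e 1) else b \<in> pos_in R T})
         (\<lambda>T. {b \<in> tuples (univ M) (arity T).
            if T = S then e 0 ! 0 \<noteq> e 0 ! 1 \<or> LT M (R (0, N')) (e 2) (e 1) b else b \<in> neg_in R T})
         {w \<in> tuples (univ M) N. e 0 @ e 1 @ e 2 @ w \<in> R (0, N')} (e 3))"
  proof (rule block_query_system[OF queries(1)], rule f, rule X)
    show "block_query L UNIV (?\<alpha> @ [arity T]) (\<lambda>M R e. if T = S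
        then e 0 ! 0 = e 0 ! 1 \<and> LE M (R (0, N')) (e 2) (e (length ?\<alpha>)) (e 1)
        else e (length ?\<alpha>) \<in> pos_in R T)" for T
      by (intro block_query_if block_query_and block_query_eq block_query_LE block_query_pos_in selector_block) simp_all
    show "block_query L UNIV (?\<alpha> @ [arity T]) (\<lambda>M R e. if T = S
        then e 0 ! 0 \<noteq> e 0 ! 1 \<or> LT M (R (0, N')) (e 2) (e 1) (e (length ?\<alpha>))
        else e (length ?\<alpha>) \<in> neg_in R T)" for T
      by (intro block_query_if block_query_or block_query_neq block_query_LT block_query_neg_in selector_block) simp_all
  qed simp_all
qed simp

lemma lfp_system_op_iff:
  assumes "\<kappa> \<in> keys M" "p \<in> tuples (univ M) m" "w \<in> tuples (univ M) N"
  shows "fst \<kappa> @ snd \<kappa> @ p @ w \<in> system_op N' lfp_system M (rpos M R) (rneg M R) X \<longleftrightarrow>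
    w \<in> system_op N \<Phi> M
      ((rpos M R)(S := run_pos (tuples (univ M) n) (keys M) base snd (t M p) (s M p) (sec M X p) \<kappa>))
      ((rneg M R)(S := run_neg (tuples (univ M) n) (keys M) base snd (t M p) (s M p) (sec M X p) \<kappa>))
      (sec M X p \<kappa>)"
proof -
  obtain q u where \<kappa>: "\<kappa> = (q, u)" "q \<in> tuples (univ M) 2" "u \<in> tuples (univ M) n"
    using assms(1) by auto
  have len: "length q = 2" "length u = n" "length p = m" "length w = N"
    using \<kappa> assms by (auto dest: tuples_length)
  have tup: "q @ u @ p @ w \<in> tuples (univ M) N'"
    using assms \<kappa> len by (simp del: add_2_eq_Suc)
  let ?e = "blocks [2, n, m, N] (q @ u @ p @ w)"
  have B: "?e 0 = q" "?e 1 = u" "?e 2 = p" "?e 3 = w"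
    using len by (simp_all add: numeral_2_eq_2 numeral_3_eq_3)
  have P: "(\<lambda>T. {b \<in> tuples (univ M) (arity T). if T = S then q ! 0 = q ! 1 \<and> LE M X p b u else b \<in> rpos M R T}) =
      (rpos M R)(S := run_pos (tuples (univ M) n) (keys M) base snd (t M p) (s M p) (sec M X p) (q, u))"
    by (auto simp: fun_eq_iff run_pos_def rpos_def)
  have Q: "(\<lambda>T. {b \<in> tuples (univ M) (arity T). if T = S then q ! 0 \<noteq> q ! 1 \<or> LT M X p u b else b \<in> rneg M R T}) =
      (rneg M R)(S := run_neg (tuples (univ M) n) (keys M) base snd (t M p) (s M p) (sec M X p) (q, u))"
    by (auto simp: fun_eq_iff run_neg_def rneg_def)
  have X: "{w \<in> tuples (univ M) N. q @ u @ p @ w \<in> X} = sec M X p (q, u)"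
    by (simp add: sec_def)
  show ?thesis
    unfolding \<kappa>(1) fst_conv snd_conv system_op_def lfp_system_def Let_def mem_Collect_eq B P Q X
    using tup assms(3) by blast
qed

lemma block_query_us:
  assumes "block_query L UNIV [m, n] (\<lambda>M R e. F M R (e 0) (e 1))"
  shows "block_query L UNIV [m] (\<lambda>M R e. F M R (e 0) (map ((!) (e 0)) us))"
proof -
  have 1: "fo_query L UNIV (m + n) (\<lambda>M R as. F M R (blocks [m, n] as 0) (blocks [m, n] as 1))"
    by (rule block_query_fo[OF assms]) simp
  have 2: "selector [m] (m + n) (\<lambda>e. e 0 @ map ((!) (e 0)) us)"
    using us by (intro selector_append selector_block selector_map_nth[where k = m]) auto
  show ?thesis
    by (rule block_query_cong[OF block_query_app[OF 1 2]]) (use us in \<open>simp add: tuples_def\<close>)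
qed

lemma output_query_lfp:
  "output_query L N' m (\<lambda>M X p. LE M X p (map ((!) p) us) (map ((!) p) us))"
  "output_query L N' m (\<lambda>M X p. OUT M X p (map ((!) p) us))"
  by (rule output_queryI, rule block_query_us, (rule block_query_LE block_query_OUT; simp))+

text \<open>Sections at different \<open>p\<close> do not influence each other, so leastness of the
  joint fixed point gives leastness of the family of runs for each \<open>p\<close>
  separately.\<close>

lemma runs:
  assumes M: "finite_structure L M" "2 \<le> card (univ M)" and p: "p \<in> tuples (univ M) m"
  shows "stage_runs (tuples (univ M) n)
    (\<lambda>X. {b \<in> tuples (univ M) n. sat M (R(S := X)) (assign ((!) p) xs b) \<phi>})
    (keys M) base snd
    (\<lambda>P Q. system_op N \<Phi> M ((rpos M R)(S := P)) ((rneg M R)(S := Q))) (t M p) (s M p)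
    (sec M (lfp (system_op N' lfp_system M (rpos M R) (rneg M R))) p)"
    (is "stage_runs ?U ?\<Gamma> ?K base snd ?Op _ _ (sec M ?X p)")
proof
  have str: "is_structure L M" and fin: "finite (univ M)"
    using M by (simp_all add: finite_structure_def)
  obtain q q' where q: "q \<in> tuples (univ M) 2" "q ! 0 = q ! 1" "q' \<in> tuples (univ M) 2" "q' ! 0 \<noteq> q' ! 1"
    using tags[OF M(2)] .
  have "univ M \<noteq> {}" using M(2) by auto
  show "finite ?U" using fin by (rule finite_tuples)
  show "mono ?\<Gamma>"
  proof (rule monoI)
    fix X Y :: "'a list set" assume "X \<subseteq> Y"
    then have "sat M (R(S := X)) v \<phi> \<longrightarrow> sat M (R(S := Y)) v \<phi>" for v
      using sat_mono[OF wf, of "R(S := X)" "R(S := Y)" True M v] pos by (auto split: if_splits)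
    then show "?\<Gamma> X \<subseteq> ?\<Gamma> Y" by blast
  qed
  show "?\<Gamma> X \<subseteq> ?U" for X by blast
  show "\<exists>\<kappa> \<in> ?K. base \<kappa>"
    using q tuples_nonempty[OF \<open>univ M \<noteq> {}\<close>, of n] by force
  show "\<exists>\<kappa> \<in> ?K. \<not> base \<kappa> \<and> snd \<kappa> = u" if "u \<in> ?U" for u
    using q that by force
  show "snd \<kappa> \<in> ?U" if "\<kappa> \<in> ?K" for \<kappa> using that by auto
  show Op_mono: "?Op P Q X \<subseteq> ?Op P' Q' X'" if "P \<subseteq> P'" "Q \<subseteq> Q'" "X \<subseteq> X'" for P P' Q Q' X X'
    using that by (intro system_op_mono[OF queries(1) str]) auto
  have upd: "upd m xs p x \<in> tuples (univ M) m" if "x \<in> ?U" for x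
    using that p xs by (intro upd_in_tuples) auto
  show t_mono: "t M p X' x" if "X \<subseteq> X'" "x \<in> ?U" "t M p X x" for X X' x
    using output_mono[OF queries(2) str that(1) upd[OF that(2)] that(3)] .
  show s_mono: "s M p X' x" if "X \<subseteq> X'" "x \<in> ?U" "s M p X x" for X X' x
    using output_mono[OF queries(3) str that(1) upd[OF that(2)] that(3)] .
  have exact: "(t M p (lfp (?Op Z (?U - Z))) x \<longleftrightarrow> x \<in> ?\<Gamma> Z) \<and> (s M p (lfp (?Op Z (?U - Z))) x \<longleftrightarrow> x \<notin> ?\<Gamma> Z)"
    if "Z \<subseteq> ?U" "x \<in> ?U" for Z x
  proof -
    \<comment> \<open>Feeding \<open>Z\<close> and its complement to the inner system amounts to
      interpreting \<open>S\<close> by \<open>Z\<close>, so correctness of that system applies to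
      the changed interpretation.\<close>
    have eq: "(rpos M R)(S := Z) = rpos M (R(S := Z))" "(rneg M R)(S := ?U - Z) = rneg M (R(S := Z))"
      using that(1) by (auto simp: fun_eq_iff rpos_def rneg_def)
    show ?thesis
      unfolding eq using decided M upd[OF that(2)] that(2) unfolding decides_def
      by (simp add: sat_update[OF vars])
  qed
  show "t M p (lfp (?Op Z (?U - Z))) x \<longleftrightarrow> x \<in> ?\<Gamma> Z" if "Z \<subseteq> ?U" "x \<in> ?U" for Z x
    using exact[OF that] by blast
  show "s M p (lfp (?Op Z (?U - Z))) x \<longleftrightarrow> x \<notin> ?\<Gamma> Z" if "Z \<subseteq> ?U" "x \<in> ?U" for Z x
    using exact[OF that] by blast
  let ?F = "system_op N' lfp_system M (rpos M R) (rneg M R)"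
  let ?run = "\<lambda>Y \<kappa>. ?Op (run_pos ?U ?K base snd (t M p) (s M p) Y \<kappa>) (run_neg ?U ?K base snd (t M p) (s M p) Y \<kappa>)"
  have fp: "?F ?X = ?X"
    by (rule lfp_unfold[symmetric]) (rule mono_system_op[OF lfp_system_query str])
  show "sec M ?X p \<kappa> = ?run (sec M ?X p) \<kappa> (sec M ?X p \<kappa>)" if "\<kappa> \<in> ?K" for \<kappa>
  proof -
    have "w \<in> sec M ?X p \<kappa> \<longleftrightarrow> w \<in> tuples (univ M) N \<and> fst \<kappa> @ snd \<kappa> @ p @ w \<in> ?F ?X" for w
      unfolding fp by (simp add: sec_def)
    with lfp_system_op_iff[OF that p, of _ R ?X] show ?thesis
      using system_op_subset[of N \<Phi>] by blast
  qed
  fix Z \<kappa>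
  assume Z: "\<And>\<kappa>. \<kappa> \<in> ?K \<Longrightarrow> ?run Z \<kappa> (Z \<kappa>) \<subseteq> Z \<kappa>" and \<kappa>: "\<kappa> \<in> ?K"
  \<comment> \<open>The largest set whose sections at \<open>p\<close> lie inside \<open>Z\<close>;
    tuples with other parameters are unrestricted.\<close>
  define W where "W = {l. \<forall>\<kappa> \<in> ?K. \<forall>w \<in> tuples (univ M) N. l = fst \<kappa> @ snd \<kappa> @ p @ w \<longrightarrow> w \<in> Z \<kappa>}"
  have secW: "sec M W p \<kappa> \<subseteq> Z \<kappa>" if "\<kappa> \<in> ?K" for \<kappa>
    using that unfolding sec_def W_def by blast
  have "?F W \<subseteq> W"
  proof
    fix l assume l: "l \<in> ?F W"
    have "w \<in> Z \<kappa>" if \<kappa>: "\<kappa> \<in> ?K" and w: "w \<in> tuples (univ M) N" "l = fst \<kappa> @ snd \<kappa> @ p @ w" for \<kappa> w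
    proof -
      have pt: "snd \<kappa> \<in> ?U" if "\<kappa> \<in> ?K" for \<kappa> using that by auto
      have "w \<in> ?run (sec M W p) \<kappa> (sec M W p \<kappa>)"
        using l w lfp_system_op_iff[OF \<kappa> p w(1), of R W] by simp
      moreover have "?run (sec M W p) \<kappa> (sec M W p \<kappa>) \<subseteq> ?run Z \<kappa> (Z \<kappa>)"
      proof (rule Op_mono)
        show "run_pos ?U ?K base snd (t M p) (s M p) (sec M W p) \<kappa> \<subseteq> run_pos ?U ?K base snd (t M p) (s M p) Z \<kappa>"
          by (rule run_pos_mono) (rule t_mono s_mono secW pt \<kappa>; assumption)+
        show "run_neg ?U ?K base snd (t M p) (s M p) (sec M W p) \<kappa> \<subseteq> run_neg ?U ?K base snd (t M p) (s M p) Z \<kappa>"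
          by (rule run_neg_mono) (rule t_mono s_mono secW pt \<kappa>; assumption)+
      qed (rule secW[OF \<kappa>])
      ultimately show ?thesis using Z[OF \<kappa>] by blast
    qed
    then show "l \<in> W" unfolding W_def by blast
  qed
  then have "?X \<subseteq> W" by (rule lfp_lowerbound)
  then show "sec M ?X p \<kappa> \<subseteq> Z \<kappa>"
    using secW[OF \<kappa>] unfolding sec_def by blast
qed

text \<open>A tuple precedes itself in the stage comparison exactly if it enters, which turns the
  comparison into a test of membership; \<open>OUT\<close> finds a closed stage that misses
  it.\<close>

lemma decides_Lfp:
  "decides L m (Lfp S xs \<phi> us) N' lfp_system
    (\<lambda>M X p. LE M X p (map ((!) p) us) (map ((!) p) us)) (\<lambda>M X p. OUT M X p (map ((!) p) us))"
  unfolding decides_def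
proof (intro conjI allI impI output_query_lfp lfp_system_query)
  fix M :: "('a, 'f, 'r) fo_struct" and R p
  assume M: "finite_structure L M" "2 \<le> card (univ M)" and p: "p \<in> tuples (univ M) m"
  let ?\<Gamma> = "\<lambda>X. {b \<in> tuples (univ M) n. sat M (R(S := X)) (assign ((!) p) xs b) \<phi>}"
  interpret run: stage_runs "tuples (univ M) n" ?\<Gamma> "keys M" base snd
    "\<lambda>P Q. system_op N \<Phi> M ((rpos M R)(S := P)) ((rneg M R)(S := Q))" "t M p" "s M p"
    "sec M (lfp (system_op N' lfp_system M (rpos M R) (rneg M R))) p"
    by (rule runs[OF M p])
  have x: "map ((!) p) us \<in> tuples (univ M) n"
    using us by (intro map_nth_in_tuples[OF p]) auto
  have "sat M R ((!) p) (Lfp S xs \<phi> us) \<longleftrightarrow> map ((!) p) us \<in> lfp ?\<Gamma>"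
    unfolding sat.simps xs(2) using stages_stabilise(2)[OF run.mono_\<Gamma> run.finite_U run.\<Gamma>_sub] by simp
  then show "LE M (lfp (system_op N' lfp_system M (rpos M R) (rneg M R))) p (map ((!) p) us) (map ((!) p) us)
      \<longleftrightarrow> sat M R ((!) p) (Lfp S xs \<phi> us)"
    "OUT M (lfp (system_op N' lfp_system M (rpos M R) (rneg M R))) p (map ((!) p) us)
      \<longleftrightarrow> \<not> sat M R ((!) p) (Lfp S xs \<phi> us)"
    using run.run_le_iff[OF x] run.run_out_iff[OF x] by simp_all
qed

end

lemma fv_subset_vars: "fv \<phi> \<subseteq> vars \<phi>"
  by (induction \<phi>) auto

text \<open>The bound \<open>m\<close> covers the bound variables too, because one tuple of length
  \<open>m\<close> carries the assignment through all subformulas.\<close>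

lemma decidable:
  fixes \<phi> :: "('f, 'r) fm"
  assumes "wf_fm L \<phi>" "vars \<phi> \<subseteq> {..<m}"
  shows "\<exists>N (\<Phi> :: ('a, 'f, 'r) system) \<tau> \<sigma>. decides L m \<phi> N \<Phi> \<tau> \<sigma>"
  using assms
proof (induction \<phi>)
  case (Eq s t)
  show ?case by (intro exI, rule decides_formula) (use Eq in auto)
next
  case (Rel r ts)
  show ?case by (intro exI, rule decides_formula) (use Rel in auto)
next
  case (RVar S ts)
  show ?case by (intro exI, rule decides_RVar) (use RVar in auto)
next
  case (Neg \<phi>)
  then show ?case using decides_Neg by fastforce
next
  case (Conj \<phi> \<psi>)
  then obtain k l and \<Phi> \<Psi> :: "('a, 'f, 'r) system" and \<tau> \<sigma> \<tau>' \<sigma>'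
    where "decides L m \<phi> k \<Phi> \<tau> \<sigma>" "decides L m \<psi> l \<Psi> \<tau>' \<sigma>'"
    by (metis wf_fm.simps(5) vars.simps(5) le_sup_iff)
  from decides_Conj[OF this] show ?case by blast
next
  case (Exi i \<phi>)
  then obtain N and \<Phi> :: "('a, 'f, 'r) system" and \<tau> \<sigma> where "decides L m \<phi> N \<Phi> \<tau> \<sigma>"
    by (metis wf_fm.simps(6) vars.simps(6) insert_subset)
  from decides_Exi[OF this] show ?case using Exi.prems fv_subset_vars[of \<phi>] by fastforce
next
  case (Lfp S xs \<phi> us)
  then obtain N and \<Phi> :: "('a, 'f, 'r) system" and \<tau> \<sigma> where "decides L m \<phi> N \<Phi> \<tau> \<sigma>"
    by (metis wf_fm.simps(7) vars.simps(7) le_sup_iff)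
  then have "lfp_step L \<phi> S xs us m N \<Phi> \<tau> \<sigma>"
    using Lfp.prems fv_subset_vars[of \<phi>] by unfold_locales auto
  from lfp_step.decides_Lfp[OF this] show ?case by blast
qed

section \<open>Orders\<close>

lemma linear_preorder_equiv:
  assumes "linear_preorder_on A r"
  shows "equiv A (r \<inter> r\<inverse>)"
proof -
  have "r \<subseteq> A \<times> A" "\<And>a. a \<in> A \<Longrightarrow> (a, a) \<in> r" "trans r"
    using assms by (auto simp: linear_preorder_on_def preorder_on_def refl_on_def)
  moreover from this have "trans (r \<inter> r\<inverse>)" by (simp add: trans_Int)
  ultimately show ?thesis by (auto simp: equiv_def refl_on_def sym_Int_converse)
qed

lemma quotient_order_iff:
  assumes r: "linear_preorder_on A r" and ab: "a \<in> A" "b \<in> A"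
  shows "((r \<inter> r\<inverse>) `` {a}, (r \<inter> r\<inverse>) `` {b}) \<in> quotient_order A r \<longleftrightarrow> (a, b) \<in> r"
proof
  have "trans r" using r by (simp add: linear_preorder_on_def preorder_on_def)
  then show "(a, b) \<in> r" if "((r \<inter> r\<inverse>) `` {a}, (r \<inter> r\<inverse>) `` {b}) \<in> quotient_order A r"
    using that by (auto simp: quotient_order_def dest: transD)
  have "a \<in> (r \<inter> r\<inverse>) `` {a}" "b \<in> (r \<inter> r\<inverse>) `` {b}"
    using equiv_class_self[OF linear_preorder_equiv[OF r]] ab by blast+
  then show "((r \<inter> r\<inverse>) `` {a}, (r \<inter> r\<inverse>) `` {b}) \<in> quotient_order A r" if "(a, b) \<in> r"
    using that ab by (auto simp: quotient_order_def intro!: quotientI)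
qed

text \<open>On a finite set the strict part of a linear order is well-founded because it is
  acyclic.\<close>

lemma well_order_quotient:
  assumes r: "linear_preorder_on A r" and fin: "finite A"
  shows "well_order_on (A // (r \<inter> r\<inverse>)) (quotient_order A r)"
proof -
  let ?q = "quotient_order A r" and ?Q = "A // (r \<inter> r\<inverse>)"
  note iff = quotient_order_iff[OF r]
  have rep: "\<exists>a \<in> A. X = (r \<inter> r\<inverse>) `` {a}" if "X \<in> ?Q" for X
    using that by (auto elim!: quotientE)
  have sub: "?q \<subseteq> ?Q \<times> ?Q" by (auto simp: quotient_order_def)
  have tr: "trans r" and refl: "\<And>a. a \<in> A \<Longrightarrow> (a, a) \<in> r"
    and total: "\<And>a b. a \<in> A \<Longrightarrow> b \<in> A \<Longrightarrow> (a, b) \<in> r \<or> (b, a) \<in> r"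
    using r by (fastforce simp: linear_preorder_on_def preorder_on_def refl_on_def total_on_def)+
  have "refl_on ?Q ?q"
    using rep iff refl by (fastforce simp: refl_on_def)
  moreover have "trans ?q"
  proof (rule transI)
    fix X Y Z assume XYZ: "(X, Y) \<in> ?q" "(Y, Z) \<in> ?q"
    then have "X \<in> ?Q" "Y \<in> ?Q" "Z \<in> ?Q" using sub by auto
    from this[THEN rep] obtain a b c where abc: "a \<in> A" "b \<in> A" "c \<in> A"
      and eq: "X = (r \<inter> r\<inverse>) `` {a}" "Y = (r \<inter> r\<inverse>) `` {b}" "Z = (r \<inter> r\<inverse>) `` {c}"
      by (elim bexE)
    show "(X, Z) \<in> ?q"
      using XYZ iff[OF abc(1,2)] iff[OF abc(2,3)] iff[OF abc(1,3)] transD[OF tr, of a b c]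
      unfolding eq by blast
  qed
  moreover have "antisym ?q"
  proof (rule antisymI)
    fix X Y assume XY: "(X, Y) \<in> ?q" "(Y, X) \<in> ?q"
    then have "X \<in> ?Q" "Y \<in> ?Q" using sub by auto
    from this[THEN rep] obtain a b where ab: "a \<in> A" "b \<in> A"
      and eq: "X = (r \<inter> r\<inverse>) `` {a}" "Y = (r \<inter> r\<inverse>) `` {b}"
      by (elim bexE)
    have "(a, b) \<in> r \<inter> r\<inverse>" using XY iff[OF ab] iff[OF ab(2,1)] unfolding eq by blast
    then show "X = Y" unfolding eq by (rule equiv_class_eq[OF linear_preorder_equiv[OF r]])
  qed
  moreover have "total_on ?Q ?q"
    unfolding total_on_def
  proof (intro ballI impI)
    fix X Y assume "X \<in> ?Q" "Y \<in> ?Q"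
    from this[THEN rep] obtain a b where ab: "a \<in> A" "b \<in> A"
      and eq: "X = (r \<inter> r\<inverse>) `` {a}" "Y = (r \<inter> r\<inverse>) `` {b}"
      by (elim bexE)
    show "(X, Y) \<in> ?q \<or> (Y, X) \<in> ?q"
      using iff[OF ab] iff[OF ab(2,1)] total[OF ab] unfolding eq by blast
  qed
  moreover have "finite ?q"
    using finite_subset[OF sub] fin by (simp add: finite_quotient quotient_def)
  moreover have "acyclic (?q - Id)" if "trans ?q" "antisym ?q"
    using trancl_id[OF trans_diff_Id[OF that]] by (simp add: acyclic_irrefl irrefl_diff_Id)
  ultimately show ?thesis
    using sub by (simp add: well_order_on_def linear_order_on_def partial_order_on_def preorder_on_def finite_acyclic_wf)
qed

text \<open>Two finite well-orders of the same size are isomorphic, so counting the classes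
  determines the order type.\<close>

lemma has_order_type_card:
  assumes r: "linear_preorder_on A r" and fin: "finite A"
  shows "has_order_type A r (card (A // (r \<inter> r\<inverse>)))"
proof -
  let ?Q = "A // (r \<inter> r\<inverse>)"
  have "finite ?Q" using fin by (simp add: quotient_def)
  then have "(quotient_order A r, card_of ?Q) \<in> ordIso"
    by (rule finite_well_order_on_ordIso[OF _ well_order_quotient[OF assms] card_of_well_order_on])
  also have "(card_of ?Q, card_of {x. x < card ?Q}) \<in> ordIso"
    using ex_bij_betw_finite_nat[OF \<open>finite ?Q\<close>] by (auto simp: atLeast0LessThan lessThan_def intro: card_of_ordIsoI)
  also have "(card_of {x. x < card ?Q}, natLeq_on (card ?Q)) \<in> ordIso"
    by (rule finite_well_order_on_ordIso[OF _ card_of_well_order_on natLeq_on_well_order_on]) simp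
  finally show ?thesis by (simp add: has_order_type_def)
qed

lemma order_type_chain:
  assumes r: "linear_preorder_on A r" and m: "has_order_type A r m"
  shows "\<exists>cs. chain_in r A cs \<and> length cs = m"
proof -
  let ?q = "quotient_order A r" and ?Q = "A // (r \<inter> r\<inverse>)"
  obtain f where f: "iso ?q (natLeq_on m) f"
    using m by (auto simp: has_order_type_def ordIso_def)
  have sub: "Field ?q \<subseteq> ?Q" by (auto simp: quotient_order_def Field_def)
  have bij: "bij_betw f (Field ?q) {x. x < m}"
    and f_iff: "\<And>X Y. X \<in> Field ?q \<Longrightarrow> Y \<in> Field ?q \<Longrightarrow> (X, Y) \<in> ?q \<longleftrightarrow> f X < m \<and> f Y < m \<and> f X \<le> f Y"
    using f unfolding iso_iff2 Field_natLeq_on by auto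
  have "\<exists>a \<in> A. (r \<inter> r\<inverse>) `` {a} \<in> Field ?q \<and> f ((r \<inter> r\<inverse>) `` {a}) = i" if "i < m" for i
  proof -
    from that bij obtain X where X: "X \<in> Field ?q" "f X = i"
      unfolding bij_betw_def by (metis (mono_tags, lifting) imageE mem_Collect_eq)
    then obtain a where "a \<in> A" "X = (r \<inter> r\<inverse>) `` {a}" using sub by (auto elim!: quotientE)
    with X show ?thesis by blast
  qed
  then obtain a where a: "\<And>i. i < m \<Longrightarrow> a i \<in> A \<and> (r \<inter> r\<inverse>) `` {a i} \<in> Field ?q \<and> f ((r \<inter> r\<inverse>) `` {a i}) = i"
    by metis
  have "(a i, a j) \<in> r \<longleftrightarrow> i \<le> j" if "i < m" "j < m" for i j
    using that a f_iff quotient_order_iff[OF r] by metis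
  then have "chain_in r A (map a [0..<m])"
    using a by (auto simp: chain_in_def sorted_wrt_iff_nth_less)
  then show ?thesis by (intro exI[of _ "map a [0..<m]"]) simp
qed

section \<open>From linear preorders through chains to the strict order property\<close>

lemma linear_preorder_imp_preorder:
  assumes "has_unbounded_LFP_linear_preorder L C"
  shows "has_unbounded_LFP_preorder L C"
proof -
  from assms obtain n y1 y2 \<phi> where *: "length y1 = n" "length y2 = n" "partitioned_LFP L \<phi> y1 y2"
    and lin: "\<And>M. M \<in> C \<Longrightarrow> linear_preorder_on (tuples (univ M) n) (def_rel M \<phi> y1 y2)"
    and unb: "\<And>k. \<exists>M \<in> C. \<exists>m \<ge> k. has_order_type (tuples (univ M) n) (def_rel M \<phi> y1 y2) m"
    unfolding has_unbounded_LFP_linear_preorder_def by blast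
  have "\<exists>M \<in> C. \<exists>cs. chain_in (def_rel M \<phi> y1 y2) (tuples (univ M) n) cs \<and> length cs \<ge> k" for k
    using unb[of k] lin order_type_chain by metis
  moreover have "preorder_on (tuples (univ M) n) (def_rel M \<phi> y1 y2)" if "M \<in> C" for M
    using lin[OF that] by (simp add: linear_preorder_on_def)
  ultimately show ?thesis unfolding has_unbounded_LFP_preorder_def using * by blast
qed

text \<open>The sets of elements below the members of a strict chain grow strictly, by transitivity
  and reflexivity, so the formula of the preorder itself is the witness.\<close>

lemma preorder_imp_sOP:
  assumes "has_unbounded_LFP_preorder L C"
  shows "has_LFP_sOP L C"
proof -
  from assms obtain n y1 y2 \<phi> where *: "length y1 = n" "length y2 = n" "partitioned_LFP L \<phi> y1 y2"
    and pre: "\<And>M. M \<in> C \<Longrightarrow> preorder_on (tuples (univ M) n) (def_rel M \<phi> y1 y2)"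
    and unb: "\<And>k. \<exists>M \<in> C. \<exists>cs. chain_in (def_rel M \<phi> y1 y2) (tuples (univ M) n) cs \<and> length cs \<ge> k"
    unfolding has_unbounded_LFP_preorder_def by blast
  have "\<exists>M \<in> C. sOP k M \<phi> y1 y2" for k
  proof -
    obtain M cs where M: "M \<in> C" and len: "length cs \<ge> k"
      and chain: "chain_in (def_rel M \<phi> y1 y2) (tuples (univ M) n) cs"
      using unb by blast
    let ?r = "def_rel M \<phi> y1 y2"
    have D: "def_set M \<phi> y1 y2 b = {a. (a, b) \<in> ?r}" if "b \<in> tuples (univ M) n" for b
      using that * by (auto simp: def_set_def def_rel_def)
    have r: "trans ?r" "\<And>a. a \<in> tuples (univ M) n \<Longrightarrow> (a, a) \<in> ?r"
      using pre[OF M] by (auto simp: preorder_on_def refl_on_def)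
    have cs: "cs ! i \<in> tuples (univ M) n" if "i < length cs" for i
      using chain that by (auto simp: chain_in_def)
    have "sOP k M \<phi> y1 y2" unfolding sOP_def
    \<comment> \<open>The parameters in \<open>sOP\<close> are numbered from 1 and list positions
      from 0.\<close>
    proof (intro exI[of _ "\<lambda>i. cs ! (i - 1)"] conjI ballI)
      show "cs ! (i - 1) \<in> tuples (univ M) (length y2)" if "i \<in> {1..k}" for i
        using that len cs[of "i - 1"] *(2) by auto
      show "def_set M \<phi> y1 y2 (cs ! (i - 1)) \<subset> def_set M \<phi> y1 y2 (cs ! (Suc i - 1))"
        if i: "i \<in> {1..<k}" for i
      proof -
        have i': "i - 1 < i" "i < length cs" using i len by auto
        then have "(cs ! (i - 1), cs ! i) \<in> ?r" "(cs ! i, cs ! (i - 1)) \<notin> ?r"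
          using chain unfolding chain_in_def sorted_wrt_iff_nth_less by blast+
        moreover have "cs ! i \<in> tuples (univ M) n" "cs ! (i - 1) \<in> tuples (univ M) n"
          using i' cs by auto
        ultimately show ?thesis using D r transD[OF r(1)] by auto
      qed
    qed
    then show ?thesis using M by blast
  qed
  with * show ?thesis unfolding has_LFP_sOP_def by blast
qed

text \<open>A positive elementary formula may contain \<open>S\<close> only. As the query depends on
  nothing but \<open>R S\<close>, any other relation variable in its formula can be replaced by
  falsity.\<close>

lemma fo_query_single:
  fixes Q :: "('a, 'f, 'r) fo_struct \<Rightarrow> 'a list set \<Rightarrow> 'a list \<Rightarrow> bool"
  assumes "fo_query L UNIV n (\<lambda>M R as. Q M (R S) as)"
  shows "fo_query L {S} n (\<lambda>M R as. Q M (R S) as)"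
proof -
  let ?G = "\<lambda>T (M :: ('a, 'f, 'r) fo_struct) R as. if T = S then drop n as \<in> R S else False"
  have G: "fo_query L {S} (n + arity T) (?G T)" for T
    using fo_query_atom[of S "{S}" L n] by (cases "T = S") (simp_all add: fo_query_const)
  have "fo_query L {S} n (\<lambda>M R as. Q M {b. ?G S M R (as @ b)} (map ((!) as) [0..<n]))"
    by (rule fo_query_sub[OF assms, of "[0..<n]" n "{S}" ?G], simp, fastforce, rule G)
  then show ?thesis
    by (rule fo_query_cong) (auto simp: tuples_def intro!: arg_cong2[where f = "Q _"] nth_equalityI)
qed

lemma fo_query_positive_elementary:
  fixes Q :: "('a, 'f, 'r) fo_struct \<Rightarrow> 'a list set \<Rightarrow> 'a list \<Rightarrow> bool"
  assumes "fo_query L {S} (arity S) (\<lambda>M R as. Q M (R S) as)"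
  obtains \<psi> where "positive_elementary L S [0..<arity S] \<psi>"
    "\<And>M R v b. is_structure L M \<Longrightarrow> b \<in> tuples (univ M) (arity S) \<Longrightarrow>
      sat M R (assign v [0..<arity S] b) \<psi> \<longleftrightarrow> Q M (R S) b"
proof -
  from assms obtain \<psi> where \<psi>: "pos_fo L {S} (arity S) \<psi>"
    and sat: "\<And>M R as. is_structure L M \<Longrightarrow> as \<in> tuples (univ M) (arity S) \<Longrightarrow> sat M R ((!) as) \<psi> \<longleftrightarrow> Q M (R S) as"
    by (rule fo_queryE) blast
  have "sat M R (assign v [0..<arity S] b) \<psi> \<longleftrightarrow> sat M R ((!) b) \<psi>" if b: "b \<in> tuples (univ M) (arity S)"
    for M :: "('a, 'f, 'r) fo_struct" and R v b
  proof (rule sat_cong)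
    fix i assume "i \<in> fv \<psi>"
    then have "i < arity S" using \<psi> by (auto simp: pos_fo_def)
    then show "assign v [0..<arity S] b i = b ! i"
      using assign_nth[of "[0..<arity S]" b i v] b by (simp add: tuples_def)
  qed simp
  with sat have "\<And>M R v b. is_structure L M \<Longrightarrow> b \<in> tuples (univ M) (arity S) \<Longrightarrow>
      sat M R (assign v [0..<arity S] b) \<psi> \<longleftrightarrow> Q M (R S) b" by blast
  moreover have "positive_elementary L S [0..<arity S] \<psi>"
    using \<psi> unfolding positive_elementary_def pos_fo_def by (simp add: atLeast0LessThan del: split_paired_All)
  ultimately show ?thesis using that by blast
qed

section \<open>From the strict order property to proficiency\<close>

text \<open>Values for \<open>zs\<close> are extended to a full \<open>m\<close>-tuple. The padding
  element \<open>c ! 0\<close> is an argument because the language may lack constants; queries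
  quantify over it.\<close>

abbreviation inst :: "nat \<Rightarrow> nat list \<Rightarrow> 'a list \<Rightarrow> 'a list \<Rightarrow> 'a list" where
  "inst m zs c as \<equiv> map (assign (\<lambda>_. c ! 0) zs as) [0..<m]"

lemma selector_inst:
  assumes b: "b < length \<alpha>" "\<alpha> ! b = 1" and g: "selector \<alpha> (length zs) g"
  shows "selector \<alpha> m (\<lambda>e. inst m zs (e b) (g e))"
proof -
  let ?is = "map (assign (\<lambda>_. 0) zs [1..<1 + length zs]) [0..<m]"
  have "assign (\<lambda>_. 0) zs [1..<1 + length zs] i \<in> {..<1 + length zs}" for i
    by (intro assign_in) (auto simp: Suc_le_eq)
  then have sel: "selector \<alpha> m (\<lambda>e. map ((!) (e b @ g e)) ?is)"
    using b g by (intro selector_map_nth[where k = "1 + length zs"] selector_append selector_block) auto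
  from g obtain js where js: "length js = length zs"
    "\<And>as. length as = sum_list \<alpha> \<Longrightarrow> g (blocks \<alpha> as) = map ((!) as) js"
    unfolding selector_def by blast
  have "map ((!) (blocks \<alpha> as b @ g (blocks \<alpha> as))) ?is = inst m zs (blocks \<alpha> as b) (g (blocks \<alpha> as))"
    if as: "length as = sum_list \<alpha>" for as
  proof -
    let ?c = "blocks \<alpha> as b" and ?a = "g (blocks \<alpha> as)"
    have len: "length ?c = 1" "length ?a = length zs"
      using blocks_in_tuples[of as UNIV \<alpha> b] b as js by (auto simp: tuples_def)
    have "map ((!) (?c @ ?a)) [1..<1 + length zs] = ?a"
      using len by (intro nth_equalityI) (simp_all add: nth_append del: upt_Suc)
    then have "(?c @ ?a) ! (assign (\<lambda>_. 0) zs [1..<1 + length zs] i) = assign ((!) (?c @ ?a) \<circ> (\<lambda>_. 0)) zs ?a i" for i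
      using assign_map[of "(!) (?c @ ?a)" "\<lambda>_. 0" zs "[1..<1 + length zs]" i] by simp
    moreover have "(!) (?c @ ?a) \<circ> (\<lambda>_. 0) = (\<lambda>_ :: nat. ?c ! 0)"
      using len by (simp add: fun_eq_iff nth_append)
    ultimately show ?thesis by simp
  qed
  with sel show ?thesis unfolding selector_def by metis
qed

lemma inst_in_tuples:
  "c \<in> tuples A 1 \<Longrightarrow> as \<in> tuples A (length zs) \<Longrightarrow> inst m zs c as \<in> tuples A m"
proof (intro map_in_tuples assign_in)
  assume "c \<in> tuples A 1"
  then have "c ! 0 \<in> A" using nth_mem[of 0 c] by (auto simp: tuples_def)
  then show "i \<in> set zs \<or> c ! 0 \<in> A" for i by blast
qed (auto simp: tuples_def)

lemma sat_inst:
  assumes "fv \<phi> \<subseteq> set zs" "set zs \<subseteq> {..<m}" "length as = length zs"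
  shows "sat M R ((!) (inst m zs c as)) \<phi> \<longleftrightarrow> sat M R (assign v zs as) \<phi>"
proof (rule sat_cong)
  fix i assume "i \<in> fv \<phi>"
  then have "i \<in> set zs" "i < m" using assms by auto
  then show "inst m zs c as ! i = assign v zs as i"
    using assms(3) by (auto intro: assign_cong)
qed simp

text \<open>Over at most one element there is at most one tuple of a given length, and a strict
  chain of subsets of a singleton has at most two members; hence the 3.\<close>

lemma sOP_imp_card:
  assumes "sOP n M \<phi> xs ys" "3 \<le> n" "finite (univ M)"
  shows "2 \<le> card (univ M)"
proof (rule ccontr)
  assume "\<not> 2 \<le> card (univ M)"
  then have "card (univ M) ^ length xs \<le> 1" by (intro power_le_one) auto
  then have T: "card (tuples (univ M) (length xs)) \<le> 1"
    using card_lists_length_eq[OF assms(3), of "length xs"] by (simp add: tuples_def conj_commute)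
  obtain b where b: "\<And>i. i \<in> {1..<n} \<Longrightarrow> def_set M \<phi> xs ys (b i) \<subset> def_set M \<phi> xs ys (b (Suc i))"
    using assms(1) unfolding sOP_def by blast
  let ?D = "\<lambda>i. def_set M \<phi> xs ys (b i)"
  have sub: "?D i \<subseteq> tuples (univ M) (length xs)" for i by (auto simp: def_set_def)
  then have fin: "finite (?D i)" for i using finite_tuples[OF assms(3)] finite_subset by blast
  have "card (?D 1) < card (?D 2)" "card (?D 2) < card (?D 3)"
    using b[of 1] b[of 2] assms(2) fin by (auto intro!: psubset_card_mono simp: numeral_2_eq_2 numeral_3_eq_3)
  moreover have "card (?D 3) \<le> card (tuples (univ M) (length xs))"
    using sub finite_tuples[OF assms(3)] by (intro card_mono)
  ultimately show False using T by simp
qed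

lemma closure_index_attained:
  assumes "mono \<Gamma>" "finite A" "\<And>X. \<Gamma> X \<subseteq> A"
  shows "stage \<Gamma> (closure_index \<Gamma>) = lfp \<Gamma>"
proof -
  from stages_stabilise(1)[OF assms] obtain k where "stage_union \<Gamma> = stage \<Gamma> k" ..
  then have "stage_union \<Gamma> = stage \<Gamma> (closure_index \<Gamma>)"
    unfolding closure_index_def by (rule LeastI)
  with stages_stabilise(2)[OF assms] show ?thesis by simp
qed

text \<open>The system computing \<open>\<phi>\<close> and its negation is run together with the rank of the relation
  \<open>\<phi>(M; y) \<subset> \<phi>(M; z)\<close>, so that a chain of length \<open>n\<close> forces about \<open>n\<close> stages.\<close>

locale chain_rank =
  fixes L :: "('f, 'r) language" and \<phi> :: "('f, 'r) fm" and xs ys m N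
    and \<Phi> :: "('a, 'f, 'r) system" and \<tau> \<sigma>
  assumes decided: "decides L m \<phi> N \<Phi> \<tau> \<sigma>"
    and part: "partitioned_LFP L \<phi> xs ys" and vars: "set (xs @ ys) \<subseteq> {..<m}"
begin

abbreviation "k \<equiv> length xs"
abbreviation "l \<equiv> length ys"
abbreviation "N' \<equiv> 2 + (N + l)"

definition yes where
  "yes M X a b \<longleftrightarrow> (\<exists>c \<in> tuples (univ M) 1. \<tau> M X (inst m (xs @ ys) c (a @ b)))"

definition no where
  "no M X a b \<longleftrightarrow> (\<exists>c \<in> tuples (univ M) 1. \<sigma> M X (inst m (xs @ ys) c (a @ b)))"

text \<open>A positive way to say that the set defined by \<open>y\<close> is not a proper subset of
  the set defined by \<open>z\<close>: an element of the first is missing from the second, or the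
  second is included in the first. It can therefore be approximated while the system is still
  running.\<close>

definition not_below where
  "not_below M X y z \<longleftrightarrow> (\<exists>a \<in> tuples (univ M) k. yes M X a y \<and> no M X a z) \<or>
     (\<forall>a \<in> tuples (univ M) k. yes M X a y \<or> no M X a z)"

text \<open>The first component runs the system for \<open>\<phi>\<close> with all relation
  variables empty, hence with full complements. In the second, \<open>z\<close> waits for every
  \<open>y\<close> that defines a properly smaller set: this is the induction for the well-founded
  part of strict inclusion, whose stages are ranks.\<close>

definition body where
  "body M X w = (let e = blocks [2, N, l] w in
     e 0 ! 0 = e 0 ! 1 \<and> \<Phi> M (\<lambda>S. {b \<in> tuples (univ M) (arity S). False})
        (\<lambda>S. {b \<in> tuples (univ M) (arity S). True}) (dec1 (univ M) N l X) (e 1) \<or>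
     e 0 ! 0 \<noteq> e 0 ! 1 \<and> (\<forall>y \<in> tuples (univ M) l. not_below M (dec1 (univ M) N l X) y (e 2) \<or>
        y \<in> dec2 (univ M) N l X))"

lemma queries: "system_query L N \<Phi>" "output_query L N m \<tau>" "output_query L N m \<sigma>"
  using decided by (simp_all add: decides_def)

lemma block_query_out:
  assumes \<rho>: "output_query L N m \<rho>"
    and "a < length \<alpha>" "\<alpha> ! a = k" "b < length \<alpha>" "\<alpha> ! b = l" "c < length \<alpha>" "\<alpha> ! c = 1"
  shows "block_query L UNIV \<alpha> (\<lambda>M R e.
    \<rho> M (dec1 (univ M) N l (R (0, N'))) (inst m (xs @ ys) (e c) (e a @ e b)))"
  unfolding dec1_def
proof (rule block_query_output[OF \<rho>])
  have "selector \<alpha> (length (xs @ ys)) (\<lambda>e. e a @ e b)"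
    unfolding length_append using assms by (intro selector_append selector_block) auto
  then show "selector \<alpha> m (\<lambda>e. inst m (xs @ ys) (e c) (e a @ e b))"
    using assms by (intro selector_inst)
  show "block_query L UNIV (\<alpha> @ [N]) (\<lambda>M R e. \<exists>q \<in> tuples (univ M) 2. \<exists>c \<in> tuples (univ M) l.
      q ! 0 = q ! 1 \<and> q @ e (length \<alpha>) @ c \<in> R (0, N'))"
    by (rule block_query_dec1) simp_all
qed simp

lemma block_query_yes:
  assumes "a < length \<alpha>" "\<alpha> ! a = k" "b < length \<alpha>" "\<alpha> ! b = l"
  shows "block_query L UNIV \<alpha> (\<lambda>M R e. yes M (dec1 (univ M) N l (R (0, N'))) (e a) (e b))"
  unfolding yes_def
  by (intro block_query_ex block_query_out[OF queries(2)]) (use assms in \<open>simp_all add: nth_append\<close>)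

lemma block_query_no:
  assumes "a < length \<alpha>" "\<alpha> ! a = k" "b < length \<alpha>" "\<alpha> ! b = l"
  shows "block_query L UNIV \<alpha> (\<lambda>M R e. no M (dec1 (univ M) N l (R (0, N'))) (e a) (e b))"
  unfolding no_def
  by (intro block_query_ex block_query_out[OF queries(3)]) (use assms in \<open>simp_all add: nth_append\<close>)

lemma block_query_not_below:
  assumes "a < length \<alpha>" "\<alpha> ! a = l" "b < length \<alpha>" "\<alpha> ! b = l"
  shows "block_query L UNIV \<alpha> (\<lambda>M R e. not_below M (dec1 (univ M) N l (R (0, N'))) (e a) (e b))"
  unfolding not_below_def
  by (intro block_query_intros block_query_yes block_query_no) (use assms in \<open>simp_all add: nth_append\<close>)

lemma block_query_dec2': 
  assumes "b < length \<alpha>" "\<alpha> ! b = l"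
  shows "block_query L UNIV \<alpha> (\<lambda>(M :: ('a, 'f, 'r) fo_struct) R e. e b \<in> dec2 (univ M) N l (R (0, N')))"
proof (rule block_query_cong[OF block_query_dec2[OF assms, of L N]])
  fix M :: "('a, 'f, 'r) fo_struct" and R :: "rvar \<Rightarrow> 'a list set" and e :: "nat \<Rightarrow> 'a list"
  assume "\<And>b. b < length \<alpha> \<Longrightarrow> e b \<in> tuples (univ M) (\<alpha> ! b)"
  from this[OF assms(1)] show "(\<exists>q \<in> tuples (univ M) 2. \<exists>c \<in> tuples (univ M) N. q ! 0 \<noteq> q ! 1 \<and> q @ c @ e b \<in> R (0, N')) =
      (e b \<in> dec2 (univ M) N l (R (0, N')))"
    using assms(2) by (simp add: dec2_def)
qed

lemma body_query: "fo_query L {(0, N')} N' (\<lambda>M R w. body M (R (0, N')) w)"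
proof (rule fo_query_single, unfold body_def Let_def, rule block_query_fo)
  have 1: "block_query L UNIV [2, N, l] (\<lambda>M R e. \<Phi> M (\<lambda>S. {b \<in> tuples (univ M) (arity S). False})
      (\<lambda>S. {b \<in> tuples (univ M) (arity S). True}) (dec1 (univ M) N l (R (0, N'))) (e 1))"
    unfolding dec1_def
    by (intro block_query_system[OF queries(1)] block_query_dec1 block_query_const selector_block) simp_all
  show "block_query L UNIV [2, N, l] (\<lambda>M R e. e 0 ! 0 = e 0 ! 1 \<and> \<Phi> M (\<lambda>S. {b \<in> tuples (univ M) (arity S). False})
      (\<lambda>S. {b \<in> tuples (univ M) (arity S). True}) (dec1 (univ M) N l (R (0, N'))) (e 1) \<or>
    e 0 ! 0 \<noteq> e 0 ! 1 \<and> (\<forall>y \<in> tuples (univ M) l. not_below M (dec1 (univ M) N l (R (0, N'))) y (e 2) \<or>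
      y \<in> dec2 (univ M) N l (R (0, N'))))"
    by (intro block_query_or block_query_and block_query_eq block_query_neq 1 block_query_all
        block_query_not_below block_query_dec2') simp_all
qed simp

text \<open>As long as the first component is incomplete, fewer pairs are recognised by
  \<open>not_below\<close>, so tuples of the second can only be late. Members of a chain thus need
  successive stages, however fast the answers for \<open>\<phi>\<close> arrive.\<close>

lemma many_stages:
  assumes M: "finite_structure L M" "2 \<le> card (univ M)" and sOP: "sOP n M \<phi> xs ys"
  shows "n \<le> closure_index (\<lambda>X. {w \<in> tuples (univ M) N'. body M X w}) + 1"
    (is "_ \<le> closure_index ?F + 1")
proof -
  have str: "is_structure L M" and fin: "finite (univ M)"
    using M by (simp_all add: finite_structure_def)
  let ?D = "def_set M \<phi> xs ys"
  let ?d1 = "dec1 (univ M) N l" and ?d2 = "dec2 (univ M) N l"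
  let ?F1 = "system_op N \<Phi> M (rpos M (\<lambda>_. {})) (rneg M (\<lambda>_. {}))"
  let ?F2 = "\<lambda>X Y. {z \<in> tuples (univ M) l. \<forall>y \<in> tuples (univ M) l. not_below M X y z \<or> y \<in> Y}"
  have inputs: "(\<lambda>S. {b \<in> tuples (univ M) (arity S). False}) = rpos M (\<lambda>_. {})"
    "(\<lambda>S. {b \<in> tuples (univ M) (arity S). True}) = rneg M (\<lambda>_. {})"
    by (auto simp: fun_eq_iff rpos_def rneg_def)
  have inst: "inst m (xs @ ys) c (a @ b) \<in> tuples (univ M) m"
    if "c \<in> tuples (univ M) 1" "a \<in> tuples (univ M) k" "b \<in> tuples (univ M) l" for a b c
    using that by (intro inst_in_tuples) (auto simp: tuples_def)
  have yes_mono: "yes M X' a b" if "X \<subseteq> X'" "a \<in> tuples (univ M) k" "b \<in> tuples (univ M) l" "yes M X a b" for X X' a b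
    using that output_mono[OF queries(2) str _ inst] unfolding yes_def by blast
  have no_mono: "no M X' a b" if "X \<subseteq> X'" "a \<in> tuples (univ M) k" "b \<in> tuples (univ M) l" "no M X a b" for X X' a b
    using that output_mono[OF queries(3) str _ inst] unfolding no_def by blast
  have not_below_mono: "not_below M X' y z"
    if "X \<subseteq> X'" "y \<in> tuples (univ M) l" "z \<in> tuples (univ M) l" "not_below M X y z" for X X' y z
    using that yes_mono[OF that(1)] no_mono[OF that(1)] unfolding not_below_def by blast
  have "univ M \<noteq> {}" using M(2) by auto
  then have "tuples (univ M) 1 \<noteq> {}" by (rule tuples_nonempty)
  then obtain c0 where c0: "c0 \<in> tuples (univ M) 1" unfolding ex_in_conv[symmetric] by (rule exE)
  have fv: "fv \<phi> \<subseteq> set (xs @ ys)" using part by (simp add: partitioned_LFP_def)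
  have exact: "(yes M (lfp ?F1) a b \<longleftrightarrow> a \<in> ?D b) \<and> (no M (lfp ?F1) a b \<longleftrightarrow> a \<notin> ?D b)"
    if ab: "a \<in> tuples (univ M) k" "b \<in> tuples (univ M) l" for a b
  proof -
    have "(\<tau> M (lfp ?F1) (inst m (xs @ ys) c (a @ b)) \<longleftrightarrow> a \<in> ?D b) \<and>
        (\<sigma> M (lfp ?F1) (inst m (xs @ ys) c (a @ b)) \<longleftrightarrow> a \<notin> ?D b)" if c: "c \<in> tuples (univ M) 1" for c
    proof -
      have "sat M (\<lambda>_. {}) ((!) (inst m (xs @ ys) c (a @ b))) \<phi> \<longleftrightarrow> a \<in> ?D b"
        using ab by (subst sat_inst[OF fv vars, where v = "\<lambda>_. undefined"])
          (simp_all add: def_set_def holds_def tuples_length)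
      then show ?thesis
        using decided M inst[OF c ab] unfolding decides_def by blast
    qed
    then show ?thesis unfolding yes_def no_def using c0 by blast
  qed
  have not_below_iff: "not_below M (lfp ?F1) y z \<longleftrightarrow> \<not> ?D y \<subset> ?D z"
    if "y \<in> tuples (univ M) l" "z \<in> tuples (univ M) l" for y z
  proof -
    have "?D y \<subseteq> tuples (univ M) k" "?D z \<subseteq> tuples (univ M) k" by (auto simp: def_set_def)
    then show ?thesis unfolding not_below_def using exact that by blast
  qed
  have F_mono: "mono ?F"
  proof (rule monoI)
    fix X Y :: "'a list set" assume "X \<subseteq> Y"
    then show "?F X \<subseteq> ?F Y"
      using fo_query_mono[OF body_query str, of _ "\<lambda>_. X" "\<lambda>_. Y"] by blast
  qed
  have F_iff: "q @ b @ c \<in> ?F X \<longleftrightarrow> q ! 0 = q ! 1 \<and> b \<in> ?F1 (?d1 X) \<or> q ! 0 \<noteq> q ! 1 \<and> c \<in> ?F2 (?d1 X) (?d2 X)"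
    if "q \<in> tuples (univ M) 2" "b \<in> tuples (univ M) N" "c \<in> tuples (univ M) l" for X q b c
    unfolding system_op_def body_def Let_def mem_Collect_eq blocks_triple(1-3)[OF that] inputs
    using that blocks_triple(4)[OF that] by blast
  have F_sub: "?F X \<subseteq> tuples (univ M) N'" for X by blast
  have F1: "mono ?F1" "?F1 X \<subseteq> tuples (univ M) N" for X
    by (rule mono_system_op[OF queries(1) str], rule system_op_subset)
  have F2_mono: "mono (?F2 X)" for X by (rule monoI) blast
  have F2_mono': "?F2 X Y \<subseteq> ?F2 X' Y" if "X \<subseteq> X'" for X X' Y
    using not_below_mono[OF that] by blast
  have F2_sub: "?F2 X Y \<subseteq> tuples (univ M) l" for X Y by blast
  have lfp_dec: "?d1 (lfp ?F) = lfp ?F1" "?d2 (?F X) = ?F2 (?d1 X) (?d2 X)" for X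
    by (rule tagged_lfp(1,3)[of "univ M" ?F N l ?F1 ?F2, OF M(2) F_mono F_sub _ F1 F2_mono _ F2_sub];
        (rule F_iff F2_mono'; assumption))+
  obtain b where b: "\<And>i. i \<in> {1..n} \<Longrightarrow> b i \<in> tuples (univ M) l"
    and chain: "\<And>i. i \<in> {1..<n} \<Longrightarrow> ?D (b i) \<subset> ?D (b (Suc i))"
    using sOP unfolding sOP_def by blast
  have finD: "finite (?D z)" for z
    using finite_tuples[OF fin] finite_subset[of "?D z" "tuples (univ M) k"] by (auto simp: def_set_def)
  \<comment> \<open>In the limit the answers are exact, so only properly smaller sets are waited
    for, and induction on the cardinality applies.\<close>
  have all: "z \<in> ?d2 (lfp ?F)" if "z \<in> tuples (univ M) l" for z
    using that
  proof (induction "card (?D z)" arbitrary: z rule: less_induct)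
    case less
    have "not_below M (lfp ?F1) y z \<or> y \<in> ?d2 (lfp ?F)" if "y \<in> tuples (univ M) l" for y
      using not_below_iff[OF that less.prems] less.hyps[OF _ that] psubset_card_mono[OF finD] by blast
    then have z: "z \<in> ?F2 (?d1 (lfp ?F)) (?d2 (lfp ?F))"
      using less.prems lfp_dec(1) by simp
    have "?d2 (lfp ?F) = ?d2 (?F (lfp ?F))"
      by (rule arg_cong[of _ _ ?d2]) (rule lfp_unfold[OF F_mono])
    from equalityD2[OF trans[OF this lfp_dec(2)]] z show ?case by (rule subsetD)
  qed
  \<comment> \<open>Stage 0 is already \<open>?F {}\<close>, so \<open>b 1\<close> may enter there;
    this is the origin of the \<open>+ 1\<close>.\<close>
  have slow: "i \<le> j + 1" if "i \<in> {1..n}" "b i \<in> ?d2 (stage ?F j)" for i j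
    using that
  proof (induction j arbitrary: i rule: less_induct)
    case (less j)
    let ?V = "\<Union>j'<j. stage ?F j'"
    show ?case
    proof (cases "i \<le> 1")
      case False
      then have i: "i - 1 \<in> {1..n}" "i - 1 \<in> {1..<n}" "Suc (i - 1) = i" using less.prems(1) by auto
      have "b i \<in> ?d2 (?F ?V)" using less.prems(2) unfolding stage.simps[of ?F j] .
      then have "b i \<in> ?F2 (?d1 ?V) (?d2 ?V)" by (rule equalityD1[OF lfp_dec(2), THEN subsetD])
      then have "not_below M (?d1 ?V) (b (i - 1)) (b i) \<or> b (i - 1) \<in> ?d2 ?V"
        using b[OF i(1)] by blast
      moreover have "\<not> not_below M (?d1 ?V) (b (i - 1)) (b i)"
      proof
        assume *: "not_below M (?d1 ?V) (b (i - 1)) (b i)"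
        have "stage_union ?F = lfp ?F"
          by (rule stages_stabilise(2)[OF F_mono finite_tuples[OF fin] F_sub])
        then have "?V \<subseteq> lfp ?F" by (auto simp: stage_union_def)
        then have "?d1 ?V \<subseteq> lfp ?F1" unfolding lfp_dec(1)[symmetric] dec1_def by blast
        from not_below_mono[OF this b[OF i(1)] b[OF less.prems(1)] *]
        have "\<not> ?D (b (i - 1)) \<subset> ?D (b i)"
          using not_below_iff[OF b[OF i(1)] b[OF less.prems(1)]] by blast
        with chain[OF i(2)] i(3) show False by simp
      qed
      ultimately have "b (i - 1) \<in> ?d2 ?V" by blast
      then obtain j' where "j' < j" "b (i - 1) \<in> ?d2 (stage ?F j')" unfolding dec2_def by blast
      from less.IH[OF this(1) i(1) this(2)] this(1) show ?thesis by simp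
    qed simp
  qed
  show ?thesis
  proof (cases "n = 0")
    case False
    then have "n \<in> {1..n}" by simp
    moreover have "b n \<in> ?d2 (stage ?F (closure_index ?F))"
      unfolding closure_index_attained[OF F_mono finite_tuples[OF fin] F_sub]
      using all b[OF \<open>n \<in> {1..n}\<close>] .
    ultimately show ?thesis by (rule slow)
  qed simp
qed

end

lemma sOP_imp_proficient:
  fixes L :: "('f, 'r) language" and C :: "('a, 'f, 'r) fo_struct set"
  assumes fin: "\<forall>M \<in> C. finite_structure L M" and sOP: "has_LFP_sOP L C"
  shows "proficient L C"
proof -
  from sOP obtain \<phi> xs ys where part: "partitioned_LFP L \<phi> xs ys"
    and unb: "\<And>n. \<exists>M \<in> C. sOP n M \<phi> xs ys"
    unfolding has_LFP_sOP_def by blast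
  have "finite (vars \<phi> \<union> set (xs @ ys))" by (simp add: finite_vars)
  then obtain m where m: "vars \<phi> \<union> set (xs @ ys) \<subseteq> {..<m}"
    unfolding finite_nat_set_iff_bounded by blast
  have "wf_fm L \<phi>" using part by (simp add: partitioned_LFP_def LFP_formula_def)
  then obtain N and \<Phi> :: "('a, 'f, 'r) system" and \<tau> \<sigma> where dec: "decides L m \<phi> N \<Phi> \<tau> \<sigma>"
    using decidable m by blast
  interpret chain_rank L \<phi> xs ys m N \<Phi> \<tau> \<sigma>
    using dec part m by unfold_locales auto
  let ?S = "(0, N') :: rvar"
  obtain \<psi> where \<psi>: "positive_elementary L ?S [0..<N'] \<psi>"
    and sat\<psi>: "\<And>M R v b. is_structure L M \<Longrightarrow> b \<in> tuples (univ M) N' \<Longrightarrow>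
      sat M R (assign v [0..<N'] b) \<psi> \<longleftrightarrow> body M (R ?S) b"
    using fo_query_positive_elementary[of L ?S body, unfolded snd_conv, OF body_query] by metis
  have "\<exists>M \<in> C. closure_ordinal M \<psi> ?S [0..<N'] \<ge> j" for j
  proof -
    \<comment> \<open>A length of at least 3 secures two elements in the universe, and the bound
      from \<open>many_stages\<close> loses one, which still leaves at least
      \<open>j\<close>.\<close>
    obtain M where M: "M \<in> C" "sOP (j + 3) M \<phi> xs ys" using unb by blast
    then have fM: "finite_structure L M" using fin by blast
    then have str: "is_structure L M" "finite (univ M)" by (simp_all add: finite_structure_def)
    have "induced_op M \<psi> ?S [0..<N'] = (\<lambda>X. {w \<in> tuples (univ M) N'. body M X w})"
      unfolding induced_op_def using sat\<psi>[OF str(1)] by (auto simp: fun_eq_iff)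
    moreover have "j + 3 \<le> closure_index (\<lambda>X. {w \<in> tuples (univ M) N'. body M X w}) + 1"
      using sOP_imp_card[OF M(2) _ str(2)] by (intro many_stages fM M(2)) simp
    ultimately show ?thesis using M(1) unfolding closure_ordinal_def by (intro bexI[of _ M]) simp_all
  qed
  with \<psi> show ?thesis unfolding proficient_def by blast
qed

section \<open>From proficiency to a linear preorder\<close>

text \<open>Complementing the relations and negating the result puts every relation variable under
  two negations. The nested use of \<open>\<Gamma>\<close> in \<open>le_step\<close> below has this
  form.\<close>

lemma fo_query_dual:
  assumes "fo_query L D n Q"
  shows "fo_query L D n (\<lambda>M R as. \<not> Q M (\<lambda>S. tuples (univ M) (arity S) - R S) as)"
proof -
  from assms obtain \<psi> where \<psi>: "pos_fo L D n \<psi>"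
    and sat: "\<And>M R as. is_structure L M \<Longrightarrow> as \<in> tuples (univ M) n \<Longrightarrow> sat M R ((!) as) \<psi> \<longleftrightarrow> Q M R as"
    by (rule fo_queryE) blast
  let ?g = "\<lambda>S ts. Neg (RVar S ts)"
  have \<psi>': "wf_fm L \<psi>" "first_order \<psi>" "frv \<psi> \<subseteq> D" "fv \<psi> \<subseteq> {..<n}" "\<And>S. positive S \<psi>"
    using \<psi> unfolding pos_fo_def by blast+
  have parity: "first_order \<chi> \<Longrightarrow> (\<And>S. occurs_parity e S \<chi>) \<Longrightarrow> occurs_parity (\<not> e) T (sub id ?g \<chi>)" for \<chi> e T
  proof (induction \<chi> arbitrary: e)
    case (RVar S ts)
    from RVar(2)[of S] show ?case by simp
  next
    case (Neg \<chi>)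
    from Neg.IH[of "\<not> e"] Neg.prems show ?case by simp
  qed auto
  show ?thesis
  proof (rule fo_queryI)
    show "pos_fo L D n (Neg (sub id ?g \<psi>))"
      unfolding pos_fo_def
    proof (intro conjI allI)
      show "wf_fm L (Neg (sub id ?g \<psi>))" using wf_fm_sub[OF \<psi>'(2,1)] by simp
      show "first_order (Neg (sub id ?g \<psi>))" using first_order_sub[OF \<psi>'(2) _ \<psi>'(1)] by simp
      show "positive S (Neg (sub id ?g \<psi>))" for S using parity[of \<psi> True S] \<psi>' by simp
      have "frv (sub id ?g \<psi>) \<subseteq> frv \<psi>"
        by (rule frv_sub[OF \<psi>'(2,1)]) auto
      then show "frv (Neg (sub id ?g \<psi>)) \<subseteq> D" using \<psi>'(3) by simp
      have "fv (sub id ?g \<chi>) = fv \<chi>" for \<chi> :: "('a, 'b) fm"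
      proof -
        have "tvars (ren id t) = tvars t" for t :: "'a tm" by simp
        then show ?thesis by (induction \<chi>) auto
      qed
      then show "fv (Neg (sub id ?g \<psi>)) \<subseteq> {..<n}" using \<psi>'(4) by simp
    qed
    fix M :: "('c, 'a, 'b) fo_struct" and R as
    assume M: "is_structure L M" and as: "as \<in> tuples (univ M) n"
    let ?R = "\<lambda>S. tuples (univ M) (arity S) - R S"
    have "sat M R ((!) as) (sub id ?g \<psi>) \<longleftrightarrow> sat M ?R ((!) as \<circ> id) \<psi>"
    proof (rule sat_sub[OF _ M _ \<psi>'(2,1,3), of _ "(!) as"])
      show "sat M R v' (?g S ts) \<longleftrightarrow> map (tval M v') ts \<in> ?R S"
        if "\<And>t. t \<in> set ts \<Longrightarrow> tvars t \<subseteq> range id \<and> tval M v' t \<in> univ M" "length ts = arity S"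
        for v' S ts
        using that by (auto simp: tuples_def)
      show "as ! id i \<in> univ M" if "i \<in> fv \<psi>" for i
        using that \<psi>'(4) as by (auto simp: tuples_def subset_iff)
    qed simp_all
    then show "sat M R ((!) as) (Neg (sub id ?g \<psi>)) \<longleftrightarrow> \<not> Q M ?R as"
      using sat[OF M as] by simp
  qed
qed

section \<open>Stage comparison as the fixed point of one positive operator\<close>

context stage_comparison
begin

text \<open>The relation \<open>le\<close> is the only fixed point of a positive operator: \<open>x' < y\<close> holds iff \<open>x'\<close>
  enters and \<open>y\<close> is not in \<open>\<Gamma>\<close> of the set of elements that enter strictly before \<open>x'\<close>.\<close>

definition le_step :: "('b \<Rightarrow> 'b \<Rightarrow> bool) \<Rightarrow> 'b \<Rightarrow> 'b \<Rightarrow> bool" where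
  "le_step E x y \<longleftrightarrow> x \<in> \<Gamma> {x' \<in> U. E x' x' \<and> y \<notin> \<Gamma> {z \<in> U. \<not> E x' z}}"

text \<open>What \<open>x\<close> does not precede or tie with is what entered before it, that is,
  the union of the earlier stages. Applying \<open>\<Gamma>\<close> to this union is the definition
  of \<open>J k\<close>.\<close>

lemma not_le_first:
  assumes "x \<in> J k" "\<And>j. j < k \<Longrightarrow> x \<notin> J j"
  shows "\<Gamma> {z \<in> U. \<not> le x z} = J k"
proof -
  have "{z \<in> U. \<not> le x z} = (\<Union>j<k. J j)"
  proof (intro set_eqI iffI)
    fix z assume "z \<in> {z \<in> U. \<not> le x z}"
    then obtain i where i: "z \<in> J i" "x \<notin> J i" using assms(1) by (auto simp: le_def lfp_eq)
    then have "\<not> k \<le> i" using assms(1) J_le by blast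
    with i show "z \<in> (\<Union>j<k. J j)" by auto
  next
    fix z assume "z \<in> (\<Union>j<k. J j)"
    then obtain j where "j < k" "z \<in> J j" by blast
    then show "z \<in> {z \<in> U. \<not> le x z}" using assms(2) J_sub[of j] by (auto simp: le_def)
  qed
  then show ?thesis using stage.simps[of \<Gamma> k] by simp
qed

text \<open>Every \<open>x'\<close> collected by the step enters, and \<open>y\<close> is missing
  from the stage in which it does, so \<open>x'\<close> enters before \<open>y\<close>. Applying
  \<open>\<Gamma>\<close> to such elements cannot lead beyond the stage of \<open>y\<close>.\<close>

lemma le_step_sound:
  assumes "le_step le x y"
  shows "le x y"
proof -
  let ?S = "{x' \<in> U. le x' x' \<and> y \<notin> \<Gamma> {z \<in> U. \<not> le x' z}}"
  have x: "x \<in> \<Gamma> ?S" using assms by (simp add: le_step_def)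
  have "?S \<subseteq> lfp \<Gamma>" by (auto simp: le_def)
  then have "x \<in> lfp \<Gamma>" using x monoD[OF mono_\<Gamma>] lfp_unfold[OF mono_\<Gamma>] by blast
  moreover have "x \<in> J k" if "y \<in> J k" for k
  proof -
    have "y \<in> lfp \<Gamma>" using that by (auto simp: lfp_eq)
    from first_stage[OF this] obtain i where i: "y \<in> J i" "\<forall>j<i. y \<notin> J j" by blast
    have "?S \<subseteq> (\<Union>j<i. J j)"
    proof
      fix x' assume x': "x' \<in> ?S"
      then have "x' \<in> lfp \<Gamma>" by (simp add: le_def)
      from first_stage[OF this] obtain j where j: "x' \<in> J j" "\<forall>j'<j. x' \<notin> J j'" by blast
      then have "\<Gamma> {z \<in> U. \<not> le x' z} = J j" by (intro not_le_first) auto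
      with x' have "y \<notin> J j" by blast
      then have "j < i" using i(1) J_le[of i j] by (meson not_le)
      with j show "x' \<in> (\<Union>j<i. J j)" by blast
    qed
    then have "x \<in> J i" using x monoD[OF mono_\<Gamma>] unfolding stage.simps[of \<Gamma> i] by blast
    moreover have "i \<le> k" using i(2) that by (meson not_le)
    ultimately show ?thesis using J_le by blast
  qed
  ultimately show ?thesis by (simp add: le_def)
qed

text \<open>\<open>E\<close> also occurs inside a complement, so for an \<open>x'\<close> of an
  earlier stage \<open>E x'\<close> must agree with \<open>le x'\<close> exactly. One half of this
  is the assumed soundness, the other the induction hypothesis, which therefore ranges over all
  \<open>y\<close>.\<close>

lemma le_step_complete:
  assumes sound: "\<And>x y. x \<in> U \<Longrightarrow> y \<in> U \<Longrightarrow> E x y \<Longrightarrow> le x y"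
    and step: "\<And>x y. x \<in> U \<Longrightarrow> y \<in> U \<Longrightarrow> le_step E x y \<Longrightarrow> E x y"
    and "x \<in> J k" "y \<in> U" "le x y"
  shows "E x y"
  using assms(3-5)
proof (induction k arbitrary: x y rule: less_induct)
  case (less k)
  show ?case
  proof (cases "\<exists>j<k. x \<in> J j")
    case True
    then show ?thesis using less by blast
  next
    case False
    let ?S = "{x' \<in> U. E x' x' \<and> y \<notin> \<Gamma> {z \<in> U. \<not> E x' z}}"
    have "(\<Union>j<k. J j) \<subseteq> ?S"
    proof
      fix x' assume "x' \<in> (\<Union>j<k. J j)"
      then obtain i where i: "i < k" "x' \<in> J i" by blast
      then have "x' \<in> lfp \<Gamma>" by (auto simp: lfp_eq)
      from first_stage[OF this] obtain j where j: "x' \<in> J j" "\<forall>j'<j. x' \<notin> J j'" by blast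
      have "j < k" using i j(2) by (meson le_less_trans not_le)
      have x': "x' \<in> U" using j J_sub by blast
      have E_iff: "E x' z \<longleftrightarrow> le x' z" if "z \<in> U" for z
        using sound[OF x' that] less.IH[OF \<open>j < k\<close> j(1) that] by blast
      have "{z \<in> U. \<not> E x' z} = {z \<in> U. \<not> le x' z}" using E_iff by blast
      then have "\<Gamma> {z \<in> U. \<not> E x' z} = J j" using j by (simp add: not_le_first)
      moreover have "y \<notin> J j" using less.prems(3) False \<open>j < k\<close> by (auto simp: le_def)
      moreover have "E x' x'" using E_iff[OF x'] j by (auto simp: le_def lfp_eq)
      ultimately show "x' \<in> ?S" using x' by blast
    qed
    then have "x \<in> \<Gamma> ?S"
      using less.prems(1) monoD[OF mono_\<Gamma>] unfolding stage.simps[of \<Gamma> k] by blast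
    then have "le_step E x y" by (simp add: le_step_def)
    then show ?thesis using step less.prems(1,2) J_sub by blast
  qed
qed

text \<open>\<open>r\<close> extends \<open>le\<close> by a top class of all elements outside the
  fixed point, which makes it total. Each step before the closure index adds an element, and
  elements added by different steps are inequivalent.\<close>

lemma closure_index_le_classes:
  fixes r
  defines "r \<equiv> {(a, b). a \<in> U \<and> b \<in> U \<and> (\<forall>k. b \<in> J k \<longrightarrow> a \<in> J k)}"
  shows "linear_preorder_on U r" "closure_index \<Gamma> \<le> card (U // (r \<inter> r\<inverse>))"
proof -
  show lin: "linear_preorder_on U r"
    unfolding linear_preorder_on_def preorder_on_def
  proof (intro conjI)
    show "total_on U r"
      unfolding total_on_def
    proof (intro ballI impI)
      fix a b assume ab: "a \<in> U" "b \<in> U"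
      show "(a, b) \<in> r \<or> (b, a) \<in> r"
      proof (rule ccontr)
        assume "\<not> ((a, b) \<in> r \<or> (b, a) \<in> r)"
        with ab obtain i j where "b \<in> J i" "a \<notin> J i" "a \<in> J j" "b \<notin> J j"
          unfolding r_def by blast
        then show False using J_le[of i j] J_le[of j i] linear[of i j] by blast
      qed
    qed
  qed (auto simp: r_def refl_on_def trans_def)
  let ?c = "closure_index \<Gamma>"
  have "\<exists>x. x \<in> J (Suc j) \<and> x \<notin> J j" if "j < ?c" for j
  proof (rule ccontr)
    assume "\<not> ?thesis"
    then have "J (Suc j) = J j" using J_le[of j "Suc j"] by auto
    then have "\<Gamma> (J j) = J j" by (simp add: stage_Suc[OF mono_\<Gamma>])
    then have "lfp \<Gamma> \<subseteq> J j" by (intro lfp_lowerbound) simp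
    then have "stage_union \<Gamma> = J j" by (auto simp: lfp_eq stage_union_def)
    then have "?c \<le> j" unfolding closure_index_def by (rule Least_le)
    with that show False by simp
  qed
  then obtain x where x: "\<And>j. j < ?c \<Longrightarrow> x j \<in> J (Suc j) \<and> x j \<notin> J j" by metis
  have xU: "x j \<in> U" if "j < ?c" for j using x[OF that] J_sub by blast
  let ?f = "\<lambda>j. (r \<inter> r\<inverse>) `` {x j}"
  have ne: "?f i \<noteq> ?f j" if "i < j" "j < ?c" for i j
  proof
    assume "?f i = ?f j"
    then have "(x i, x j) \<in> r \<inter> r\<inverse>"
      using eq_equiv_class[OF _ linear_preorder_equiv[OF lin] xU[OF that(2)]] by blast
    then have "x j \<in> J (Suc i)" using x[of i] that by (auto simp: r_def)
    then show False using x[of j] J_le[of "Suc i" j] that by auto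
  qed
  have "inj_on ?f {..<?c}"
  proof (rule inj_onI)
    show "i = j" if "i \<in> {..<?c}" "j \<in> {..<?c}" "?f i = ?f j" for i j
      using that ne[of i j] ne[of j i] by (metis lessThan_iff linorder_neqE_nat)
  qed
  moreover have "?f ` {..<?c} \<subseteq> U // (r \<inter> r\<inverse>)" using xU by (auto intro: quotientI)
  moreover have "finite (U // (r \<inter> r\<inverse>))" using finite_U by (simp add: quotient_def)
  ultimately show "?c \<le> card (U // (r \<inter> r\<inverse>))"
    using card_inj_on_le[of ?f "{..<?c}"] by simp
qed

end

section \<open>The formula defining the stage preorder\<close>

locale stage_preorder =
  fixes L :: "('f, 'r) language" and S :: rvar and xs :: "nat list" and \<phi> :: "('f, 'r) fm"
  assumes pe: "positive_elementary L S xs \<phi>"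
begin

abbreviation "n \<equiv> arity S"
abbreviation E :: rvar where "E \<equiv> (0, n + n)"

definition mem :: "('a, 'f, 'r) fo_struct \<Rightarrow> 'a list set \<Rightarrow> 'a list \<Rightarrow> bool" where
  "mem M X b \<longleftrightarrow> sat M ((\<lambda>_. {})(S := X)) (assign (\<lambda>_. undefined) xs b) \<phi>"

text \<open>This is \<open>le_step\<close> for a relation coded by concatenated pairs. The inner
  argument is written as a complement so that \<open>fo_query_dual\<close> applies.\<close>

definition body :: "('a, 'f, 'r) fo_struct \<Rightarrow> 'a list set \<Rightarrow> 'a list \<Rightarrow> bool" where
  "body M X w = (let e = blocks [n, n] w in
     mem M {x' \<in> tuples (univ M) n. x' @ x' \<in> X \<and>
       \<not> mem M (tuples (univ M) n - {z \<in> tuples (univ M) n. x' @ z \<in> X}) (e 1)} (e 0))"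

lemma pe': "wf_fm L \<phi>" "first_order \<phi>" "positive S \<phi>" "frv \<phi> \<subseteq> {S}" "distinct xs" "length xs = n" "fv \<phi> \<subseteq> set xs"
  using pe by (simp_all add: positive_elementary_def)

text \<open>The variables \<open>xs\<close> are arbitrary numbers, whereas a query reads positions
  below \<open>n\<close>; \<open>inst\<close> translates between the two.\<close>

lemma mem_query: "fo_query L {S} n (\<lambda>(M :: ('a, 'f, 'r) fo_struct) R b. mem M (R S) b)"
proof -
  obtain m where m: "set xs \<subseteq> {..<m}"
    using finite_set[of xs] unfolding finite_nat_set_iff_bounded by blast
  have "occurs_parity True T \<phi>" for T
    using pe'(3,4) by (cases "T = S") (auto intro: occurs_parity_notin)
  then have 1: "fo_query L {S} m (\<lambda>(M :: ('a, 'f, 'r) fo_struct) R as. sat M R ((!) as) \<phi>)"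
    using pe' m by (intro fo_query_formula) auto
  have "block_query L {S} [n] (\<lambda>(M :: ('a, 'f, 'r) fo_struct) R e. \<exists>c \<in> tuples (univ M) 1. sat M R ((!) (inst m xs c (e 0))) \<phi>)"
    by (rule block_query_ex, rule block_query_app[OF 1], rule selector_inst)
      (use pe'(6) in \<open>auto intro: selector_block\<close>)
  then have "fo_query L {S} n (\<lambda>(M :: ('a, 'f, 'r) fo_struct) R as.
      \<exists>c \<in> tuples (univ M) 1. sat M R ((!) (inst m xs c (take n as))) \<phi>)"
    by (simp add: block_query_def)
  then show ?thesis
  proof (rule fo_query_cong)
    fix M :: "('a, 'f, 'r) fo_struct" and R as
    assume M: "is_structure L M" and as: "as \<in> tuples (univ M) n"
    have "sat M R ((!) (inst m xs c (take n as))) \<phi> \<longleftrightarrow> mem M (R S) as" for c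
    proof -
      have "sat M R ((!) (inst m xs c as)) \<phi> \<longleftrightarrow> sat M R (assign (\<lambda>_. undefined) xs as) \<phi>"
        using as pe' m by (intro sat_inst) (auto simp: tuples_length)
      also have "\<dots> \<longleftrightarrow> mem M (R S) as"
        unfolding mem_def using pe'(4) by (intro sat_cong) auto
      finally show ?thesis using as by (simp add: tuples_length)
    qed
    moreover have "tuples (univ M) 1 \<noteq> {}"
      using M by (intro tuples_nonempty) (simp add: is_structure_def)
    ultimately show "(\<exists>c \<in> tuples (univ M) 1. sat M R ((!) (inst m xs c (take n as))) \<phi>) = mem M (R S) as"
      by blast
  qed
qed

lemma body_query: "fo_query L {E} (arity E) (\<lambda>(M :: ('a, 'f, 'r) fo_struct) R w. body M (R E) w)"
  unfolding body_def Let_def snd_conv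
proof (rule block_query_fo)
  have sel: "selector \<alpha> (b + c) (\<lambda>e :: nat \<Rightarrow> 'a list. e i @ e j)"
    if "i < length \<alpha>" "\<alpha> ! i = b" "j < length \<alpha>" "\<alpha> ! j = c" for \<alpha> b c i j
    using that by (intro selector_append selector_block) auto
  have E1: "block_query L {E} ([n, n, n] @ [arity T]) (\<lambda>(M :: ('a, 'f, 'r) fo_struct) R e. e 2 @ e 3 \<in> R E)" if "T \<in> {S}" for T
    by (rule block_query_mem) (use that in \<open>auto intro!: sel\<close>)
  have "block_query L {E} [n, n, n] (\<lambda>(M :: ('a, 'f, 'r) fo_struct) R e. \<not> mem M (tuples (univ M) n -
      {z \<in> tuples (univ M) n. (e(length [n, n, n] := z)) 2 @ (e(length [n, n, n] := z)) 3 \<in> R E}) (e 1))"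
    by (rule block_query_sub[OF fo_query_dual[OF mem_query] _ E1]) (auto intro: selector_block)
  then have 1: "block_query L {E} [n, n, n] (\<lambda>(M :: ('a, 'f, 'r) fo_struct) R e. \<not> mem M (tuples (univ M) n -
      {z \<in> tuples (univ M) n. e 2 @ z \<in> R E}) (e 1))"
    by simp
  have 2: "block_query L {E} [n, n, n] (\<lambda>(M :: ('a, 'f, 'r) fo_struct) R e. e 2 @ e 2 \<in> R E)"
    by (rule block_query_mem) (auto intro!: sel)
  have 3: "block_query L {E} ([n, n] @ [arity T]) (\<lambda>(M :: ('a, 'f, 'r) fo_struct) R e. e 2 @ e 2 \<in> R E \<and> \<not> mem M (tuples (univ M) n -
      {z \<in> tuples (univ M) n. e 2 @ z \<in> R E}) (e 1))" if "T \<in> {S}" for T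
    using block_query_and[OF 2 1] that by simp
  have "block_query L {E} [n, n] (\<lambda>(M :: ('a, 'f, 'r) fo_struct) R e. mem M {x' \<in> tuples (univ M) n.
      (e(length [n, n] := x')) 2 @ (e(length [n, n] := x')) 2 \<in> R E \<and> \<not> mem M (tuples (univ M) n -
      {z \<in> tuples (univ M) n. (e(length [n, n] := x')) 2 @ z \<in> R E}) ((e(length [n, n] := x')) 1)} (e 0))"
    by (rule block_query_sub[OF mem_query _ 3]) (auto intro: selector_block)
  then show "block_query L {E} [n, n] (\<lambda>(M :: ('a, 'f, 'r) fo_struct) R e. mem M {x' \<in> tuples (univ M) n. x' @ x' \<in> R E \<and>
       \<not> mem M (tuples (univ M) n - {z \<in> tuples (univ M) n. x' @ z \<in> R E}) (e 1)} (e 0))"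
    by (simp add: numeral_2_eq_2)
qed simp

definition step :: "('a, 'f, 'r) fo_struct \<Rightarrow> 'a list set \<Rightarrow> 'a list set" where
  "step M X = {w \<in> tuples (univ M) (n + n). body M X w}"

lemma mono_step:
  fixes M :: "('a, 'f, 'r) fo_struct"
  assumes "is_structure L M"
  shows "mono (step M)"
proof (rule monoI)
  fix X Y :: "'a list set" assume "X \<subseteq> Y"
  then show "step M X \<subseteq> step M Y"
    using fo_query_mono[OF body_query assms, of _ "\<lambda>_. X" "\<lambda>_. Y"] unfolding step_def snd_conv by blast
qed

lemma comparison:
  fixes M :: "('a, 'f, 'r) fo_struct"
  assumes "finite_structure L M"
  shows "stage_comparison (tuples (univ M) n) (induced_op M \<phi> S xs)"
proof
  show "finite (tuples (univ M) n)"
    using assms by (simp add: finite_structure_def finite_tuples)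
  show "mono (induced_op M \<phi> S xs)"
  proof (rule monoI)
    fix X Y :: "'a list set" assume "X \<subseteq> Y"
    then have "sat M ((\<lambda>_. {})(S := X)) v \<phi> \<longrightarrow> sat M ((\<lambda>_. {})(S := Y)) v \<phi>" for v
      using sat_mono[OF pe'(1), of "(\<lambda>_. {})(S := X)" "(\<lambda>_. {})(S := Y)" True M v] pe'(3) by (auto split: if_splits)
    then show "induced_op M \<phi> S xs X \<subseteq> induced_op M \<phi> S xs Y" unfolding induced_op_def by blast
  qed
  show "induced_op M \<phi> S xs X \<subseteq> tuples (univ M) n" for X
    using pe'(6) by (auto simp: induced_op_def)
qed

text \<open>That \<open>le\<close> is closed under the step bounds the fixed point from above. This
  bound is also the soundness that \<open>le_step_complete\<close> asks for in the other
  direction.\<close>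

lemma lfp_step:
  fixes M :: "('a, 'f, 'r) fo_struct"
  assumes M: "finite_structure L M" and xy: "x \<in> tuples (univ M) n" "y \<in> tuples (univ M) n"
  shows "x @ y \<in> lfp (step M) \<longleftrightarrow> stage_comparison.le (induced_op M \<phi> S xs) x y"
proof -
  interpret stage_comparison "tuples (univ M) n" "induced_op M \<phi> S xs" by (rule comparison[OF M])
  let ?U = "tuples (univ M) n"
  have str: "is_structure L M" using M by (simp add: finite_structure_def)
  have mem: "mem M X b \<longleftrightarrow> b \<in> induced_op M \<phi> S xs X" if "b \<in> ?U" for X b
    using that pe'(6) by (simp add: mem_def induced_op_def)
  have step_iff: "x @ y \<in> step M X \<longleftrightarrow> le_step (\<lambda>x y. x @ y \<in> X) x y" if "x \<in> ?U" "y \<in> ?U" for x y X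
  proof -
    have len: "length x = n" "length y = n" using that by (auto dest: tuples_length)
    have eq: "?U - {z \<in> ?U. x' @ z \<in> X} = {z \<in> ?U. x' @ z \<notin> X}" for x' by blast
    have B: "blocks [n, n] (x @ y) 0 = x" "blocks [n, n] (x @ y) 1 = y" using len by simp_all
    show ?thesis
      unfolding step_def body_def Let_def B eq mem_Collect_eq mem[OF that(1)] mem[OF that(2)] le_step_def
      using that len by simp
  qed
  have fp: "lfp (step M) = step M (lfp (step M))"
    by (rule lfp_unfold[OF mono_step[OF str]])
  let ?T = "{w. \<exists>x \<in> ?U. \<exists>y \<in> ?U. w = x @ y \<and> le x y}"
  have T_iff: "x @ y \<in> ?T \<longleftrightarrow> le x y" if "x \<in> ?U" "y \<in> ?U" for x y
  proof -
    have "x = x' \<and> y = y'" if "x @ y = x' @ y'" "x' \<in> ?U" for x' y'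
      using that \<open>x \<in> ?U\<close> by (auto dest!: tuples_length)
    then show ?thesis using that by blast
  qed
  have "step M ?T \<subseteq> ?T"
  proof
    fix w assume w: "w \<in> step M ?T"
    then have "w \<in> tuples (univ M) (n + n)" by (simp add: step_def)
    then obtain x y where xy: "x \<in> ?U" "y \<in> ?U" "w = x @ y" unfolding tuples_split by blast
    with w have "le_step (\<lambda>x y. x @ y \<in> ?T) x y" using step_iff by blast
    moreover have "{x' \<in> ?U. x' @ x' \<in> ?T \<and> y \<notin> induced_op M \<phi> S xs {z \<in> ?U. x' @ z \<notin> ?T}} =
        {x' \<in> ?U. le x' x' \<and> y \<notin> induced_op M \<phi> S xs {z \<in> ?U. \<not> le x' z}}"
    proof -
      have "{z \<in> ?U. x' @ z \<notin> ?T} = {z \<in> ?U. \<not> le x' z}" if "x' \<in> ?U" for x'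
        using T_iff[OF that] by blast
      then show ?thesis using T_iff by (intro Collect_cong conj_cong) auto
    qed
    ultimately have "le_step le x y" unfolding le_step_def by simp
    then have "le x y" by (rule le_step_sound)
    with xy show "w \<in> ?T" by blast
  qed
  then have sub: "lfp (step M) \<subseteq> ?T" by (rule lfp_lowerbound)
  have sound: "le x y" if "x \<in> ?U" "y \<in> ?U" "x @ y \<in> lfp (step M)" for x y
    using that sub T_iff by blast
  have step: "x @ y \<in> lfp (step M)" if "x \<in> ?U" "y \<in> ?U" "le_step (\<lambda>x y. x @ y \<in> lfp (step M)) x y" for x y
    using step_iff[OF that(1,2), of "lfp (step M)"] that(3) fp by blast
  show ?thesis
  proof
    show "le x y" if "x @ y \<in> lfp (step M)" using sound[OF xy that] .
    assume le: "le x y"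
    then obtain k where "x \<in> J k" by (auto simp: le_def lfp_eq)
    from le_step_complete[of "\<lambda>x y. x @ y \<in> lfp (step M)", OF sound step this xy(2) le]
    show "x @ y \<in> lfp (step M)" .
  qed
qed

lemma linear_preorder_formula:
  obtains \<theta> y1 y2 where "length y1 = n" "length y2 = n" "partitioned_LFP L \<theta> y1 y2"
    "\<And>M :: ('a, 'f, 'r) fo_struct. finite_structure L M \<Longrightarrow> def_rel M \<theta> y1 y2 =
      {(a, b). a \<in> tuples (univ M) n \<and> b \<in> tuples (univ M) n \<and>
        (\<forall>k. b \<in> stage (induced_op M \<phi> S xs) k \<longrightarrow> a \<in> stage (induced_op M \<phi> S xs) k)}"
proof -
  obtain \<psi> where \<psi>: "positive_elementary L E [0..<arity E] \<psi>"
    and sat\<psi>: "\<And>(M :: ('a, 'f, 'r) fo_struct) R v b. is_structure L M \<Longrightarrow> b \<in> tuples (univ M) (arity E) \<Longrightarrow>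
      sat M R (assign v [0..<arity E] b) \<psi> \<longleftrightarrow> body M (R E) b"
    using fo_query_positive_elementary[OF body_query] by metis
  have "finite (vars \<psi> \<union> {..<n + n})" by (simp add: finite_vars)
  then obtain B where B: "vars \<psi> \<union> {..<n + n} \<subseteq> {..<B}"
    unfolding finite_nat_set_iff_bounded by blast
  define y1 y2 zs where "y1 = [B..<B + n]" and "y2 = [B + n..<B + n + n]" and "zs = [B + n + n..<B + n + n + n]"
  define FP where "FP us = Lfp E [0..<n + n] \<psi> us" for us
  \<comment> \<open>\<open>y1\<close> precedes \<open>y2\<close>, or \<open>y2\<close> never enters.
    The second case is the failure of \<open>y2 \<le> y2\<close>; since the arguments of
    \<open>Lfp\<close> have to be distinct, the second copy of \<open>y2\<close> is held by
    \<open>zs\<close>. Starting at \<open>B\<close> makes all of them fresh for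
    \<open>\<psi>\<close>.\<close>
  define \<theta> where "\<theta> = Neg (Conj (Neg (FP (y1 @ y2))) (Lets zs (map Var y2) (FP (y2 @ zs))))"
  have len: "length y1 = n" "length y2 = n" "length zs = n"
    by (simp_all add: y1_def y2_def zs_def)
  have dist: "distinct (y1 @ y2)" "distinct (y2 @ zs)" "distinct zs" "set y2 \<inter> set zs = {}"
    by (auto simp: y1_def y2_def zs_def)
  have fresh: "(set y1 \<union> set y2 \<union> set zs) \<inter> (vars \<psi> \<union> {..<n + n}) = {}"
    using B by (auto simp: y1_def y2_def zs_def)
  have wf: "wf_fm L (FP us)" "frv (FP us) = {}" "fv (FP us) \<subseteq> set us"
    if "us = y1 @ y2 \<or> us = y2 @ zs" for us
  proof -
    have 1: "wf_fm L \<psi>" "positive E \<psi>" "frv \<psi> \<subseteq> {E}" "fv \<psi> \<subseteq> {..<n + n}"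
      using \<psi> by (simp_all add: positive_elementary_def atLeast0LessThan)
    have 2: "distinct us" "length us = n + n" "set us \<inter> ({0..<n + n} \<union> vars \<psi>) = {}"
      using that dist len fresh by (auto simp: atLeast0LessThan)
    show "wf_fm L (FP us)" unfolding FP_def using 1 2 by simp
    show "frv (FP us) = {}" unfolding FP_def using 1 by auto
    show "fv (FP us) \<subseteq> set us" unfolding FP_def using 1 by (auto simp: atLeast0LessThan)
  qed
  have "partitioned_LFP L \<theta> y1 y2"
    using wf[of "y1 @ y2"] wf[of "y2 @ zs"] dist len
    by (auto simp: partitioned_LFP_def LFP_formula_def \<theta>_def)
  moreover have "def_rel M \<theta> y1 y2 =
      {(a, b). a \<in> tuples (univ M) n \<and> b \<in> tuples (univ M) n \<and>
        (\<forall>k. b \<in> stage (induced_op M \<phi> S xs) k \<longrightarrow> a \<in> stage (induced_op M \<phi> S xs) k)}"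
    if M: "finite_structure L M" for M :: "('a, 'f, 'r) fo_struct"
  proof -
    interpret stage_comparison "tuples (univ M) n" "induced_op M \<phi> S xs" by (rule comparison[OF M])
    have str: "is_structure L M" "finite (univ M)" using M by (simp_all add: finite_structure_def)
    have sat_FP: "sat M R v (FP us) \<longleftrightarrow> map v us \<in> lfp (step M)" for R v us
    proof -
      have "(\<lambda>X. {b \<in> tuples (univ M) (length [0..<n + n]). sat M (R(E := X)) (assign v [0..<n + n] b) \<psi>}) = step M"
        using sat\<psi>[OF str(1)] by (auto simp: fun_eq_iff step_def)
      moreover have "stage_union (step M) = lfp (step M)"
        by (rule stages_stabilise(2)[OF mono_step[OF str(1)] finite_tuples[OF str(2)]]) (auto simp: step_def)
      ultimately show ?thesis unfolding FP_def sat.simps by simp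
    qed
    have "holds M \<theta> (y1 @ y2) (a @ b) \<longleftrightarrow> (\<forall>k. b \<in> J k \<longrightarrow> a \<in> J k)"
      if ab: "a \<in> tuples (univ M) n" "b \<in> tuples (univ M) n" for a b
    proof -
      let ?v = "assign (\<lambda>_. undefined) (y1 @ y2) (a @ b)"
      have abl: "length a = n" "length b = n" using ab by (auto dest: tuples_length)
      have "map ?v (y1 @ y2) = a @ b" using dist len abl by (intro map_assign) auto
      then have va: "map ?v y1 = a" "map ?v y2 = b" using len abl by auto
      let ?w = "assign ?v zs b"
      have w: "map ?w zs = b" "map ?w y2 = b"
      proof -
        show "map ?w zs = b" using dist len abl by (intro map_assign) auto
        have "map ?w y2 = map ?v y2" using dist(4) by (auto intro!: assign_notin)
        then show "map ?w y2 = b" using va by simp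
      qed
      have tv: "map (tval M ?v) (map Var y2) = b" using va(2) by (simp add: comp_def)
      have "sat M (\<lambda>_. {}) ?v (Lets zs (map Var y2) (FP (y2 @ zs))) \<longleftrightarrow>
          sat M (\<lambda>_. {}) (assign ?v zs (map (tval M ?v) (map Var y2))) (FP (y2 @ zs))"
      proof (rule sat_Lets[OF dist(3)])
        show "tval M ?v t \<in> univ M" if "t \<in> set (map Var y2)" for t
        proof -
          have "tval M ?v t \<in> set b" using that tv by (metis imageI list.set_map)
          then show ?thesis using ab by (auto simp: tuples_def)
        qed
        show "tvars t \<inter> set zs = {}" if "t \<in> set (map Var y2)" for t
          using that dist(4) by auto
      qed (simp add: len)
      then have "sat M (\<lambda>_. {}) ?v (Lets zs (map Var y2) (FP (y2 @ zs))) \<longleftrightarrow> sat M (\<lambda>_. {}) ?w (FP (y2 @ zs))"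
        by (simp only: tv)
      then have "holds M \<theta> (y1 @ y2) (a @ b) \<longleftrightarrow> le a b \<or> \<not> le b b"
        unfolding holds_def \<theta>_def sat.simps sat_FP map_append va w
        using lfp_step[OF M ab] lfp_step[OF M ab(2,2)] by blast
      also have "\<dots> \<longleftrightarrow> (\<forall>k. b \<in> J k \<longrightarrow> a \<in> J k)" by (auto simp: le_def lfp_eq)
      finally show ?thesis .
    qed
    then show ?thesis by (auto simp: def_rel_def len)
  qed
  ultimately show ?thesis using that len by blast
qed

end

lemma proficient_imp_linear_preorder:
  fixes L :: "('f, 'r) language" and C :: "('a, 'f, 'r) fo_struct set"
  assumes fin: "\<forall>M \<in> C. finite_structure L M" and prof: "proficient L C"
  shows "has_unbounded_LFP_linear_preorder L C"
proof -
  from prof obtain S xs \<phi> where pe: "positive_elementary L S xs \<phi>"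
    and unb: "\<And>k. \<exists>M \<in> C. closure_ordinal M \<phi> S xs \<ge> k"
    unfolding proficient_def by blast
  interpret stage_preorder L S xs \<phi> by unfold_locales (rule pe)
  obtain \<theta> y1 y2 where len: "length y1 = n" "length y2 = n" and part: "partitioned_LFP L \<theta> y1 y2"
    and rel: "\<And>M :: ('a, 'f, 'r) fo_struct. finite_structure L M \<Longrightarrow> def_rel M \<theta> y1 y2 =
      {(a, b). a \<in> tuples (univ M) n \<and> b \<in> tuples (univ M) n \<and>
        (\<forall>k. b \<in> stage (induced_op M \<phi> S xs) k \<longrightarrow> a \<in> stage (induced_op M \<phi> S xs) k)}"
    by (rule linear_preorder_formula) (rule that; assumption)
  have lin: "linear_preorder_on (tuples (univ M) n) (def_rel M \<theta> y1 y2)"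
    and type: "\<exists>m \<ge> closure_ordinal M \<phi> S xs. has_order_type (tuples (univ M) n) (def_rel M \<theta> y1 y2) m"
    if "M \<in> C" for M
  proof -
    have M: "finite_structure L M" using that fin by blast
    interpret stage_comparison "tuples (univ M) n" "induced_op M \<phi> S xs" by (rule comparison[OF M])
    note * = closure_index_le_classes[folded rel[OF M]]
    show "linear_preorder_on (tuples (univ M) n) (def_rel M \<theta> y1 y2)" by (rule *(1))
    from *(2) has_order_type_card[OF *(1) finite_U]
    show "\<exists>m \<ge> closure_ordinal M \<phi> S xs. has_order_type (tuples (univ M) n) (def_rel M \<theta> y1 y2) m"
      unfolding closure_ordinal_def by blast
  qed
  have "\<exists>M \<in> C. \<exists>m \<ge> k. has_order_type (tuples (univ M) n) (def_rel M \<theta> y1 y2) m" for k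
  proof -
    from unb obtain M where M: "M \<in> C" "closure_ordinal M \<phi> S xs \<ge> k" by blast
    from type[OF M(1)] obtain m where "m \<ge> closure_ordinal M \<phi> S xs"
      "has_order_type (tuples (univ M) n) (def_rel M \<theta> y1 y2) m" by blast
    with M show ?thesis by (intro bexI[of _ M] exI[of _ m]) auto
  qed
  then show ?thesis
    unfolding has_unbounded_LFP_linear_preorder_def using len part lin by blast
qed

theorem theorem2p9:
  fixes L :: "('f, 'r) language" and C :: "('a, 'f, 'r) fo_struct set"
  assumes "\<forall>M \<in> C. finite_structure L M"
  shows "(proficient L C \<longleftrightarrow> has_LFP_sOP L C) \<and>
         (has_LFP_sOP L C \<longleftrightarrow> has_unbounded_LFP_preorder L C) \<and>
         (has_unbounded_LFP_preorder L C \<longleftrightarrow> has_unbounded_LFP_linear_preorder L C)"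
  using proficient_imp_linear_preorder[OF assms] linear_preorder_imp_preorder[of L C]
    preorder_imp_sOP[of L C] sOP_imp_proficient[OF assms] by blast

end
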